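(* Let $(M,g)$ be a semi-Riemannian manifold and let $\Omega\subset M$ be an open subset with $C^2$ boundary $\partial\Omega$, where $\partial\Omega=\phi^{-1}(0)$ for a $C^2$ function $\phi\colon M\to\mathbb{R}$ having $0$ as a regular value and such that $\phi(x)>0$ for each $x\in\Omega$. Then: (1) local convexity, infinitesimal convexity and geometric convexity of $\partial\Omega$ are equivalent; (2) time-infinitesimal convexity of $\partial\Omega$ is equivalent to time-geometric convexity of $\partial\Omega$, and space-infinitesimal convexity of $\partial\Omega$ is equivalent to space-geometric convexity of $\partial\Omega$.
   Context: Standing regularity: $M$ has a differentiable structure of class at least $C^2$, and $g$ is differentiable with locally Lipschitz differential. $\nabla$ is the Levi-Civita connection of $g$, $\exp$ its exponential map, and $H_\phi=\nabla(\mathrm{d}\phi)$ is the Hessian of $\phi$. A tangent vector $v\ne 0$ is timelike if $g(v,v)<0$ and spacelike if $g(v,v)>0$; a geodesic is timelike (resp. spacelike) if its velocity is. The metric induced on $\partial\Omega$ may be degenerate. Definitions: - $\partial\Omega$ is infinitesimally convex if $(H_\phi)_x(v,v)\le 0$ for every $x\in\partial\Omega$ and $v\in T_x\partial\Omega$; it is time- (resp. space-) infinitesimally convex if this inequality holds for every $x\in\partial\Omega$ and every timelike (resp. spacelike) $v\in T_x\partial\Omega$. - $\partial\Omega$ is locally convex if for every $x\in\partial\Omega$ there is a neighborhood $O$ of $0$ in $T_x\partial\Omega$ such that $\exp_x(O)\subset M\setminus\Omega$ (geodesics issuing from $x$ tangentially to $\partial\Omega$ locally do not enter $\Omega$). -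 $\partial\Omega$ is geometrically convex if for any $p,q\in\Omega$ and any geodesic arc $\gamma\colon[0,1]\to M$ from $p$ to $q$: if $\gamma([0,1])\subset\Omega\cup\partial\Omega$ then $\gamma([0,1])\subset\Omega$. It is time- (resp. space-) geometrically convex if this holds for all timelike (resp. spacelike) geodesic arcs $\gamma$. *)

theory Defs
  imports "HOL-Analysis.Analysis"
begin

section \<open>Differentiability classes on open subsets of coordinate space\<close>

text \<open>Meant for open \<open>S\<close>.  In finite dimension, continuity of the differential is the same as
  continuity of all directional derivatives \<open>x \<mapsto> Df(x) h\<close>.\<close>

primrec Ck_on :: "nat \<Rightarrow> (real^'n) set \<Rightarrow> (real^'n \<Rightarrow> 'b::real_normed_vector) \<Rightarrow> bool" where
  "Ck_on 0 S f \<longleftrightarrow> continuous_on S f"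
| "Ck_on (Suc k) S f \<longleftrightarrow> (\<forall>x\<in>S. f differentiable (at x)) \<and>
     (\<forall>h. Ck_on k S (\<lambda>x. frechet_derivative f (at x) h))"

definition locally_Lipschitz_on :: "(real^'n) set \<Rightarrow> (real^'n \<Rightarrow> real) \<Rightarrow> bool" where
  "locally_Lipschitz_on S f \<longleftrightarrow> (\<forall>x\<in>S. \<exists>u>0. \<exists>L. L-lipschitz_on (cball x u \<inter> S) f)"

definition C11_on :: "(real^'n) set \<Rightarrow> (real^'n \<Rightarrow> real) \<Rightarrow> bool" where
  "C11_on S f \<longleftrightarrow> (\<forall>x\<in>S. f differentiable (at x)) \<and>
     (\<forall>h. locally_Lipschitz_on S (\<lambda>x. frechet_derivative f (at x) h))"


section \<open>Manifolds given by a \<open>C\<^sup>2\<close> atlas\<close>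

text \<open>A chart is a pair \<open>(U, \<psi>)\<close>; only the values of \<open>\<psi>\<close> on \<open>U\<close> matter.  The manifold is
  the whole type \<open>'a\<close>.  The atlas need not be maximal.\<close>

type_synonym ('a, 'n) chart = "'a set \<times> ('a \<Rightarrow> real^'n)"

definition chart_inv :: "('a, 'n) chart \<Rightarrow> real^'n \<Rightarrow> 'a" where
  "chart_inv c = inv_into (fst c) (snd c)"

definition charts_at :: "('a, 'n) chart set \<Rightarrow> 'a \<Rightarrow> ('a, 'n) chart set" where
  "charts_at A x = {c \<in> A. x \<in> fst c}"

definition chart_at :: "('a, 'n) chart set \<Rightarrow> 'a \<Rightarrow> ('a, 'n) chart" where
  "chart_at A x = (SOME c. c \<in> charts_at A x)"

definition C2_atlas ::
    "('a::{t2_space,second_countable_topology}, 'n::finite) chart set \<Rightarrow> bool" where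
  "C2_atlas A \<longleftrightarrow>
     (\<Union>c\<in>A. fst c) = UNIV \<and>
     (\<forall>c\<in>A. open (fst c) \<and> open (snd c ` fst c) \<and>
        homeomorphism (fst c) (snd c ` fst c) (snd c) (chart_inv c)) \<and>
     (\<forall>c\<in>A. \<forall>d\<in>A. Ck_on 2 (snd c ` (fst c \<inter> fst d)) (snd d \<circ> chart_inv c))"

definition C2_function :: "('a, 'n::finite) chart set \<Rightarrow> ('a \<Rightarrow> real) \<Rightarrow> bool" where
  "C2_function A f \<longleftrightarrow> (\<forall>c\<in>A. Ck_on 2 (snd c ` fst c) (f \<circ> chart_inv c))"


section \<open>Tangent vectors\<close>

text \<open>A tangent vector at \<open>x\<close> is the family of its components in all charts around \<open>x\<close>, related
  by the differentials of the transition maps; the entries for other indices are \<open>0\<close>.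
  The vector space operations and the topology (product topology) are the pointwise ones;
  for \<open>c\<close> around \<open>x\<close>, evaluation at \<open>c\<close> is a linear homeomorphism onto \<open>real^'n\<close>.\<close>

type_synonym ('a, 'n) tangent = "('a, 'n) chart \<Rightarrow> real^'n"

definition zero_tangent :: "('a, 'n::finite) tangent" where
  "zero_tangent = (\<lambda>c. 0)"

definition tangent_space ::
    "('a, 'n::finite) chart set \<Rightarrow> 'a \<Rightarrow> ('a, 'n) tangent set" where
  "tangent_space A x = {v.
     (\<forall>c\<in>charts_at A x. \<forall>d\<in>charts_at A x.
        v d = frechet_derivative (snd d \<circ> chart_inv c) (at (snd c x)) (v c)) \<and>
     (\<forall>c. c \<notin> charts_at A x \<longrightarrow> v c = 0)}"

text \<open>The tangent vector at \<open>x\<close> with components \<open>u\<close> in the chart \<open>c\<close>.\<close>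

definition tangent_of ::
    "('a, 'n::finite) chart set \<Rightarrow> ('a, 'n) chart \<Rightarrow> 'a \<Rightarrow> real^'n \<Rightarrow> ('a, 'n) tangent" where
  "tangent_of A c x u = (\<lambda>d. if d \<in> charts_at A x
     then frechet_derivative (snd d \<circ> chart_inv c) (at (snd c x)) u else 0)"

definition differential ::
    "('a, 'n::finite) chart set \<Rightarrow> ('a \<Rightarrow> real) \<Rightarrow> 'a \<Rightarrow> ('a, 'n) tangent \<Rightarrow> real" where
  "differential A f x v =
     (let c = chart_at A x in frechet_derivative (f \<circ> chart_inv c) (at (snd c x)) (v c))"

definition regular_value ::
    "('a, 'n::finite) chart set \<Rightarrow> ('a \<Rightarrow> real) \<Rightarrow> real \<Rightarrow> bool" where
  "regular_value A f r \<longleftrightarrow> (\<forall>x. f x = r \<longrightarrow> differential A f x ` tangent_space A x = UNIV)"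

definition velocity ::
    "('a, 'n::finite) chart set \<Rightarrow> real set \<Rightarrow> (real \<Rightarrow> 'a) \<Rightarrow> real \<Rightarrow> ('a, 'n) tangent" where
  "velocity A I \<gamma> t = (\<lambda>c. if c \<in> charts_at A (\<gamma> t)
     then vector_derivative (snd c \<circ> \<gamma>) (at t within I) else 0)"

definition C1_curve ::
    "('a::topological_space, 'n::finite) chart set \<Rightarrow> real set \<Rightarrow> (real \<Rightarrow> 'a) \<Rightarrow> bool" where
  "C1_curve A I \<gamma> \<longleftrightarrow> continuous_on I \<gamma> \<and>
     (\<forall>c\<in>A. (\<forall>t\<in>I. \<gamma> t \<in> fst c \<longrightarrow> (snd c \<circ> \<gamma>) differentiable (at t within I)) \<and>
            continuous_on {t\<in>I. \<gamma> t \<in> fst c} (\<lambda>t. velocity A I \<gamma> t c))"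

text \<open>\<open>T\<^sub>xS\<close>, for a hypersurface \<open>S\<close>: the velocities at \<open>x\<close> of the \<open>C\<^sup>1\<close> curves lying in \<open>S\<close>.\<close>

definition tangent_space_sub ::
    "('a::topological_space, 'n::finite) chart set \<Rightarrow> 'a set \<Rightarrow> 'a \<Rightarrow> ('a, 'n) tangent set" where
  "tangent_space_sub A S x = {v. \<exists>\<epsilon>>0. \<exists>\<gamma>. C1_curve A {-\<epsilon><..<\<epsilon>} \<gamma> \<and>
     \<gamma> ` {-\<epsilon><..<\<epsilon>} \<subseteq> S \<and> \<gamma> 0 = x \<and> velocity A {-\<epsilon><..<\<epsilon>} \<gamma> 0 = v}"


section \<open>Semi-Riemannian metrics\<close>

type_synonym ('a, 'n) metric = "'a \<Rightarrow> ('a, 'n) tangent \<Rightarrow> ('a, 'n) tangent \<Rightarrow> real"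

definition metric_matrix ::
    "('a, 'n::finite) chart set \<Rightarrow> ('a, 'n) metric \<Rightarrow> ('a, 'n) chart \<Rightarrow> real^'n \<Rightarrow> real^'n^'n" where
  "metric_matrix A g c y = (\<chi> i j. let x = chart_inv c y in
     g x (tangent_of A c x (axis i 1)) (tangent_of A c x (axis j 1)))"

definition scalar_product_on ::
    "('a, 'n::finite) tangent set \<Rightarrow>
     (('a, 'n) tangent \<Rightarrow> ('a, 'n) tangent \<Rightarrow> real) \<Rightarrow> bool" where
  "scalar_product_on T b \<longleftrightarrow>
     (\<forall>u\<in>T. \<forall>v\<in>T. b u v = b v u) \<and>
     (\<forall>u\<in>T. \<forall>v\<in>T. \<forall>w\<in>T. \<forall>r s. b (\<lambda>c. r *\<^sub>R u c + s *\<^sub>R v c) w = r * b u w + s * b v w) \<and>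
     (\<forall>u\<in>T. (\<forall>w\<in>T. b u w = 0) \<longrightarrow> u = zero_tangent)"

definition index_of_matrix :: "real^'n^'n \<Rightarrow> nat" where
  "index_of_matrix B = (GREATEST k. \<exists>V. subspace V \<and> dim V = k \<and>
     (\<forall>u\<in>V. u \<noteq> 0 \<longrightarrow> u \<bullet> (B *v u) < 0))"

text \<open>As usual, a semi-Riemannian metric is required to have constant index.  The regularity of \<open>g\<close>
  is imposed in the charts of the given atlas \<open>A\<close>, as it is not invariant under arbitrary
  \<open>C\<^sup>2\<close> changes of coordinates.\<close>

definition semi_riemannian_manifold ::
    "('a::{t2_space,second_countable_topology}, 'n::finite) chart set \<Rightarrow>
     ('a, 'n) metric \<Rightarrow> bool" where
  "semi_riemannian_manifold A g \<longleftrightarrow>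
     C2_atlas A \<and>
     (\<forall>x. scalar_product_on (tangent_space A x) (g x)) \<and>
     (\<exists>\<nu>. \<forall>x. \<forall>c\<in>charts_at A x. index_of_matrix (metric_matrix A g c (snd c x)) = \<nu>) \<and>
     (\<forall>c\<in>A. \<forall>i j. C11_on (snd c ` fst c) (\<lambda>y. metric_matrix A g c y $ i $ j))"

definition timelike ::
    "('a, 'n::finite) chart set \<Rightarrow> ('a, 'n) metric \<Rightarrow> 'a \<Rightarrow> ('a, 'n) tangent \<Rightarrow> bool" where
  "timelike A g x v \<longleftrightarrow> v \<in> tangent_space A x \<and> v \<noteq> zero_tangent \<and> g x v v < 0"

definition spacelike ::
    "('a, 'n::finite) chart set \<Rightarrow> ('a, 'n) metric \<Rightarrow> 'a \<Rightarrow> ('a, 'n) tangent \<Rightarrow> bool" where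
  "spacelike A g x v \<longleftrightarrow> v \<in> tangent_space A x \<and> v \<noteq> zero_tangent \<and> g x v v > 0"


section \<open>Levi-Civita connection, Hessian, geodesics and exponential map\<close>

text \<open>\<open>\<partial>\<^sub>k g\<^sub>i\<^sub>j\<close> and the Christoffel symbols \<open>\<Gamma>\<^sup>k\<^sub>i\<^sub>j\<close> of the Levi-Civita connection in the chart \<open>c\<close>,
  at the coordinates \<open>y\<close>; see \<open>christoffel_sym\<close> and \<open>christoffel_metric\<close> below.\<close>

definition metric_deriv ::
    "('a, 'n::finite) chart set \<Rightarrow> ('a, 'n) metric \<Rightarrow> ('a, 'n) chart \<Rightarrow> real^'n \<Rightarrow>
     'n \<Rightarrow> 'n \<Rightarrow> 'n \<Rightarrow> real" where
  "metric_deriv A g c y k i j =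
     frechet_derivative (\<lambda>z. metric_matrix A g c z $ i $ j) (at y) (axis k 1)"

definition christoffel ::
    "('a, 'n::finite) chart set \<Rightarrow> ('a, 'n) metric \<Rightarrow> ('a, 'n) chart \<Rightarrow> real^'n \<Rightarrow>
     'n \<Rightarrow> 'n \<Rightarrow> 'n \<Rightarrow> real" where
  "christoffel A g c y k i j =
     (1/2) * (\<Sum>l\<in>UNIV. matrix_inv (metric_matrix A g c y) $ k $ l *
       (metric_deriv A g c y i j l + metric_deriv A g c y j i l - metric_deriv A g c y l i j))"

text \<open>Covariant derivative of a 1-form, \<open>(\<nabla>\<alpha>)\<^sub>i\<^sub>j = \<partial>\<^sub>i \<alpha>\<^sub>j - \<Gamma>\<^sup>k\<^sub>i\<^sub>j \<alpha>\<^sub>k\<close>, computed in any chart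
  around the point; \<open>form_coeff\<close> gives the components \<open>\<alpha>\<^sub>j\<close>.\<close>

definition form_coeff ::
    "('a, 'n::finite) chart set \<Rightarrow> ('a \<Rightarrow> ('a, 'n) tangent \<Rightarrow> real) \<Rightarrow> ('a, 'n) chart \<Rightarrow>
     real^'n \<Rightarrow> 'n \<Rightarrow> real" where
  "form_coeff A \<alpha> c y j = (let x = chart_inv c y in \<alpha> x (tangent_of A c x (axis j 1)))"

definition cov_deriv_form ::
    "('a, 'n::finite) chart set \<Rightarrow> ('a, 'n) metric \<Rightarrow> ('a \<Rightarrow> ('a, 'n) tangent \<Rightarrow> real) \<Rightarrow> 'a \<Rightarrow>
     ('a, 'n) tangent \<Rightarrow> ('a, 'n) tangent \<Rightarrow> real" where
  "cov_deriv_form A g \<alpha> x v w = (let c = chart_at A x; y = snd c x in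
     \<Sum>i\<in>UNIV. \<Sum>j\<in>UNIV. v c $ i * w c $ j *
       (frechet_derivative (\<lambda>z. form_coeff A \<alpha> c z j) (at y) (axis i 1) -
        (\<Sum>k\<in>UNIV. christoffel A g c y k i j * form_coeff A \<alpha> c y k)))"

definition hessian ::
    "('a, 'n::finite) chart set \<Rightarrow> ('a, 'n) metric \<Rightarrow> ('a \<Rightarrow> real) \<Rightarrow> 'a \<Rightarrow>
     ('a, 'n) tangent \<Rightarrow> ('a, 'n) tangent \<Rightarrow> real" where
  "hessian A g f = cov_deriv_form A g (differential A f)"

text \<open>The geodesic equation \<open>(x\<^sup>k)'' = - \<Gamma>\<^sup>k\<^sub>i\<^sub>j (x\<^sup>i)' (x\<^sup>j)'\<close> in every chart; derivatives are one-sided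
  at the end points of \<open>I\<close>.  Constant curves are included.\<close>

definition geodesic_on ::
    "('a::topological_space, 'n::finite) chart set \<Rightarrow> ('a, 'n) metric \<Rightarrow> real set \<Rightarrow>
     (real \<Rightarrow> 'a) \<Rightarrow> bool" where
  "geodesic_on A g I \<gamma> \<longleftrightarrow> continuous_on I \<gamma> \<and>
     (\<forall>c\<in>A. \<forall>t\<in>I. \<gamma> t \<in> fst c \<longrightarrow>
        (snd c \<circ> \<gamma>) differentiable (at t within I) \<and>
        ((\<lambda>s. velocity A I \<gamma> s c) has_vector_derivative
           (\<chi> k. - (\<Sum>i\<in>UNIV. \<Sum>j\<in>UNIV. christoffel A g c (snd c (\<gamma> t)) k i j *
              velocity A I \<gamma> t c $ i * velocity A I \<gamma> t c $ j))) (at t within I))"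

definition exp_geodesic ::
    "('a::topological_space, 'n::finite) chart set \<Rightarrow> ('a, 'n) metric \<Rightarrow> 'a \<Rightarrow>
     ('a, 'n) tangent \<Rightarrow> (real \<Rightarrow> 'a) \<Rightarrow> bool" where
  "exp_geodesic A g x v \<gamma> \<longleftrightarrow>
     geodesic_on A g {0..1} \<gamma> \<and> \<gamma> 0 = x \<and> velocity A {0..1} \<gamma> 0 = v"

definition exp_domain ::
    "('a::topological_space, 'n::finite) chart set \<Rightarrow> ('a, 'n) metric \<Rightarrow> 'a \<Rightarrow>
     ('a, 'n) tangent set" where
  "exp_domain A g x = {v \<in> tangent_space A x. \<exists>\<gamma>. exp_geodesic A g x v \<gamma>}"

text \<open>Geodesics being determined by their initial velocity, the choice of \<open>\<gamma>\<close> is immaterial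
  for \<open>v\<close> in \<open>exp_domain A g x\<close>; other values are meaningless.\<close>

definition exp_map ::
    "('a::topological_space, 'n::finite) chart set \<Rightarrow> ('a, 'n) metric \<Rightarrow> 'a \<Rightarrow>
     ('a, 'n) tangent \<Rightarrow> 'a" where
  "exp_map A g x v = (SOME \<gamma>. exp_geodesic A g x v \<gamma>) 1"

text \<open>The Christoffel symbols are those of the torsion-free connection compatible with the metric.
  For a semi-Riemannian metric the assumptions hold with \<open>S\<close> the image of the chart \<open>c\<close>.\<close>

lemma metric_deriv_sym:
  assumes S: "open S" "y \<in> S"
    and sym: "\<And>z i j. z \<in> S \<Longrightarrow> metric_matrix A g c z $ i $ j = metric_matrix A g c z $ j $ i"
  shows "metric_deriv A g c y k i j = metric_deriv A g c y k j i"
proof -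
  have "((\<lambda>z. metric_matrix A g c z $ i $ j) has_derivative D) (at y) \<longleftrightarrow>
        ((\<lambda>z. metric_matrix A g c z $ j $ i) has_derivative D) (at y)" for D
    by (rule iffI; erule has_derivative_transform_within_open[OF _ S]; rule sym)
  then show ?thesis by (simp add: metric_deriv_def frechet_derivative_def)
qed

lemma christoffel_sym:
  assumes "open S" "y \<in> S"
    and "\<And>z i j. z \<in> S \<Longrightarrow> metric_matrix A g c z $ i $ j = metric_matrix A g c z $ j $ i"
  shows "christoffel A g c y k i j = christoffel A g c y k j i"
proof -
  have "metric_deriv A g c y l i j = metric_deriv A g c y l j i" for l i j
    by (rule metric_deriv_sym[OF assms])
  then show ?thesis by (simp add: christoffel_def add.commute)
qed

lemma christoffel_metric:
  assumes S: "open S" "y \<in> S"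
    and sym: "\<And>z i j. z \<in> S \<Longrightarrow> metric_matrix A g c z $ i $ j = metric_matrix A g c z $ j $ i"
    and inv: "invertible (metric_matrix A g c y)"
  shows "metric_deriv A g c y k i j =
    (\<Sum>l\<in>UNIV. christoffel A g c y l k i * metric_matrix A g c y $ l $ j) +
    (\<Sum>l\<in>UNIV. christoffel A g c y l k j * metric_matrix A g c y $ i $ l)"
proof -
  let ?G = "metric_matrix A g c y" and ?d = "metric_deriv A g c y"
  have dsym: "?d l i j = ?d l j i" for l i j
    by (rule metric_deriv_sym[OF S sym])
  have GI: "(\<Sum>l\<in>UNIV. ?G $ j $ l * matrix_inv ?G $ l $ m) = (if j = m then 1 else 0)" for j m
  proof -
    have "?G ** matrix_inv ?G = mat 1"
      using someI_ex[OF inv[unfolded invertible_def]] unfolding matrix_inv_def by blast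
    then have "(?G ** matrix_inv ?G) $ j $ m = mat 1 $ j $ m"
      by simp
    then show ?thesis by (simp add: matrix_matrix_mult_def mat_def)
  qed
  have low: "(\<Sum>l\<in>UNIV. christoffel A g c y l k i * ?G $ j $ l) =
      (1/2) * (?d k i j + ?d i k j - ?d j k i)" for k i j
  proof -
    let ?e = "\<lambda>m. ?d k i m + ?d i k m - ?d m k i"
    have "(\<Sum>l\<in>UNIV. christoffel A g c y l k i * ?G $ j $ l) =
        (\<Sum>l\<in>UNIV. \<Sum>m\<in>UNIV. (1/2) * (?G $ j $ l * matrix_inv ?G $ l $ m) * ?e m)"
      unfolding christoffel_def
      by (intro sum.cong refl)
         (simp add: sum_distrib_left sum_distrib_right sum_divide_distrib mult_ac)
    also have "\<dots> = (\<Sum>m\<in>UNIV. (1/2) * (\<Sum>l\<in>UNIV. ?G $ j $ l * matrix_inv ?G $ l $ m) * ?e m)"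
      by (subst sum.swap) (simp add: sum_distrib_left sum_distrib_right)
    also have "\<dots> = (\<Sum>m\<in>UNIV. if m = j then (1/2) * ?e m else 0)"
      unfolding GI by (intro sum.cong) auto
    finally show ?thesis by simp
  qed
  have "(\<Sum>l\<in>UNIV. christoffel A g c y l k i * ?G $ l $ j) =
      (\<Sum>l\<in>UNIV. christoffel A g c y l k i * ?G $ j $ l)"
    using sym[OF S(2)] by (intro sum.cong refl) metis
  then show ?thesis using low[of k i j] low[of k j i] dsym[of k i j] dsym[of i k j] dsym[of j k i]
    by (simp add: field_simps)
qed


section \<open>Notions of convexity of \<open>\<partial>\<Omega>\<close>\<close>

definition infinitesimally_convex ::
    "('a::topological_space, 'n::finite) chart set \<Rightarrow> ('a, 'n) metric \<Rightarrow> ('a \<Rightarrow> real) \<Rightarrow>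
     'a set \<Rightarrow> bool" where
  "infinitesimally_convex A g \<phi> \<Omega> \<longleftrightarrow>
     (\<forall>x\<in>frontier \<Omega>. \<forall>v\<in>tangent_space_sub A (frontier \<Omega>) x. hessian A g \<phi> x v v \<le> 0)"

definition time_infinitesimally_convex ::
    "('a::topological_space, 'n::finite) chart set \<Rightarrow> ('a, 'n) metric \<Rightarrow> ('a \<Rightarrow> real) \<Rightarrow>
     'a set \<Rightarrow> bool" where
  "time_infinitesimally_convex A g \<phi> \<Omega> \<longleftrightarrow>
     (\<forall>x\<in>frontier \<Omega>. \<forall>v\<in>tangent_space_sub A (frontier \<Omega>) x.
        timelike A g x v \<longrightarrow> hessian A g \<phi> x v v \<le> 0)"

definition space_infinitesimally_convex ::
    "('a::topological_space, 'n::finite) chart set \<Rightarrow> ('a, 'n) metric \<Rightarrow> ('a \<Rightarrow> real) \<Rightarrow>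
     'a set \<Rightarrow> bool" where
  "space_infinitesimally_convex A g \<phi> \<Omega> \<longleftrightarrow>
     (\<forall>x\<in>frontier \<Omega>. \<forall>v\<in>tangent_space_sub A (frontier \<Omega>) x.
        spacelike A g x v \<longrightarrow> hessian A g \<phi> x v v \<le> 0)"

definition locally_convex ::
    "('a::topological_space, 'n::finite) chart set \<Rightarrow> ('a, 'n) metric \<Rightarrow> 'a set \<Rightarrow> bool" where
  "locally_convex A g \<Omega> \<longleftrightarrow>
     (\<forall>x\<in>frontier \<Omega>. \<exists>O'. openin (top_of_set (tangent_space_sub A (frontier \<Omega>) x)) O' \<and>
        zero_tangent \<in> O' \<and> O' \<subseteq> exp_domain A g x \<and> exp_map A g x ` O' \<subseteq> - \<Omega>)"

definition geodesic_arc ::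
    "('a::topological_space, 'n::finite) chart set \<Rightarrow> ('a, 'n) metric \<Rightarrow> 'a \<Rightarrow> 'a \<Rightarrow>
     (real \<Rightarrow> 'a) \<Rightarrow> bool" where
  "geodesic_arc A g p q \<gamma> \<longleftrightarrow> geodesic_on A g {0..1} \<gamma> \<and> \<gamma> 0 = p \<and> \<gamma> 1 = q"

definition geometrically_convex ::
    "('a::topological_space, 'n::finite) chart set \<Rightarrow> ('a, 'n) metric \<Rightarrow> 'a set \<Rightarrow> bool" where
  "geometrically_convex A g \<Omega> \<longleftrightarrow>
     (\<forall>p\<in>\<Omega>. \<forall>q\<in>\<Omega>. \<forall>\<gamma>. geodesic_arc A g p q \<gamma> \<longrightarrow>
        \<gamma> ` {0..1} \<subseteq> \<Omega> \<union> frontier \<Omega> \<longrightarrow> \<gamma> ` {0..1} \<subseteq> \<Omega>)"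

definition time_geometrically_convex ::
    "('a::topological_space, 'n::finite) chart set \<Rightarrow> ('a, 'n) metric \<Rightarrow> 'a set \<Rightarrow> bool" where
  "time_geometrically_convex A g \<Omega> \<longleftrightarrow>
     (\<forall>p\<in>\<Omega>. \<forall>q\<in>\<Omega>. \<forall>\<gamma>. geodesic_arc A g p q \<gamma> \<longrightarrow>
        (\<forall>t\<in>{0..1}. timelike A g (\<gamma> t) (velocity A {0..1} \<gamma> t)) \<longrightarrow>
        \<gamma> ` {0..1} \<subseteq> \<Omega> \<union> frontier \<Omega> \<longrightarrow> \<gamma> ` {0..1} \<subseteq> \<Omega>)"

definition space_geometrically_convex ::
    "('a::topological_space, 'n::finite) chart set \<Rightarrow> ('a, 'n) metric \<Rightarrow> 'a set \<Rightarrow> bool" where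
  "space_geometrically_convex A g \<Omega> \<longleftrightarrow>
     (\<forall>p\<in>\<Omega>. \<forall>q\<in>\<Omega>. \<forall>\<gamma>. geodesic_arc A g p q \<gamma> \<longrightarrow>
        (\<forall>t\<in>{0..1}. spacelike A g (\<gamma> t) (velocity A {0..1} \<gamma> t)) \<longrightarrow>
        \<gamma> ` {0..1} \<subseteq> \<Omega> \<union> frontier \<Omega> \<longrightarrow> \<gamma> ` {0..1} \<subseteq> \<Omega>)"

end

theory Submission
  imports Defs
begin

text \<open>Let \<open>\<gamma>\<close> be a geodesic in a chart around a boundary point and let \<open>e\<close> be a direction transversal to
  \<open>\<partial>\<Omega>\<close>.  The foot \<open>\<beta>(t) = \<gamma>(t) - \<sigma>(t) e\<close> is defined by \<open>\<phi>(\<beta>(t)) = 0\<close>; then \<open>\<sigma>\<close> and \<open>\<phi> \<circ> \<gamma>\<close> have the same sign.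
  Differentiating twice gives
  \<open>\<sigma>'' d\<phi>(\<beta>) e = H\<^sub>\<phi>(\<beta>)(\<beta>', \<beta>') + d\<phi>(\<beta>)(\<Gamma>\<^sub>\<beta>(\<beta>', \<beta>') - \<Gamma>\<^sub>\<gamma>(\<gamma>', \<gamma>'))\<close>, where \<open>\<beta>'\<close> is tangent to \<open>\<partial>\<Omega>\<close>.
  Infinitesimal convexity and the Lipschitz continuity of \<open>\<Gamma>\<close> yield \<open>\<sigma>'' \<le> C (|\<sigma>| + |\<sigma>'|)\<close>, so that
  \<open>\<sigma>(0) = \<sigma>'(0) = 0\<close> forces \<open>\<sigma> \<le> 0\<close> on a short interval: a geodesic tangent to \<open>\<partial>\<Omega>\<close> does not enter \<open>\<Omega>\<close>.
  Conversely, if \<open>H\<^sub>\<phi>(v, v) > 0\<close> for some \<open>v\<close> tangent to \<open>\<partial>\<Omega>\<close>, then \<open>\<phi>\<close> is positive along the geodesic with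
  velocity \<open>v\<close>, except at the point of contact.\<close>

section \<open>Second derivatives\<close>

text \<open>Differentiating \<phi> \<circ> \<gamma> twice would put the Hessian at \<gamma>(t), off
  \<partial>\<Omega> and on a vector that need not be tangent, where convexity says nothing; moving
  it to the boundary would require a Lipschitz modulus for the second derivatives of \<phi>, which
  are merely continuous. This is what the foot is for. The projection direction is a constant chart
  vector \<open>e\<close>, since the gradient of \<phi> is only C1 and is tangent to
  \<partial>\<Omega> where the induced metric degenerates. The causal versions are treated at once
  through a set \<open>C\<close> of admissible values g(v, v). Its openness keeps the foot velocity
  admissible near a contact; its stability under positive factors permits rescaling of geodesics.
  Geometric convexity uses the estimate backwards from the first contact. Local convexity uses it
  forwards over unit time, which works because the constant of the estimate tends to 0 with the
  speed. As \<open>exp_map\<close> selects some geodesic, the a priori bounds are proved for every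
  geodesic with a small initial velocity.\<close>

abbreviation fderiv :: "(real^'n \<Rightarrow> 'b::real_normed_vector) \<Rightarrow> real^'n \<Rightarrow> real^'n \<Rightarrow> 'b" where
  "fderiv f y \<equiv> frechet_derivative f (at y)"

text \<open>The inner direction \<open>k\<close> stays fixed while the base point moves in the
  direction \<open>h\<close>, as in \<open>Ck_on\<close>. Linearity in \<open>h\<close> is that of a
  derivative; linearity in \<open>k\<close> and symmetry need proofs.\<close>

definition fderiv2 ::
    "(real^'n \<Rightarrow> 'b::real_normed_vector) \<Rightarrow> real^'n \<Rightarrow> real^'n \<Rightarrow> real^'n \<Rightarrow> 'b" where
  "fderiv2 f y h k = fderiv (\<lambda>z. fderiv f z k) y h"

lemma Ck_on_2_iff:
  "Ck_on 2 S f \<longleftrightarrow> (\<forall>x\<in>S. f differentiable (at x)) \<and>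
     (\<forall>k. (\<forall>x\<in>S. (\<lambda>z. fderiv f z k) differentiable (at x)) \<and>
        (\<forall>h. continuous_on S (\<lambda>x. fderiv2 f x h k)))"
  by (simp add: numeral_2_eq_2 fderiv2_def)

lemma C2_has_derivative:
  assumes "Ck_on 2 S f" "x \<in> S"
  shows "(f has_derivative fderiv f x) (at x)"
  using assms by (auto simp: Ck_on_2_iff frechet_derivative_works[symmetric])

lemma C2_has_fderiv2:
  assumes "Ck_on 2 S f" "x \<in> S"
  shows "((\<lambda>z. fderiv f z k) has_derivative (\<lambda>h. fderiv2 f x h k)) (at x)"
  using assms unfolding Ck_on_2_iff fderiv2_def
  by (simp add: frechet_derivative_works[symmetric] eta_contract_eq)

lemma linear_sum_axis:
  fixes L :: "real^'n \<Rightarrow> 'b::real_vector"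
  assumes "linear L"
  shows "L h = (\<Sum>j\<in>UNIV. (h $ j) *\<^sub>R L (axis j 1))"
proof -
  have "L (\<Sum>j\<in>UNIV. (h $ j) *\<^sub>R axis j 1) = (\<Sum>j\<in>UNIV. (h $ j) *\<^sub>R L (axis j 1))"
    using assms by (simp add: linear_sum linear_cmul)
  moreover have "(\<Sum>j\<in>UNIV. (h $ j) *\<^sub>R axis j 1) = h"
    by (simp add: vec_eq_iff axis_def if_distrib cong: if_cong)
  ultimately show ?thesis by simp
qed

lemma C2_derivative_linear:
  assumes "Ck_on 2 S f" "x \<in> S"
  shows "linear (fderiv f x)"
  using assms by (simp add: Ck_on_2_iff linear_frechet_derivative)

lemma C2_derivative_sum:
  assumes "Ck_on 2 S f" "x \<in> S"
  shows "fderiv f x h = (\<Sum>j\<in>UNIV. (h $ j) *\<^sub>R fderiv f x (axis j 1))"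
  by (rule linear_sum_axis[OF C2_derivative_linear[OF assms]])

lemma C2_second_derivative_linear:
  assumes "Ck_on 2 S f" "x \<in> S"
  shows "linear (\<lambda>h. fderiv2 f x h k)"
  using C2_has_fderiv2[OF assms] by (rule has_derivative_linear)

text \<open>Linearity in the inner direction comes from differentiating the expansion of
  \<open>fderiv f z k\<close> in the coordinate directions, which holds for all \<open>z\<close>
  near \<open>x\<close>; this is where openness of \<open>S\<close> enters.\<close>

lemma C2_second_derivative_sum_right:
  assumes S: "open S" and f: "Ck_on 2 S f" "x \<in> S"
  shows "fderiv2 f x h k = (\<Sum>j\<in>UNIV. (k $ j) *\<^sub>R fderiv2 f x h (axis j 1))"
proof -
  have "((\<lambda>z. \<Sum>j\<in>UNIV. (k $ j) *\<^sub>R fderiv f z (axis j 1)) has_derivative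
      (\<lambda>h. \<Sum>j\<in>UNIV. (k $ j) *\<^sub>R fderiv2 f x h (axis j 1))) (at x)"
    by (intro has_derivative_sum has_derivative_scaleR_right C2_has_fderiv2[OF f])
  then have "((\<lambda>z. fderiv f z k) has_derivative
      (\<lambda>h. \<Sum>j\<in>UNIV. (k $ j) *\<^sub>R fderiv2 f x h (axis j 1))) (at x)"
    by (rule has_derivative_transform_within_open[OF _ S f(2)])
       (rule C2_derivative_sum[OF f(1), symmetric])
  from has_derivative_unique[OF this C2_has_fderiv2[OF f]]
  show ?thesis by metis
qed

lemma C2_second_derivative_linear_right:
  assumes S: "open S" and f: "Ck_on 2 S f" "x \<in> S"
  shows "linear (fderiv2 f x h)"
proof -
  have eq: "fderiv2 f x h = (\<lambda>k. \<Sum>j\<in>UNIV. (k $ j) *\<^sub>R fderiv2 f x h (axis j 1))"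
    using C2_second_derivative_sum_right[OF assms] by blast
  show ?thesis
    by (subst eq, rule linearI) (simp_all add: scaleR_add_left sum.distrib scaleR_sum_right)
qed

lemma C2_second_derivative_sum:
  assumes S: "open S" and f: "Ck_on 2 S f" "x \<in> S"
  shows "fderiv2 f x h k =
    (\<Sum>i\<in>UNIV. \<Sum>j\<in>UNIV. (h $ i * k $ j) *\<^sub>R fderiv2 f x (axis i 1) (axis j 1))"
  by (subst linear_sum_axis[OF C2_second_derivative_linear[OF f]],
      subst C2_second_derivative_sum_right[OF assms]) (simp add: scaleR_sum_right)

lemma C2_continuous_on: "Ck_on 2 S f \<Longrightarrow> continuous_on S f"
  by (auto intro!: continuous_at_imp_continuous_on differentiable_imp_continuous_within simp: Ck_on_2_iff)

text \<open>\<open>Ck_on\<close> yields continuity in the base point for a fixed direction only;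
  expanding a moving direction in the basis vectors reduces to that case.\<close>

lemma continuous_on_derivative_C2:
  assumes f: "Ck_on 2 S f" and "continuous_on T y" "continuous_on T h" "y ` T \<subseteq> S"
  shows "continuous_on T (\<lambda>t. fderiv f (y t) (h t))"
proof -
  have *: "continuous_on S (\<lambda>z. fderiv f z k)" for k
    using f by (auto intro!: continuous_at_imp_continuous_on differentiable_imp_continuous_within simp: Ck_on_2_iff)
  have "continuous_on T (\<lambda>t. \<Sum>j\<in>UNIV. (h t $ j) *\<^sub>R fderiv f (y t) (axis j 1))"
    by (intro continuous_intros continuous_on_compose2[OF *] assms)
  then show ?thesis
    by (rule continuous_on_eq) (use assms in \<open>auto intro!: C2_derivative_sum[OF f, symmetric]\<close>)
qed

lemma continuous_on_second_derivative_C2: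
  assumes S: "open S" and f: "Ck_on 2 S f"
    and "continuous_on T y" "continuous_on T h" "continuous_on T k" "y ` T \<subseteq> S"
  shows "continuous_on T (\<lambda>t. fderiv2 f (y t) (h t) (k t))"
proof -
  have *: "continuous_on S (\<lambda>z. fderiv2 f z h k)" for h k
    using f by (auto simp: Ck_on_2_iff)
  have "continuous_on T (\<lambda>t. \<Sum>i\<in>UNIV. \<Sum>j\<in>UNIV. (h t $ i * k t $ j) *\<^sub>R
      fderiv2 f (y t) (axis i 1) (axis j 1))"
    by (intro continuous_intros continuous_on_compose2[OF *] assms)
  then show ?thesis
    by (rule continuous_on_eq) (use assms in \<open>auto intro!: C2_second_derivative_sum[symmetric]\<close>)
qed

lemma eventually_in_open:
  assumes "(x has_vector_derivative v) (at t within I)" "open S" "x t \<in> S"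
  shows "eventually (\<lambda>s. x s \<in> S) (at t within I)"
  using has_vector_derivative_continuous[OF assms(1)] assms(2,3)
  by (simp add: continuous_within topological_tendstoD)

lemma has_vector_derivative_transform_eventually:
  assumes "(f has_vector_derivative d) (at t within I)"
    and "eventually (\<lambda>s. f s = g s) (at t within I)" "f t = g t"
  shows "(g has_vector_derivative d) (at t within I)"
  using assms unfolding has_vector_derivative_def
  by (auto simp: has_derivative_within elim!: Lim_transform_eventually eventually_mono
      intro: Lim_transform_eventually[rotated])

text \<open>Product rule after expanding the direction \<open>h s\<close> in the basis: the base
  point contributes the second derivative, the direction contributes
  \<open>fderiv f (x t) k\<close>. The set \<open>I\<close> allows one-sided derivatives.\<close>

lemma has_vector_derivative_derivative_C2:
  assumes S: "open S" and f: "Ck_on 2 S f" and xt: "x t \<in> S"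
    and x: "(x has_vector_derivative v) (at t within I)"
    and h: "(h has_vector_derivative k) (at t within I)"
  shows "((\<lambda>s. fderiv f (x s) (h s)) has_vector_derivative
    fderiv2 f (x t) v (h t) + fderiv f (x t) k) (at t within I)"
proof -
  have hj: "((\<lambda>s. h s $ j) has_real_derivative k $ j) (at t within I)" for j
    using bounded_linear.has_vector_derivative[OF bounded_linear_vec_nth h]
    by (simp add: has_real_derivative_iff_has_vector_derivative)
  have fj: "((\<lambda>s. fderiv f (x s) (axis j 1)) has_vector_derivative
      fderiv2 f (x t) v (axis j 1)) (at t within I)" for j
    using vector_derivative_diff_chain_within[OF x, of "\<lambda>z. fderiv f z (axis j 1)"]
      has_derivative_at_withinI[OF C2_has_fderiv2[OF f xt]]
    by (auto simp: o_def)
  have "((\<lambda>s. \<Sum>j\<in>UNIV. (h s $ j) *\<^sub>R fderiv f (x s) (axis j 1)) has_vector_derivative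
     (\<Sum>j\<in>UNIV. (h t $ j) *\<^sub>R fderiv2 f (x t) v (axis j 1) +
        (k $ j) *\<^sub>R fderiv f (x t) (axis j 1))) (at t within I)"
    by (intro has_vector_derivative_sum has_vector_derivative_scaleR hj fj)
  also have "(\<Sum>j\<in>UNIV. (h t $ j) *\<^sub>R fderiv2 f (x t) v (axis j 1) +
        (k $ j) *\<^sub>R fderiv f (x t) (axis j 1)) =
      fderiv2 f (x t) v (h t) + fderiv f (x t) k"
    unfolding sum.distrib C2_second_derivative_sum_right[OF S f xt, symmetric]
      C2_derivative_sum[OF f xt, symmetric] ..
  finally show ?thesis
  proof (rule has_vector_derivative_transform_eventually)
    show "eventually (\<lambda>s. (\<Sum>j\<in>UNIV. (h s $ j) *\<^sub>R fderiv f (x s) (axis j 1)) =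
        fderiv f (x s) (h s)) (at t within I)"
      using eventually_in_open[OF x S xt]
      by eventually_elim (simp add: C2_derivative_sum[OF f, symmetric])
  qed (simp add: C2_derivative_sum[OF f xt, symmetric])
qed

lemma has_vector_derivative_compose_C2:
  assumes f: "Ck_on 2 S f" and xt: "x t \<in> S"
    and x: "(x has_vector_derivative v) (at t within I)"
  shows "((\<lambda>s. f (x s)) has_vector_derivative fderiv f (x t) v) (at t within I)"
  using vector_derivative_diff_chain_within[OF x has_derivative_at_withinI[OF C2_has_derivative[OF f xt]]]
  by (simp add: o_def)

text \<open>The second difference of \<open>f\<close> along \<open>s h\<close> and \<open>t k\<close>, divided by \<open>s t\<close>, is by two applications
  of the mean value theorem a value of either mixed second derivative near \<open>x\<close>.\<close>

lemma second_difference_mvt: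
  fixes f :: "real^'n \<Rightarrow> real"
  assumes f: "Ck_on 2 S f" and st: "0 < s" "0 < t"
    and sub: "\<And>a b. 0 \<le> a \<Longrightarrow> a \<le> s \<Longrightarrow> 0 \<le> b \<Longrightarrow> b \<le> t \<Longrightarrow> x + a *\<^sub>R h + b *\<^sub>R k \<in> S"
  shows "\<exists>a b. 0 \<le> a \<and> a \<le> s \<and> 0 \<le> b \<and> b \<le> t \<and>
    f (x + s *\<^sub>R h + t *\<^sub>R k) - f (x + s *\<^sub>R h) - f (x + t *\<^sub>R k) + f x =
    s * t * fderiv2 f (x + a *\<^sub>R h + b *\<^sub>R k) k h"
proof -
  have line: "((\<lambda>a. p + a *\<^sub>R q) has_vector_derivative q) (at a within UNIV)" for p q :: "real^'n" and a
    by (auto intro!: derivative_eq_intros)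
  define u where "u a = f (x + a *\<^sub>R h + t *\<^sub>R k) - f (x + a *\<^sub>R h)" for a
  have "\<exists>a. 0 < a \<and> a < s \<and> u s - u 0 = (s - 0) *
     (fderiv f (x + a *\<^sub>R h + t *\<^sub>R k) h - fderiv f (x + a *\<^sub>R h) h)"
  proof (rule MVT2[OF st(1)])
    fix a assume a: "0 \<le> a" "a \<le> s"
    have 1: "x + t *\<^sub>R k + a *\<^sub>R h \<in> S" "x + a *\<^sub>R h \<in> S"
      using sub[OF a, of t] sub[OF a, of 0] st by (auto simp: algebra_simps)
    show "(u has_real_derivative fderiv f (x + a *\<^sub>R h + t *\<^sub>R k) h -
        fderiv f (x + a *\<^sub>R h) h) (at a)"
      using has_vector_derivative_diff[OF has_vector_derivative_compose_C2[OF f 1(1) line]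
          has_vector_derivative_compose_C2[OF f 1(2) line]]
      unfolding u_def by (simp add: has_real_derivative_iff_has_vector_derivative algebra_simps)
  qed
  then obtain a where a: "0 < a" "a < s" and ua: "u s - u 0 = s *
     (fderiv f (x + a *\<^sub>R h + t *\<^sub>R k) h - fderiv f (x + a *\<^sub>R h) h)"
    by auto
  define w where "w b = fderiv f (x + a *\<^sub>R h + b *\<^sub>R k) h" for b
  have "\<exists>b. 0 < b \<and> b < t \<and> w t - w 0 = (t - 0) * fderiv2 f (x + a *\<^sub>R h + b *\<^sub>R k) k h"
  proof (rule MVT2[OF st(2)])
    fix b assume b: "0 \<le> b" "b \<le> t"
    have 1: "x + a *\<^sub>R h + b *\<^sub>R k \<in> S"
      using sub[of a b] a b by auto
    show "(w has_real_derivative fderiv2 f (x + a *\<^sub>R h + b *\<^sub>R k) k h) (at b)"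
      using vector_derivative_diff_chain_within[OF line
          has_derivative_at_withinI[OF C2_has_fderiv2[OF f 1]]]
      unfolding w_def by (simp add: has_real_derivative_iff_has_vector_derivative o_def)
  qed
  then obtain b where b: "0 < b" "b < t" "w t - w 0 = t * fderiv2 f (x + a *\<^sub>R h + b *\<^sub>R k) k h"
    by auto
  show ?thesis
    using a b ua unfolding u_def w_def
    by (intro exI[of _ a] exI[of _ b]) auto
qed

text \<open>Schwarz's theorem. The second difference is symmetric in the two increments, so the two
  mixed derivatives attain a common value at points arbitrarily close to \<open>x\<close>;
  continuity forces equality at \<open>x\<close>.\<close>

lemma second_derivative_sym_real:
  fixes f :: "real^'n \<Rightarrow> real"
  assumes S: "open S" and f: "Ck_on 2 S f" and x: "x \<in> S"
  shows "fderiv2 f x h k = fderiv2 f x k h"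
proof (rule ccontr)
  assume neq: "\<not> ?thesis"
  \<comment> \<open>Half the gap: values strictly closer than \<open>e\<close> to the two limits
    cannot coincide.\<close>
  define e where "e = \<bar>fderiv2 f x h k - fderiv2 f x k h\<bar> / 2"
  have e: "0 < e" using neq by (simp add: e_def)
  have "continuous_on S (\<lambda>y. fderiv2 f y h k)" "continuous_on S (\<lambda>y. fderiv2 f y k h)"
    using f by (auto simp: Ck_on_2_iff)
  then have "isCont (\<lambda>y. fderiv2 f y h k) x" "isCont (\<lambda>y. fderiv2 f y k h) x"
    using S x by (auto simp: continuous_on_eq_continuous_at)
  moreover have "eventually (\<lambda>y. dist (F y) (F x) < e) (nhds x)" if "isCont F x" for F :: "real^'n \<Rightarrow> real"
    using that e tendsto_at_iff_tendsto_nhds[of F x] tendstoD unfolding isCont_def by blast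
  ultimately have "eventually (\<lambda>y. dist (fderiv2 f y h k) (fderiv2 f x h k) < e) (nhds x)"
    "eventually (\<lambda>y. dist (fderiv2 f y k h) (fderiv2 f x k h) < e) (nhds x)"
    by blast+
  moreover have "eventually (\<lambda>y. y \<in> S) (nhds x)"
    using S x by (rule eventually_nhds_in_open)
  ultimately have "eventually (\<lambda>y. dist (fderiv2 f y h k) (fderiv2 f x h k) < e \<and>
    dist (fderiv2 f y k h) (fderiv2 f x k h) < e \<and> y \<in> S) (nhds x)"
    by eventually_elim simp
  then obtain d where d: "0 < d" "\<And>y. dist y x < d \<Longrightarrow>
    dist (fderiv2 f y h k) (fderiv2 f x h k) < e \<and>
    dist (fderiv2 f y k h) (fderiv2 f x k h) < e \<and> y \<in> S"
    unfolding eventually_nhds_metric by auto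
  \<comment> \<open>The parallelogram with sides \<open>s h\<close> and \<open>s k\<close> then
    stays within \<open>d / 2\<close> of \<open>x\<close>; the summand 1 covers
    \<open>h = k = 0\<close>.\<close>
  define s where "s = d / (2 * (norm h + norm k + 1))"
  have pos: "0 < norm h + norm k + 1" by (simp add: add_nonneg_pos)
  then have s: "0 < s" using d(1) by (simp add: s_def)
  have near: "dist (x + a *\<^sub>R h + b *\<^sub>R k) x < d" if "0 \<le> a" "a \<le> s" "0 \<le> b" "b \<le> s" for a b
  proof -
    have "dist (x + a *\<^sub>R h + b *\<^sub>R k) x = norm (a *\<^sub>R h + b *\<^sub>R k)"
      by (simp add: dist_norm)
    also have "\<dots> \<le> a * norm h + b * norm k"
      using norm_triangle_ineq[of "a *\<^sub>R h" "b *\<^sub>R k"] that by simp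
    also have "\<dots> \<le> s * norm h + s * norm k"
      using that by (intro add_mono mult_right_mono) auto
    also have "\<dots> \<le> s * (norm h + norm k + 1)" using s by (simp add: algebra_simps)
    also have "\<dots> = d / 2" unfolding s_def
using pos by (simp add: field_simps)
    also have "\<dots> < d" using d by simp
    finally show ?thesis .
  qed
  from second_difference_mvt[OF f s s, of x h k] near d(2) obtain a b where 1:
    "0 \<le> a" "a \<le> s" "0 \<le> b" "b \<le> s"
    "f (x + s *\<^sub>R h + s *\<^sub>R k) - f (x + s *\<^sub>R h) - f (x + s *\<^sub>R k) + f x =
      s * s * fderiv2 f (x + a *\<^sub>R h + b *\<^sub>R k) k h" by blast
  have "x + a *\<^sub>R k + b *\<^sub>R h \<in> S" if "0 \<le> a" "a \<le> s" "0 \<le> b" "b \<le> s" for a b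
    using near[of b a] d(2) that by (simp add: algebra_simps)
  from second_difference_mvt[OF f s s, of x k h, OF this] obtain a' b' where 2:
    "0 \<le> a'" "a' \<le> s" "0 \<le> b'" "b' \<le> s"
    "f (x + s *\<^sub>R k + s *\<^sub>R h) - f (x + s *\<^sub>R k) - f (x + s *\<^sub>R h) + f x =
      s * s * fderiv2 f (x + a' *\<^sub>R k + b' *\<^sub>R h) h k" by blast
  have "s * s * fderiv2 f (x + a *\<^sub>R h + b *\<^sub>R k) k h = s * s * fderiv2 f (x + a' *\<^sub>R k + b' *\<^sub>R h) h k"
    using 1(5) 2(5) by (simp add: algebra_simps)
  then have eq: "fderiv2 f (x + a *\<^sub>R h + b *\<^sub>R k) k h = fderiv2 f (x + b' *\<^sub>R h + a' *\<^sub>R k) h k"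
    using s by (simp add: algebra_simps)
  have "dist (fderiv2 f (x + a *\<^sub>R h + b *\<^sub>R k) k h) (fderiv2 f x k h) < e"
    "dist (fderiv2 f (x + b' *\<^sub>R h + a' *\<^sub>R k) h k) (fderiv2 f x h k) < e"
    using near[of a b] near[of b' a'] d(2) 1 2 by auto
  then show False unfolding eq e_def dist_real_def by (auto simp: field_simps abs_if split: if_splits)
qed

text \<open>The mean value theorem is scalar, so for vector-valued maps such as chart transitions
  symmetry is obtained componentwise.\<close>

lemma second_derivative_nth:
  fixes f :: "real^'n \<Rightarrow> real^'m"
  assumes S: "open S" and f: "Ck_on 2 S f" and x: "x \<in> S"
  shows "fderiv2 (\<lambda>z. f z $ i) x h k = fderiv2 f x h k $ i"
    and "Ck_on 2 S (\<lambda>z. f z $ i)"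
proof -
  have D: "((\<lambda>z. f z $ i) has_derivative (\<lambda>h. fderiv f z h $ i)) (at z)" if "z \<in> S" for z
    using C2_has_derivative[OF f that]
    by (rule bounded_linear.has_derivative[OF bounded_linear_vec_nth])
  then have D': "fderiv (\<lambda>z. f z $ i) z h = fderiv f z h $ i" if "z \<in> S" for z h
    using that by (metis frechet_derivative_at)
  have E: "((\<lambda>z. fderiv (\<lambda>z. f z $ i) z k) has_derivative
      (\<lambda>h. fderiv2 f z h k $ i)) (at z)" if "z \<in> S" for z k
    by (rule has_derivative_transform_within_open[OF _ S that])
       (use bounded_linear.has_derivative[OF bounded_linear_vec_nth C2_has_fderiv2[OF f that]] D' in auto)
  have E': "fderiv2 (\<lambda>z. f z $ i) z h k = fderiv2 f z h k $ i" if "z \<in> S" for z h k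
    unfolding fderiv2_def[of "\<lambda>z. f z $ i"] using frechet_derivative_at[OF E[OF that, of k]] by metis
  show "fderiv2 (\<lambda>z. f z $ i) x h k = fderiv2 f x h k $ i"
    by (rule E'[OF x])
  have "continuous_on S (\<lambda>x. fderiv2 f x h k $ i)" for h k
    using f by (auto simp: Ck_on_2_iff intro!: continuous_intros)
  then have "continuous_on S (\<lambda>x. fderiv2 (\<lambda>z. f z $ i) x h k)" for h k
    by (rule continuous_on_eq) (simp add: E')
  then show "Ck_on 2 S (\<lambda>z. f z $ i)"
    unfolding Ck_on_2_iff using D E unfolding differentiable_def by blast
qed

lemma second_derivative_sym:
  fixes f :: "real^'n \<Rightarrow> real^'m"
  assumes "open S" "Ck_on 2 S f" "x \<in> S"
  shows "fderiv2 f x h k = fderiv2 f x k h"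
  using second_derivative_sym_real[OF assms(1) second_derivative_nth(2)[OF assms] assms(3), of _ h k]
  by (simp add: vec_eq_iff second_derivative_nth(1)[OF assms])

section \<open>Ordinary differential equations and inequalities\<close>

lemma mvt_subinterval:
  fixes f :: "real \<Rightarrow> real"
  assumes f: "\<And>t. t \<in> {a..b} \<Longrightarrow> (f has_real_derivative f' t) (at t within {a..b})"
    and uv: "a \<le> u" "u < v" "v \<le> b"
  shows "\<exists>z. u < z \<and> z < v \<and> f v - f u = (v - u) * f' z"
proof -
  have "\<exists>z\<in>{u<..<v}. f v - f u = f' z * (v - u)"
  proof (rule mvt_simple[OF uv(2)])
    fix x assume x: "u \<le> x" "x \<le> v"
    show "(f has_derivative (*) (f' x)) (at x within {u..v})"
      using f[of x] x uv has_derivative_subset[of f "(*) (f' x)" x "{a..b}" "{u..v}"]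
      by (simp add: has_field_derivative_def subset_iff)
  qed
  then show ?thesis by (auto simp: mult.commute)
qed

text \<open>Only an upper bound for \<open>q\<close> is available, so nothing bounds
  \<open>s\<close> from below a priori. If \<open>s t > 0\<close>, restarting at a minimum
  \<open>m\<close> of \<open>s\<close> on \<open>{a..t}\<close> repairs this: there \<open>p\<close>
  vanishes, and on \<open>{m..t}\<close> both \<open>s\<close> and the positive part of
  \<open>p\<close> are controlled by the maximum \<open>p w\<close>. Integrating \<open>q\<close>
  over the last stretch before \<open>w\<close> on which \<open>p > 0\<close> gives
  \<open>p w < p w\<close>.\<close>

lemma second_order_comparison:
  fixes s p q :: "real \<Rightarrow> real"
  assumes s: "\<And>t. t \<in> {a..b} \<Longrightarrow> (s has_real_derivative p t) (at t within {a..b})"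
    and p: "\<And>t. t \<in> {a..b} \<Longrightarrow> (p has_real_derivative q t) (at t within {a..b})"
    and init: "s a = 0" "p a = 0"
    and q: "\<And>t. t \<in> {a..b} \<Longrightarrow> q t \<le> C * (\<bar>s t\<bar> + \<bar>p t\<bar>)"
    and C: "0 \<le> C" "C * (b - a) * (1 + (b - a)) < 1"
    and t: "t \<in> {a..b}"
  shows "s t \<le> 0"
proof (rule ccontr)
  assume "\<not> s t \<le> 0"
  then have st: "0 < s t" by simp
  define l where "l = b - a"
  have contS: "continuous_on {a..b} s" and contP: "continuous_on {a..b} p"
    by (rule DERIV_continuous_on[OF s], assumption) (rule DERIV_continuous_on[OF p])
  note mvt_s = mvt_subinterval[OF s] and mvt_p = mvt_subinterval[OF p]
  have "continuous_on {a..t} s" using contS t by (auto elim: continuous_on_subset)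
  then obtain m where m: "m \<in> {a..t}" "\<And>x. x \<in> {a..t} \<Longrightarrow> s m \<le> s x"
    using continuous_attains_inf[of "{a..t}" s] t by auto
  have sm: "s m \<le> 0" using m(2)[of a] t init by simp
  have mt: "m < t" using m(1) sm st by (cases "m = t") auto
  \<comment> \<open>At \<open>m = a\<close> this is the initial condition; otherwise
    \<open>m\<close> is an interior minimum, because \<open>s t > 0\<close> excludes
    \<open>m = t\<close>.\<close>
  have pm: "p m = 0"
  proof (cases "m = a")
    case False
    then have m': "a < m" "m < b" using m mt t by auto
    then have "(s has_real_derivative p m) (at m)"
      using s[of m] by (simp add: at_within_Icc_at)
    moreover have "\<forall>y. \<bar>m - y\<bar> < min (m - a) (t - m) \<longrightarrow> s m \<le> s y"
      by (auto intro!: m(2) simp: abs_if split: if_splits)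
    ultimately show ?thesis using m' mt
      by (intro DERIV_local_min[of s "p m" m "min (m - a) (t - m)"]) auto
  qed (simp add: init)
  have "continuous_on {m..t} p" using contP t m by (auto elim: continuous_on_subset)
  then obtain w where w: "w \<in> {m..t}" "\<And>x. x \<in> {m..t} \<Longrightarrow> p x \<le> p w"
    using continuous_attains_sup[of "{m..t}" p] mt by auto
  have "\<exists>z. m < z \<and> z < t \<and> s t - s m = (t - m) * p z"
    using mvt_s mt m t by auto
  then obtain z where "m < z" "z < t" "s t - s m = (t - m) * p z" by blast
  then have "0 < p z" using st sm mt by (metis diff_gt_0_iff_gt less_le_trans order_le_less_trans zero_less_mult_pos)
  with w(2)[of z] \<open>m < z\<close> \<open>z < t\<close> have W: "0 < p w" by auto
  have s_lower: "- (l * p w) \<le> s m"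
  proof -
    have "s t - s m \<le> (t - m) * p w"
      using \<open>s t - s m = (t - m) * p z\<close> w(2)[of z] \<open>m < z\<close> \<open>z < t\<close> by (simp add: mult_left_mono)
    also have "\<dots> \<le> l * p w" using W m t by (intro mult_right_mono) (auto simp: l_def)
    finally show ?thesis using st by simp
  qed
  have s_bound: "\<bar>s x\<bar> \<le> l * p w" if x: "m \<le> x" "x \<le> t" for x
  proof -
    have "s x \<le> l * p w"
    proof (cases "x = m")
      case True
      then show ?thesis using sm W m t by (auto simp: l_def intro: order_trans[OF _ mult_nonneg_nonneg])
    next
      case False
      with x mvt_s[of m x] m t obtain y where y: "m < y" "y < x" "s x - s m = (x - m) * p y" by auto
      have "(x - m) * p y \<le> (x - m) * p w" using w(2)[of y] y x by (intro mult_left_mono) auto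
      also have "\<dots> \<le> l * p w" using W m t x by (intro mult_right_mono) (auto simp: l_def)
      finally show ?thesis using y sm by simp
    qed
    moreover have "s m \<le> s x" using m x by auto
    ultimately show ?thesis using s_lower by (simp add: abs_le_iff)
  qed
  \<comment> \<open>The point \<open>c\<close> obtained from this is the last one before
    \<open>w\<close> with \<open>p \<le> 0\<close>. Between \<open>c\<close> and \<open>w\<close>
    the value of \<open>p\<close> is positive and at most \<open>p w\<close>, which bounds its
    absolute value.\<close>
  have "closed {x \<in> {m..w}. p x \<le> 0}"
    using contP m w t by (intro continuous_on_closed_Collect_le continuous_on_const) (auto elim: continuous_on_subset)
  then have "compact {x \<in> {m..w}. p x \<le> 0}"
    by (metis (no_types, lifting) bounded_closed_interval bounded_subset compact_eq_bounded_closed mem_Collect_eq subsetI)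
  moreover have "m \<in> {x \<in> {m..w}. p x \<le> 0}" using pm w by auto
  ultimately obtain c where c: "c \<in> {m..w}" "p c \<le> 0" "\<And>x. x \<in> {m..w} \<Longrightarrow> p x \<le> 0 \<Longrightarrow> x \<le> c"
    using compact_attains_sup[of "{x \<in> {m..w}. p x \<le> 0}"] by blast
  have cw: "c < w" using c W by (cases "c = w") auto
  with mvt_p[of c w] c m w t obtain y where y: "c < y" "y < w" "p w - p c = (w - c) * q y" by auto
  have py: "0 < p y" using c(3)[of y] c(1) y by (cases "p y \<le> 0") auto
  have "p w \<le> (w - c) * q y" using y(3) c(2) by simp
  also have "\<dots> \<le> (w - c) * (C * (l * p w + p w))"
  proof (rule mult_left_mono)
    have "q y \<le> C * (\<bar>s y\<bar> + \<bar>p y\<bar>)" using q[of y] c(1) y w m t by auto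
    also have "\<dots> \<le> C * (l * p w + p w)"
      using s_bound[of y] w(2)[of y] py c(1) y w(1) C(1) by (intro mult_left_mono add_mono) auto
    finally show "q y \<le> C * (l * p w + p w)" .
  qed (use cw in simp)
  also have "\<dots> \<le> l * (C * (l * p w + p w))"
    using c w m t W C(1) by (intro mult_right_mono mult_nonneg_nonneg add_nonneg_nonneg) (auto simp: l_def)
  also have "\<dots> = (C * l * (1 + l)) * p w" by (simp add: algebra_simps)
  also have "\<dots> < 1 * p w" using C(2) W unfolding l_def by (intro mult_strict_right_mono) auto
  finally show False by simp
qed

text \<open>Time reversal: \<open>p\<close> changes sign and \<open>q\<close> does not, and the
  bound sees \<open>p\<close> only through its absolute value.\<close>

lemma second_order_comparison_left:
  fixes s p q :: "real \<Rightarrow> real"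
  assumes s: "\<And>t. t \<in> {a..b} \<Longrightarrow> (s has_real_derivative p t) (at t within {a..b})"
    and p: "\<And>t. t \<in> {a..b} \<Longrightarrow> (p has_real_derivative q t) (at t within {a..b})"
    and init: "s b = 0" "p b = 0"
    and q: "\<And>t. t \<in> {a..b} \<Longrightarrow> q t \<le> C * (\<bar>s t\<bar> + \<bar>p t\<bar>)"
    and C: "0 \<le> C" "C * (b - a) * (1 + (b - a)) < 1"
    and t: "t \<in> {a..b}"
  shows "s t \<le> 0"
proof -
  have im: "uminus ` {- b.. - a} = {a..b}" by simp
  have neg: "((\<lambda>t. f (- t)) has_real_derivative - d) (at t within {- b.. - a})"
    if "(f has_real_derivative d) (at (- t) within {a..b})" for f d t
  proof -
    have "(uminus has_real_derivative - 1) (at t within {- b.. - a})"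
      by (auto intro!: derivative_eq_intros)
    then show ?thesis
      using DERIV_image_chain[of f d "\<lambda>t. - t" t "{- b.. - a}" "- 1"] that by (simp add: o_def im)
  qed
  have "s (- (- t)) \<le> 0"
    by (rule second_order_comparison[of "- b" "- a" "\<lambda>t. s (- t)" "\<lambda>t. - p (- t)" "\<lambda>t. q (- t)" C "- t"])
       (use assms in \<open>auto intro!: neg DERIV_minus[where D = "- _", simplified]\<close>)
  then show ?thesis by simp
qed

section \<open>Existence for autonomous Lipschitz equations\<close>

lemma norm_le_on_symmetric_interval:
  fixes f :: "real \<Rightarrow> 'a::real_normed_vector"
  assumes "\<And>t. t \<in> {- T..T} \<Longrightarrow> (f has_vector_derivative f' t) (at t within {- T..T})"
    and "\<And>t. t \<in> {- T..T} \<Longrightarrow> norm (f' t) \<le> M" and "f 0 = 0" and t: "t \<in> {- T..T}"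
  shows "norm (f t) \<le> M * T"
proof -
  have "norm (f t - f 0) \<le> M * norm (t - 0)"
  proof (rule differentiable_bound[of "{- T..T}" f "\<lambda>t h. h *\<^sub>R f' t"])
    fix x assume x: "x \<in> {- T..T}"
    show "onorm (\<lambda>h. h *\<^sub>R f' x) \<le> M"
      by (rule onorm_le) (use assms(2)[OF x] in \<open>simp add: mult.commute[of M] mult_left_mono\<close>)
  qed (use assms in \<open>auto simp: has_vector_derivative_def\<close>)
  also have "\<dots> \<le> M * T"
    using t assms(2)[OF t] by (intro mult_left_mono) (auto intro: order_trans[OF norm_ge_zero])
  finally show ?thesis using assms(3) by simp
qed

text \<open>For negative \<open>t\<close> the integral over \<open>{0..t}\<close> is 0, hence the
  base point \<open>- T\<close> and the subtracted value at 0.\<close>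

lemma antiderivative_on_symmetric_interval:
  fixes h :: "real \<Rightarrow> 'a::banach"
  assumes h: "continuous_on {- T..T} h"
  defines "J \<equiv> \<lambda>t. integral {- T..t} h - integral {- T..0} h"
  shows "t \<in> {- T..T} \<Longrightarrow> (J has_vector_derivative h t) (at t within {- T..T})" and "J 0 = 0"
  using has_vector_derivative_diff[OF integral_has_vector_derivative[OF h] has_vector_derivative_const]
  by (auto simp: J_def)

text \<open>The Picard iteration is run for the vector field extended by the projection onto the ball, on
  bounded continuous functions that are constant outside \<open>{- T..T}\<close>.\<close>

lemma picard_lindelof:
  fixes F :: "'a::euclidean_space \<Rightarrow> 'a"
  assumes F: "\<And>x y. x \<in> cball z0 \<rho> \<Longrightarrow> y \<in> cball z0 \<rho> \<Longrightarrow> norm (F x - F y) \<le> L * norm (x - y)"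
    and B: "\<And>x. x \<in> cball z0 \<rho> \<Longrightarrow> norm (F x) \<le> B"
    and \<rho>: "0 \<le> \<rho>" and L: "0 \<le> L" and T: "0 \<le> T" "B * T \<le> \<rho>" "L * T < 1"
  shows "\<exists>z. z 0 = z0 \<and> (\<forall>t\<in>{- T..T}. z t \<in> cball z0 \<rho> \<and>
    (z has_vector_derivative F (z t)) (at t within {- T..T}))"
proof -
  \<comment> \<open>The projection is nonexpansive, so \<open>G\<close> is defined everywhere with
    the Lipschitz constant and the bound of \<open>F\<close>.\<close>
  define P where "P = closest_point (cball z0 \<rho>)"
  define G where "G = F \<circ> P"
  have P: "P x \<in> cball z0 \<rho>" for x
    unfolding P_def using \<rho> by (intro closest_point_in_set) auto
  have P_lip: "norm (P x - P y) \<le> norm (x - y)" for x y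
    unfolding P_def using \<rho> closest_point_lipschitz[of "cball z0 \<rho>" x y]
    by (auto simp: dist_norm)
  have G_lip: "norm (G x - G y) \<le> L * norm (x - y)" for x y
    unfolding G_def o_def using order_trans[OF F[OF P P] mult_left_mono[OF P_lip L]] .
  have G_B: "norm (G x) \<le> B" for x
    unfolding G_def o_def by (rule B[OF P])
  have "L-lipschitz_on UNIV G"
    using G_lip L by (auto intro!: lipschitz_onI simp: dist_norm)
  then have G_cont: "continuous_on UNIV G" by (rule lipschitz_on_continuous_on)
  define cl where "cl t = max (- T) (min T t)" for t
  have cl: "cl t \<in> {- T..T}" for t using T by (auto simp: cl_def)
  have cl_id: "cl t = t" if "t \<in> {- T..T}" for t using that by (auto simp: cl_def)
  have cl_cont: "continuous_on UNIV cl" unfolding cl_def by (intro continuous_intros)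
  define J where "J h t = integral {- T..t} h - integral {- T..0} h" for h :: "real \<Rightarrow> 'a" and t
  have Gu_cont: "continuous_on {- T..T} (\<lambda>s. G (apply_bcontfun u s))" for u :: "real \<Rightarrow>\<^sub>C 'a"
    by (rule continuous_on_compose2[OF G_cont]) auto
  note J = antiderivative_on_symmetric_interval[OF Gu_cont, folded J_def]
  have J_bound: "norm (J (\<lambda>s. G (apply_bcontfun u s)) t) \<le> B * T" if "t \<in> {- T..T}" for u t
    by (rule norm_le_on_symmetric_interval[OF J(1) _ J(2) that]) (auto intro: G_B)
  define \<Phi>0 where "\<Phi>0 u t = z0 + J (\<lambda>s. G (apply_bcontfun u s)) (cl t)" for u t
  have \<Phi>0: "\<Phi>0 u \<in> bcontfun" for u
  proof (rule bcontfun_normI)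
    have "continuous_on {- T..T} (J (\<lambda>s. G (apply_bcontfun u s)))"
      using has_vector_derivative_continuous[OF J(1)] unfolding continuous_on_eq_continuous_within by blast
    then show "continuous_on UNIV (\<Phi>0 u)"
      unfolding \<Phi>0_def using cl
      by (intro continuous_intros continuous_on_compose2[OF _ cl_cont]) auto
    show "norm (\<Phi>0 u t) \<le> norm z0 + B * T" for t
      unfolding \<Phi>0_def using J_bound[OF cl] by (intro norm_triangle_le add_mono) auto
  qed
  define \<Phi> where "\<Phi> u = Bcontfun (\<Phi>0 u)" for u
  have \<Phi>: "apply_bcontfun (\<Phi> u) = \<Phi>0 u" for u
    unfolding \<Phi>_def by (rule Bcontfun_inverse[OF \<Phi>0])
  \<comment> \<open>In the supremum distance the integral operator contracts by
    \<open>L * T\<close>: the field contributes \<open>L\<close>, integration over time contributes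
    \<open>T\<close>.\<close>
  have "\<exists>!u. \<Phi> u = u"
  proof (rule banach_fix_type[of "L * T"])
    show "\<forall>u v. dist (\<Phi> u) (\<Phi> v) \<le> L * T * dist u v"
    proof (intro allI dist_bound)
      fix u v t
      let ?D = "\<lambda>t. J (\<lambda>s. G (apply_bcontfun u s)) t - J (\<lambda>s. G (apply_bcontfun v s)) t"
      have "norm (?D (cl t)) \<le> L * dist u v * T"
      proof (rule norm_le_on_symmetric_interval[OF _ _ _ cl])
        fix t assume t: "t \<in> {- T..T}"
        show "(?D has_vector_derivative G (apply_bcontfun u t) - G (apply_bcontfun v t)) (at t within {- T..T})"
          by (intro has_vector_derivative_diff J(1) t)
        show "norm (G (apply_bcontfun u t) - G (apply_bcontfun v t)) \<le> L * dist u v"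
          using order_trans[OF G_lip mult_left_mono[OF dist_bounded[of u t v, unfolded dist_norm] L]]
          by (simp add: dist_norm)
      qed (simp add: J(2))
      then show "dist (apply_bcontfun (\<Phi> u) t) (apply_bcontfun (\<Phi> v) t) \<le> L * T * dist u v"
        by (simp add: \<Phi> \<Phi>0_def dist_norm mult_ac)
    qed
  qed (use L T in auto)
  then obtain u where u: "\<Phi> u = u" by blast
  define z where "z = apply_bcontfun u"
  have z: "z t = z0 + J (\<lambda>s. G (z s)) t" if "t \<in> {- T..T}" for t
  proof -
    have "apply_bcontfun u t = \<Phi>0 u t" using \<Phi>[of u] unfolding u by metis
    then show ?thesis unfolding z_def \<Phi>0_def cl_id[OF that] .
  qed
  \<comment> \<open>\<open>B * T \<le> \<rho>\<close> confines the fixed point to the ball, where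
    the projection is the identity; so it solves the equation for \<open>F\<close> itself.\<close>
  have in_ball: "z t \<in> cball z0 \<rho>" if "t \<in> {- T..T}" for t
    using J_bound[OF that, of u] T z[OF that] by (simp add: z_def dist_norm)
  have GF: "G (z t) = F (z t)" if "t \<in> {- T..T}" for t
    unfolding G_def P_def using in_ball[OF that] by (simp add: closest_point_self)
  show ?thesis
  proof (intro exI[of _ z] conjI ballI)
    show "z 0 = z0" using z[of 0] T J(2)[of u] by (simp add: z_def)
    fix t assume t: "t \<in> {- T..T}"
    show "z t \<in> cball z0 \<rho>" by (rule in_ball[OF t])
    have D0: "((\<lambda>t. J (\<lambda>s. G (z s)) t) has_vector_derivative F (z t)) (at t within {- T..T})"
      using J(1)[OF t, of u] GF[OF t] by (simp add: z_def)
    have D: "((\<lambda>t. z0 + J (\<lambda>s. G (z s)) t) has_vector_derivative F (z t)) (at t within {- T..T})"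
      using has_vector_derivative_add[OF has_vector_derivative_const D0, of z0] by simp
    show "(z has_vector_derivative F (z t)) (at t within {- T..T})"
      using z has_vector_derivative_transform[OF t _ D, of z] by blast
  qed
qed

text \<open>Two applications of the mean value theorem on the side of \<open>m\<close> that contains
  \<open>t\<close>. The point \<open>m\<close> may be an end point, the case of a geodesic leaving
  the boundary, or interior, the case of one touching it.\<close>

lemma positive_of_second_derivative_pos:
  fixes F :: "real \<Rightarrow> real"
  assumes F: "\<And>t. t \<in> {a..b} \<Longrightarrow> (F has_real_derivative F1 t) (at t within {a..b})"
    and F1: "\<And>t. t \<in> {a..b} \<Longrightarrow> (F1 has_real_derivative F2 t) (at t within {a..b})"
    and pos: "\<And>t. t \<in> {a..b} \<Longrightarrow> 0 < F2 t"
    and m: "m \<in> {a..b}" "F m = 0" "F1 m = 0" and t: "t \<in> {a..b}" "t \<noteq> m"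
  shows "0 < F t"
proof (cases "m < t")
  case True
  then obtain z where z: "m < z" "z < t" "F t - F m = (t - m) * F1 z"
    using mvt_subinterval[OF F, of m t] m t by auto
  obtain y where y: "m < y" "y < z" "F1 z - F1 m = (z - m) * F2 y"
    using mvt_subinterval[OF F1, of m z] m t z by auto
  have "0 < F2 y" using pos[of y] y z m t by auto
  then show ?thesis using y z m by simp
next
  case False
  then have tm: "t < m" using t by simp
  then obtain z where z: "t < z" "z < m" "F m - F t = (m - t) * F1 z"
    using mvt_subinterval[OF F, of t m] m t by auto
  obtain y where y: "z < y" "y < m" "F1 m - F1 z = (m - z) * F2 y"
    using mvt_subinterval[OF F1, of z m] m t z by auto
  have "0 < F2 y" using pos[of y] y z m t by auto
  then have "0 < (m - z) * F2 y" using y z by simp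
  then have "F1 z < 0" using y(3) m by linarith
  then have "(m - t) * F1 z < 0" using tm by (simp add: mult_pos_neg)
  then show ?thesis using z m by simp
qed

lemma continuous_on_near:
  fixes h :: "'a::metric_space \<Rightarrow> 'b::topological_space"
  assumes "continuous_on I h" "t0 \<in> I" "open U" "h t0 \<in> U"
  shows "\<exists>d>0. \<forall>t\<in>I. dist t t0 < d \<longrightarrow> h t \<in> U"
proof -
  have "eventually (\<lambda>t. h t \<in> U) (at t0 within I)"
    using assms unfolding continuous_on_def by (blast dest: topological_tendstoD)
  then obtain d where "0 < d" "\<And>t. t \<in> I \<Longrightarrow> t \<noteq> t0 \<Longrightarrow> dist t t0 < d \<Longrightarrow> h t \<in> U"
    unfolding eventually_at by blast
  then show ?thesis using assms(4) by metis
qed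

lemma Icc_nontrivial:
  fixes a b t :: real
  assumes "a < b" "t \<in> {a..b}"
  shows "at t within {a..b} \<noteq> bot"
  using assms by (simp add: trivial_limit_within islimpt_Icc)

section \<open>Local Lipschitz continuity at a point\<close>

text \<open>A Lipschitz germ at one point. The class is closed under sums, products and reciprocals
  of functions not vanishing there, which carries it from the metric and its first derivatives to
  the Christoffel symbols.\<close>

definition lipschitz_near :: "'a::real_normed_vector \<Rightarrow> ('a \<Rightarrow> 'b::real_normed_vector) \<Rightarrow> bool" where
  "lipschitz_near y0 F \<longleftrightarrow> (\<exists>r>0. \<exists>L\<ge>0. \<forall>y\<in>cball y0 r. \<forall>z\<in>cball y0 r. norm (F y - F z) \<le> L * norm (y - z))"

lemma lipschitz_nearI:
  assumes "0 < r" "\<And>y z. y \<in> cball y0 r \<Longrightarrow> z \<in> cball y0 r \<Longrightarrow> norm (F y - F z) \<le> L * norm (y - z)"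
  shows "lipschitz_near y0 F"
proof -
  have "norm (F y - F z) \<le> \<bar>L\<bar> * norm (y - z)" if "y \<in> cball y0 r" "z \<in> cball y0 r" for y z
    using assms(2)[OF that] by (rule order_trans) (simp add: mult_right_mono)
  then show ?thesis unfolding lipschitz_near_def using assms(1) abs_ge_zero by blast
qed

text \<open>Products need bounds as well as Lipschitz constants; on a ball the former follow from
  the latter.\<close>

lemma lipschitz_near_bound:
  assumes "lipschitz_near y0 F"
  obtains r L B where "0 < r" "0 \<le> L" "0 \<le> B"
    "\<And>y z. y \<in> cball y0 r \<Longrightarrow> z \<in> cball y0 r \<Longrightarrow> norm (F y - F z) \<le> L * norm (y - z)"
    "\<And>y. y \<in> cball y0 r \<Longrightarrow> norm (F y) \<le> B"
proof -
  obtain r L where *: "0 < r" "0 \<le> L"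
    "\<And>y z. y \<in> cball y0 r \<Longrightarrow> z \<in> cball y0 r \<Longrightarrow> norm (F y - F z) \<le> L * norm (y - z)"
    using assms unfolding lipschitz_near_def by blast
  have "norm (F y) \<le> norm (F y0) + L * r" if y: "y \<in> cball y0 r" for y
  proof -
    have "norm (F y) \<le> norm (F y0) + norm (F y - F y0)" by (rule norm_triangle_sub)
    also have "norm (F y - F y0) \<le> L * norm (y - y0)" using *(3)[OF y, of y0] *(1) by simp
    also have "\<dots> \<le> L * r" using y *(2) by (intro mult_left_mono) (auto simp: dist_norm norm_minus_commute)
    finally show ?thesis by simp
  qed
  then show ?thesis using that[OF *(1,2) _ *(3), of "norm (F y0) + L * r"] *(1,2) by auto
qed

lemma lipschitz_near_const: "lipschitz_near y0 (\<lambda>_. c)"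
  by (rule lipschitz_nearI[of 1 _ _ 0]) auto

lemma lipschitz_near_add:
  assumes "lipschitz_near y0 F" "lipschitz_near y0 G"
  shows "lipschitz_near y0 (\<lambda>y. F y + G y)"
proof -
  obtain r L where F: "0 < r" "\<And>y z. y \<in> cball y0 r \<Longrightarrow> z \<in> cball y0 r \<Longrightarrow> norm (F y - F z) \<le> L * norm (y - z)"
    using assms(1) unfolding lipschitz_near_def by blast
  obtain s M where G: "0 < s" "\<And>y z. y \<in> cball y0 s \<Longrightarrow> z \<in> cball y0 s \<Longrightarrow> norm (G y - G z) \<le> M * norm (y - z)"
    using assms(2) unfolding lipschitz_near_def by blast
  show ?thesis
  proof (rule lipschitz_nearI)
    fix y z assume "y \<in> cball y0 (min r s)" "z \<in> cball y0 (min r s)"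
    then have "norm (F y - F z) + norm (G y - G z) \<le> (L + M) * norm (y - z)"
      using F(2)[of y z] G(2)[of y z] by (simp add: algebra_simps)
    then show "norm (F y + G y - (F z + G z)) \<le> (L + M) * norm (y - z)"
      using norm_triangle_ineq[of "F y - F z" "G y - G z"] by (simp add: algebra_simps)
  qed (use F G in simp)
qed

lemma lipschitz_near_mult:
  fixes F G :: "'a::real_normed_vector \<Rightarrow> real"
  assumes "lipschitz_near y0 F" "lipschitz_near y0 G"
  shows "lipschitz_near y0 (\<lambda>y. F y * G y)"
proof -
  obtain r L B where F: "0 < r" "0 \<le> L" "0 \<le> B"
      "\<And>y z. y \<in> cball y0 r \<Longrightarrow> z \<in> cball y0 r \<Longrightarrow> norm (F y - F z) \<le> L * norm (y - z)"
      "\<And>y. y \<in> cball y0 r \<Longrightarrow> norm (F y) \<le> B"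
    by (rule lipschitz_near_bound[OF assms(1)]) blast
  obtain s M C where G: "0 < s" "0 \<le> M" "0 \<le> C"
      "\<And>y z. y \<in> cball y0 s \<Longrightarrow> z \<in> cball y0 s \<Longrightarrow> norm (G y - G z) \<le> M * norm (y - z)"
      "\<And>y. y \<in> cball y0 s \<Longrightarrow> norm (G y) \<le> C"
    by (rule lipschitz_near_bound[OF assms(2)]) blast
  show ?thesis
  proof (rule lipschitz_nearI)
    fix y z assume yz: "y \<in> cball y0 (min r s)" "z \<in> cball y0 (min r s)"
    have "F y * G y - F z * G z = F y * (G y - G z) + (F y - F z) * G z" by (simp add: algebra_simps)
    then have "norm (F y * G y - F z * G z) \<le> norm (F y) * norm (G y - G z) + norm (F y - F z) * norm (G z)"
      by (metis norm_mult norm_triangle_ineq)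
    also have "\<dots> \<le> B * (M * norm (y - z)) + (L * norm (y - z)) * C"
      using yz F G by (intro add_mono mult_mono) auto
    finally show "norm (F y * G y - F z * G z) \<le> (B * M + L * C) * norm (y - z)"
      by (simp add: algebra_simps)
  qed (use F G in simp)
qed

lemma lipschitz_near_inverse:
  fixes F :: "'a::real_normed_vector \<Rightarrow> real"
  assumes "lipschitz_near y0 F" "F y0 \<noteq> 0"
  shows "lipschitz_near y0 (\<lambda>y. inverse (F y))"
proof -
  obtain r L where F: "0 < r" "0 \<le> L"
      "\<And>y z. y \<in> cball y0 r \<Longrightarrow> z \<in> cball y0 r \<Longrightarrow> norm (F y - F z) \<le> L * norm (y - z)"
    using assms(1) unfolding lipschitz_near_def by blast
  let ?m = "\<bar>F y0\<bar> / 2"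
  \<comment> \<open>On this ball \<open>\<bar>F y\<bar>\<close> is at least half its value at the
    centre; the 1 in \<open>L + 1\<close> guards against \<open>L = 0\<close>.\<close>
  define s where "s = min r (?m / (L + 1))"
  have m: "0 < ?m" using assms(2) by simp
  have s: "0 < s" "s \<le> r" using F m by (auto simp: s_def)
  have lower: "?m \<le> \<bar>F y\<bar>" if y: "y \<in> cball y0 s" for y
  proof -
    have "\<bar>F y - F y0\<bar> \<le> L * norm (y - y0)" using F(3)[of y y0] y s F(1) by simp
    also have "\<dots> \<le> L * (?m / (L + 1))"
      using y F(2) by (intro mult_left_mono) (auto simp: dist_norm norm_minus_commute s_def)
    also have "\<dots> \<le> ?m" using F(2) m by (simp add: field_simps)
    finally show ?thesis by (simp add: abs_if split: if_splits)
  qed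
  show ?thesis
  proof (rule lipschitz_nearI[OF s(1)])
    fix y z assume yz: "y \<in> cball y0 s" "z \<in> cball y0 s"
    have nz: "F y \<noteq> 0" "F z \<noteq> 0" using lower[OF yz(1)] lower[OF yz(2)] m by auto
    have "inverse (F y) - inverse (F z) = (F z - F y) / (F y * F z)" using nz by (simp add: field_simps)
    then have "norm (inverse (F y) - inverse (F z)) = \<bar>F y - F z\<bar> / (\<bar>F y\<bar> * \<bar>F z\<bar>)"
      by (simp add: abs_mult abs_minus_commute)
    also have "\<dots> \<le> (L * norm (y - z)) / (?m * ?m)"
      using F(3)[of y z] yz s m lower[OF yz(1)] lower[OF yz(2)] F(2)
      by (intro frac_le mult_mono mult_nonneg_nonneg mult_pos_pos) auto
    finally show "norm (inverse (F y) - inverse (F z)) \<le> (L / (?m * ?m)) * norm (y - z)" by (simp add: mult_ac)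
  qed
qed

lemma lipschitz_near_sum:
  "(\<And>i. i \<in> I \<Longrightarrow> lipschitz_near y0 (F i)) \<Longrightarrow> lipschitz_near y0 (\<lambda>y. \<Sum>i\<in>I. F i y)"
  by (induction I rule: infinite_finite_induct) (auto intro: lipschitz_near_const lipschitz_near_add)

lemma lipschitz_near_prod:
  fixes F :: "'i \<Rightarrow> 'a::real_normed_vector \<Rightarrow> real"
  shows "(\<And>i. i \<in> I \<Longrightarrow> lipschitz_near y0 (F i)) \<Longrightarrow> lipschitz_near y0 (\<lambda>y. \<Prod>i\<in>I. F i y)"
  by (induction I rule: infinite_finite_induct) (auto intro: lipschitz_near_const lipschitz_near_mult)

lemma lipschitz_near_det:
  fixes M :: "'a::real_normed_vector \<Rightarrow> real^'n^'n"
  assumes "\<And>i j. lipschitz_near y0 (\<lambda>y. M y $ i $ j)"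
  shows "lipschitz_near y0 (\<lambda>y. det (M y))"
  unfolding det_def
  by (intro lipschitz_near_sum lipschitz_near_mult lipschitz_near_const lipschitz_near_prod assms)

lemma lipschitz_near_cong:
  assumes "lipschitz_near y0 F" "open S" "y0 \<in> S" "\<And>y. y \<in> S \<Longrightarrow> F y = G y"
  shows "lipschitz_near y0 G"
proof -
  obtain r L where F: "0 < r"
      "\<And>y z. y \<in> cball y0 r \<Longrightarrow> z \<in> cball y0 r \<Longrightarrow> norm (F y - F z) \<le> L * norm (y - z)"
    using assms(1) unfolding lipschitz_near_def by blast
  obtain s where s: "0 < s" "cball y0 s \<subseteq> S" using assms(2,3) open_contains_cball by blast
  show ?thesis
  proof (rule lipschitz_nearI)
    fix y z assume "y \<in> cball y0 (min r s)" "z \<in> cball y0 (min r s)"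
    then show "norm (G y - G z) \<le> L * norm (y - z)"
      using F(2)[of y z] assms(4)[of y] assms(4)[of z] s(2) by (auto simp: subset_iff)
  qed (use F s in simp)
qed

text \<open>Cramer's rule writes every entry of the inverse as a quotient of determinants, which are
  polynomials in the entries.\<close>

lemma lipschitz_near_matrix_inv:
  fixes M :: "'a::real_normed_vector \<Rightarrow> real^'n^'n"
  assumes M: "\<And>i j. lipschitz_near y0 (\<lambda>y. M y $ i $ j)"
    and S: "open S" "y0 \<in> S" and inv: "\<And>y. y \<in> S \<Longrightarrow> invertible (M y)"
  shows "lipschitz_near y0 (\<lambda>y. matrix_inv (M y) $ k $ l)"
proof -
  \<comment> \<open>\<open>M y\<close> with column \<open>k\<close> replaced by the basis vector
    \<open>axis l 1\<close>: Cramer's numerator for component \<open>k\<close> of column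
    \<open>l\<close> of the inverse.\<close>
  let ?N = "\<lambda>y. \<chi> i j. if j = k then axis l 1 $ i else M y $ i $ j"
  have "lipschitz_near y0 (\<lambda>y. ?N y $ i $ j)" for i j
    using M lipschitz_near_const by (cases "j = k") auto
  then have "lipschitz_near y0 (\<lambda>y. det (?N y) * inverse (det (M y)))"
    using inv[OF S(2)]
    by (intro lipschitz_near_mult lipschitz_near_det lipschitz_near_inverse M) (auto simp: invertible_det_nz)
  then show ?thesis
  proof (rule lipschitz_near_cong[OF _ S])
    fix y assume y: "y \<in> S"
    have "M y ** matrix_inv (M y) = mat 1"
      using someI_ex[OF inv[OF y, unfolded invertible_def]] unfolding matrix_inv_def by blast
    then have "M y *v (matrix_inv (M y) *v axis l 1) = axis l 1"
      by (simp add: matrix_vector_mul_assoc)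
    then have "matrix_inv (M y) *v axis l 1 = (\<chi> k. det (\<chi> i j. if j = k then axis l 1 $ i else M y $ i $ j) / det (M y))"
      using inv[OF y] by (intro iffD1[OF cramer]) (simp add: invertible_det_nz)
    then have "(matrix_inv (M y) *v axis l 1) $ k = det (?N y) / det (M y)" by simp
    then show "det (?N y) * inverse (det (M y)) = matrix_inv (M y) $ k $ l"
      by (simp add: matrix_vector_mult_basis column_def divide_inverse)
  qed
qed

lemma lipschitz_near_finite:
  fixes F :: "'i::finite \<Rightarrow> 'a::real_normed_vector \<Rightarrow> 'b::real_normed_vector"
  assumes "\<And>i. lipschitz_near y0 (F i)" and r0: "0 < r0"
  shows "\<exists>r L. 0 < r \<and> r \<le> r0 \<and> 0 \<le> L \<and>
    (\<forall>i. \<forall>y\<in>cball y0 r. norm (F i y) \<le> L \<and> (\<forall>z\<in>cball y0 r. norm (F i y - F i z) \<le> L * norm (y - z)))"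
proof -
  have "\<exists>r L B. 0 < r \<and> 0 \<le> L \<and> 0 \<le> B \<and> (\<forall>y\<in>cball y0 r. norm (F i y) \<le> B \<and>
      (\<forall>z\<in>cball y0 r. norm (F i y - F i z) \<le> L * norm (y - z)))" for i
    by (rule lipschitz_near_bound[OF assms(1)[of i]]) metis
  then obtain r L B where *: "\<And>i. 0 < r i \<and> 0 \<le> L i \<and> 0 \<le> B i \<and> (\<forall>y\<in>cball y0 (r i). norm (F i y) \<le> B i \<and>
      (\<forall>z\<in>cball y0 (r i). norm (F i y - F i z) \<le> L i * norm (y - z)))"
    by metis
  \<comment> \<open>All \<open>L i\<close> and \<open>B i\<close> are nonnegative, so the total sum
    dominates each of them and serves both estimates.\<close>
  let ?r = "min r0 (Min (range r))" and ?L = "\<Sum>i\<in>UNIV. L i + B i"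
  have le: "L i + B i \<le> ?L" for i using * by (intro member_le_sum) (auto simp: add_nonneg_nonneg)
  have L: "L i \<le> ?L" "B i \<le> ?L" for i using le[of i] *[of i] by linarith+
  have sub: "cball y0 ?r \<subseteq> cball y0 (r i)" for i
    by (rule subset_cball) (simp add: min.coboundedI2)
  have "norm (F i y) \<le> ?L \<and> (\<forall>z\<in>cball y0 ?r. norm (F i y - F i z) \<le> ?L * norm (y - z))"
    if y: "y \<in> cball y0 ?r" for i y
  proof -
    have y': "y \<in> cball y0 (r i)" using y sub by blast
    have "norm (F i y - F i z) \<le> ?L * norm (y - z)" if "z \<in> cball y0 ?r" for z
    proof -
      have "z \<in> cball y0 (r i)" using that sub by blast
      then have "norm (F i y - F i z) \<le> L i * norm (y - z)" using * y' by blast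
      also have "\<dots> \<le> ?L * norm (y - z)" using L by (intro mult_right_mono) auto
      finally show ?thesis .
    qed
    moreover have "norm (F i y) \<le> ?L" using * y' L(2)[of i] by (meson order_trans)
    ultimately show ?thesis by blast
  qed
  moreover have "0 < ?r" using * r0 by (simp add: Min_gr_iff)
  moreover have "0 \<le> ?L" using * by (intro sum_nonneg) (auto simp: add_nonneg_nonneg)
  moreover have "?r \<le> r0" by simp
  ultimately show ?thesis by blast
qed

lemma lipschitz_near_isCont: 
  assumes "lipschitz_near y0 F"
  shows "isCont F y0"
proof -
  obtain r L where r: "0 < r" "0 \<le> L" "\<And>y z. y \<in> cball y0 r \<Longrightarrow> z \<in> cball y0 r \<Longrightarrow> norm (F y - F z) \<le> L * norm (y - z)"
    using assms unfolding lipschitz_near_def by blast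
  then have "L-lipschitz_on (cball y0 r) F" by (auto intro!: lipschitz_onI simp: dist_norm)
  then have "continuous_on (ball y0 r) F"
    by (rule continuous_on_subset[OF lipschitz_on_continuous_on ball_subset_cball])
  then show ?thesis using r(1) by (simp add: continuous_on_eq_continuous_at)
qed

section \<open>Projection onto a level set along a transversal direction\<close>

text \<open>On the ball, lines in the direction \<open>e\<close> climb \<open>f\<close> at rate at
  least \<open>a\<close>, while \<open>f\<close> varies at rate at most \<open>L\<close> in any
  direction. The quotient \<open>L / a\<close> governs all later estimates.\<close>

locale transversal =
  fixes f :: "real^'n \<Rightarrow> real" and S :: "(real^'n) set" and x0 e :: "real^'n" and r a L :: real
  assumes open_S: "open S" and C2: "Ck_on 2 S f" and ball_S: "cball x0 r \<subseteq> S" and r_pos: "0 < r"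
    and norm_e: "norm e = 1" and a_pos: "0 < a" and L_nonneg: "0 \<le> L"
    and slope: "\<And>y. y \<in> cball x0 r \<Longrightarrow> a \<le> fderiv f y e"
    and bound: "\<And>y h. y \<in> cball x0 r \<Longrightarrow> \<bar>fderiv f y h\<bar> \<le> L * norm h"
    and zero: "f x0 = 0"
begin

text \<open>The solution of \<open>\<rho> + L / a * \<rho> = r\<close>: a point within
  \<open>\<rho>\<close> of \<open>x0\<close> has \<open>\<bar>f y\<bar> \<le> L * \<rho>\<close>, so
  the zero on its line is at most \<open>L / a * \<rho>\<close> away and still in the large
  ball.\<close>

definition inner_radius where "inner_radius = r * a / (a + L)"

lemma inner_radius: "0 < inner_radius" "inner_radius + L / a * inner_radius = r" "inner_radius \<le> r"
proof -
  have aL: "0 < a + L" using a_pos L_nonneg by simp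
  then show "0 < inner_radius" using r_pos a_pos by (simp add: inner_radius_def)
  have "inner_radius + L / a * inner_radius = (a + L) / a * inner_radius"
    using a_pos by (simp add: field_simps)
  also have "\<dots> = r" using aL a_pos by (simp add: inner_radius_def)
  finally show eq: "inner_radius + L / a * inner_radius = r" .
  have "0 \<le> L / a * inner_radius" using \<open>0 < inner_radius\<close> a_pos L_nonneg by simp
  with eq show "inner_radius \<le> r" by linarith
qed

lemma segment_S: "y \<in> cball x0 r \<Longrightarrow> z \<in> cball x0 r \<Longrightarrow> 0 \<le> t \<Longrightarrow> t \<le> 1 \<Longrightarrow> y + t *\<^sub>R (z - y) \<in> cball x0 r"
  using convexD_alt[OF convex_cball, of y x0 r z t] by (simp add: algebra_simps)

lemma mvt:
  assumes "y \<in> cball x0 r" "z \<in> cball x0 r"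
  shows "\<exists>p\<in>cball x0 r. f z - f y = fderiv f p (z - y)"
proof -
  have "\<exists>t. 0 < t \<and> t < 1 \<and> f (y + 1 *\<^sub>R (z - y)) - f (y + 0 *\<^sub>R (z - y)) =
      (1 - 0) * fderiv f (y + t *\<^sub>R (z - y)) (z - y)"
  proof (rule MVT2[of 0 1 "\<lambda>t. f (y + t *\<^sub>R (z - y))"])
    fix t :: real assume t: "0 \<le> t" "t \<le> 1"
    have "((\<lambda>t. y + t *\<^sub>R (z - y)) has_vector_derivative z - y) (at t within UNIV)"
      by (auto intro!: derivative_eq_intros)
    from has_vector_derivative_compose_C2[OF C2 _ this] segment_S[OF assms t] ball_S
    show "((\<lambda>t. f (y + t *\<^sub>R (z - y))) has_real_derivative
        fderiv f (y + t *\<^sub>R (z - y)) (z - y)) (at t)"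
      by (auto simp: has_real_derivative_iff_has_vector_derivative)
  qed simp
  then show ?thesis using segment_S[OF assms] by force
qed

lemma lipschitz:
  assumes "y \<in> cball x0 r" "z \<in> cball x0 r"
  shows "\<bar>f z - f y\<bar> \<le> L * norm (z - y)"
  using mvt[OF assms] bound by force

lemma derivative_linear: "y \<in> cball x0 r \<Longrightarrow> linear (fderiv f y)"
  using ball_S by (intro C2_derivative_linear[OF C2]) auto

lemma decrease:
  assumes "y - s *\<^sub>R e \<in> cball x0 r" "y - t *\<^sub>R e \<in> cball x0 r" "s \<le> t"
  shows "a * (t - s) \<le> f (y - s *\<^sub>R e) - f (y - t *\<^sub>R e)"
proof -
  from mvt[OF assms(2,1)] obtain p where p: "p \<in> cball x0 r"
    "f (y - s *\<^sub>R e) - f (y - t *\<^sub>R e) = fderiv f p ((t - s) *\<^sub>R e)"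
    by (auto simp: algebra_simps)
  then have "f (y - s *\<^sub>R e) - f (y - t *\<^sub>R e) = (t - s) * fderiv f p e"
    using linear_cmul[OF derivative_linear[OF p(1)]] by simp
  then show ?thesis using slope[OF p(1)] assms(3) by (simp add: mult.commute[of a] mult_left_mono)
qed

lemma shift_in:
  assumes "y \<in> cball x0 inner_radius" "\<bar>s\<bar> \<le> L / a * inner_radius"
  shows "y - s *\<^sub>R e \<in> cball x0 r"
proof -
  have "norm (x0 - (y - s *\<^sub>R e)) \<le> norm (x0 - y) + norm (s *\<^sub>R e)"
    using norm_triangle_ineq[of "x0 - y" "s *\<^sub>R e"] by (simp add: algebra_simps)
  also have "\<dots> \<le> r" using assms norm_e inner_radius(2) by (simp add: dist_norm)
  finally show ?thesis by (simp add: dist_norm)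
qed

lemma root_exists:
  assumes y: "y \<in> cball x0 inner_radius"
  shows "\<exists>s. \<bar>s\<bar> \<le> L / a * inner_radius \<and> f (y - s *\<^sub>R e) = 0"
proof -
  let ?s = "L / a * inner_radius"
  have s: "0 \<le> ?s" using L_nonneg a_pos inner_radius(1) by simp
  have yr: "y \<in> cball x0 r" "x0 \<in> cball x0 r" using y inner_radius(3) r_pos by auto
  have "\<bar>f y\<bar> \<le> L * norm (y - x0)" using lipschitz[OF yr(2,1)] zero by simp
  also have "\<dots> \<le> L * inner_radius" using y L_nonneg by (intro mult_left_mono) (auto simp: dist_norm norm_minus_commute)
  finally have fy: "\<bar>f y\<bar> \<le> a * ?s" using a_pos by simp
  \<comment> \<open>At the two ends of the shift range the slope \<open>a\<close> outweighs
    \<open>\<bar>f y\<bar>\<close>, so \<open>f\<close> has opposite weak signs there.\<close>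
  have "f (y - ?s *\<^sub>R e) \<le> 0" "0 \<le> f (y - (- ?s) *\<^sub>R e)"
    using decrease[of y 0 ?s] decrease[of y "- ?s" 0] shift_in[OF y, of ?s] shift_in[OF y, of "- ?s"] s yr(1) fy
    by (auto simp: abs_le_iff)
  moreover have "continuous_on {- ?s..?s} (\<lambda>s. f (y - s *\<^sub>R e))"
    using shift_in[OF y] ball_S
    by (intro continuous_on_compose2[OF C2_continuous_on[OF C2]] continuous_intros) (auto simp: abs_le_iff)
  ultimately have "\<exists>s\<ge>- ?s. s \<le> ?s \<and> f (y - s *\<^sub>R e) = 0"
    by (intro IVT2') (use s in auto)
  then show ?thesis by (auto simp: abs_le_iff)
qed

text \<open>The signed length \<sigma> of the overview, as a function of the point. By
  \<open>decrease\<close>, \<open>f\<close> is strictly decreasing along the shifts that stay in the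
  ball, so the choice has a single candidate.\<close>

definition root where "root y = (SOME s. \<bar>s\<bar> \<le> L / a * inner_radius \<and> f (y - s *\<^sub>R e) = 0)"
definition foot where "foot y = y - root y *\<^sub>R e"

lemma root:
  assumes "y \<in> cball x0 inner_radius"
  shows "\<bar>root y\<bar> \<le> L / a * inner_radius" "f (foot y) = 0"
  using someI_ex[OF root_exists[OF assms]] unfolding root_def foot_def by auto

lemma foot_in: "y \<in> cball x0 inner_radius \<Longrightarrow> foot y \<in> cball x0 r"
  unfolding foot_def by (intro shift_in root)

text \<open>By \<open>decrease\<close>, \<open>f y\<close> is at least \<open>a * root y\<close>
  where the root is nonnegative and at most \<open>a * root y\<close> where it is
  nonpositive.\<close>

lemma root_pos_iff:
  assumes y: "y \<in> cball x0 inner_radius"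
  shows "0 < root y \<longleftrightarrow> 0 < f y" and "root y = 0 \<longleftrightarrow> f y = 0"
proof -
  have yr: "y - 0 *\<^sub>R e \<in> cball x0 r" using y inner_radius(3) by auto
  note foot = foot_in[OF y, unfolded foot_def] root(2)[OF y, unfolded foot_def]
  have "a * root y \<le> f y" if "0 \<le> root y"
    using decrease[OF yr foot(1) that] foot(2) by simp
  moreover have "f y \<le> a * root y" if "root y \<le> 0"
    using decrease[OF foot(1) yr that] foot(2) by simp
  moreover have "0 < root y \<Longrightarrow> 0 < a * root y" "root y < 0 \<Longrightarrow> a * root y < 0" "a * root y = 0 \<longleftrightarrow> root y = 0"
    using a_pos by (simp_all add: mult_pos_neg)
  ultimately show "0 < root y \<longleftrightarrow> 0 < f y" "root y = 0 \<longleftrightarrow> f y = 0"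
    by linarith+
qed

text \<open>The point \<open>?m\<close> lies on the line of \<open>z\<close> but is shifted by the
  root of \<open>y\<close>. It differs from \<open>foot y\<close> by \<open>z - y\<close>, so
  \<open>f ?m\<close> is at most \<open>L * norm (z - y)\<close> in absolute value; it differs from
  \<open>foot z\<close> by the difference of the roots along \<open>e\<close>, which the slope
  \<open>a\<close> controls through \<open>f ?m\<close>.\<close>

lemma root_lipschitz:
  assumes y: "y \<in> cball x0 inner_radius" and z: "z \<in> cball x0 inner_radius"
  shows "\<bar>root z - root y\<bar> \<le> L / a * norm (z - y)"
proof -
  let ?m = "z - root y *\<^sub>R e"
  have m: "?m \<in> cball x0 r" by (intro shift_in z root(1) y)
  have "\<bar>f ?m\<bar> \<le> L * norm (z - y)"
    using lipschitz[OF foot_in[OF y] m] root(2)[OF y] by (simp add: foot_def)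
  moreover have "a * \<bar>root z - root y\<bar> \<le> \<bar>f ?m\<bar>"
    using decrease[OF m foot_in[OF z, unfolded foot_def]] decrease[OF foot_in[OF z, unfolded foot_def] m]
      root(2)[OF z] by (cases "root y \<le> root z") (auto simp: foot_def algebra_simps)
  ultimately show ?thesis using a_pos by (simp add: field_simps)
qed

lemma slope_pos: "y \<in> cball x0 r \<Longrightarrow> 0 < fderiv f y e"
  using slope[of y] a_pos by linarith

text \<open>Implicit differentiation of \<open>f (foot z) = 0\<close>: the linearization of
  \<open>f\<close> at \<open>foot y\<close> has an error small against
  \<open>norm (foot z - foot y)\<close>, which by \<open>root_lipschitz\<close> is at most a
  multiple of \<open>norm (z - y)\<close>. Solving for \<open>root z - root y\<close> divides by the
  slope along \<open>e\<close>.\<close>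

lemma root_has_derivative:
  assumes y: "y \<in> cball x0 inner_radius"
  shows "(root has_derivative (\<lambda>h. fderiv f (foot y) h / fderiv f (foot y) e))
    (at y within cball x0 inner_radius)"
proof -
  let ?D = "fderiv f (foot y)"
  have lin: "linear ?D" by (rule derivative_linear[OF foot_in[OF y]])
  have D: "(f has_derivative ?D) (at (foot y))"
    using foot_in[OF y] ball_S by (intro C2_has_derivative[OF C2]) auto
  note e_pos = slope[OF foot_in[OF y]]
  \<comment> \<open>The factor \<open>1 + L / a\<close> bounds the displacement of the foot; the
    division by \<open>a\<close> accounts for dividing by the slope.\<close>
  let ?K = "(1 + L / a) / a"
  have K: "0 < ?K" using a_pos L_nonneg by (simp add: add_pos_nonneg)
  show ?thesis unfolding has_derivative_within_alt
  proof (intro conjI allI impI)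
    show "bounded_linear (\<lambda>h. ?D h / ?D e)"
      using has_derivative_bounded_linear[OF D] bounded_linear_divide bounded_linear_compose by blast
    fix \<eta> :: real assume \<eta>: "0 < \<eta>"
    obtain d where d: "0 < d" "\<And>q. norm (q - foot y) < d \<Longrightarrow>
        norm (f q - f (foot y) - ?D (q - foot y)) \<le> \<eta> / ?K * norm (q - foot y)"
      using D \<eta> K unfolding has_derivative_at_alt by (meson divide_pos_pos)
    have "norm (root z - root y - ?D (z - y) / ?D e) \<le> \<eta> * norm (z - y)"
      if z: "z \<in> cball x0 inner_radius" "norm (z - y) < d / (1 + L / a)" for z
    proof -
      have q: "foot z - foot y = (z - y) - (root z - root y) *\<^sub>R e"
        by (simp add: foot_def algebra_simps)
      have "norm (foot z - foot y) \<le> norm (z - y) + \<bar>root z - root y\<bar>"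
        unfolding q using norm_triangle_ineq4[of "z - y" "(root z - root y) *\<^sub>R e"] norm_e by simp
      also have "\<dots> \<le> (1 + L / a) * norm (z - y)"
        using root_lipschitz[OF y z(1)] by (simp add: algebra_simps)
      finally have n: "norm (foot z - foot y) \<le> (1 + L / a) * norm (z - y)" .
      also have "\<dots> < d" using z(2) a_pos L_nonneg
        by (simp add: pos_less_divide_eq add_pos_nonneg mult.commute)
      finally have "norm (f (foot z) - f (foot y) - ?D (foot z - foot y)) \<le> \<eta> / ?K * norm (foot z - foot y)"
        by (rule d(2))
      also have "\<dots> \<le> \<eta> / ?K * ((1 + L / a) * norm (z - y))"
        using less_imp_le[OF divide_pos_pos[OF \<eta> K]] by (rule mult_left_mono[OF n])
      also have "\<dots> = \<eta> * a * norm (z - y)"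
      proof -
        have "0 < 1 + L / a" using a_pos L_nonneg by (simp add: add_pos_nonneg)
        then show ?thesis by simp
      qed
      finally have "\<bar>?D (z - y) - (root z - root y) * ?D e\<bar> \<le> \<eta> * a * norm (z - y)"
        unfolding q root(2)[OF y] root(2)[OF z(1)]
        by (simp add: linear_diff[OF lin] linear_cmul[OF lin] abs_minus_commute)
      also have "\<dots> \<le> \<eta> * ?D e * norm (z - y)"
        using e_pos \<eta> by (intro mult_right_mono mult_left_mono) auto
      finally have "\<bar>?D (z - y) - (root z - root y) * ?D e\<bar> / ?D e \<le> \<eta> * norm (z - y)"
        using e_pos a_pos by (simp add: pos_divide_le_eq mult_ac)
      also have "\<bar>?D (z - y) - (root z - root y) * ?D e\<bar> / ?D e = \<bar>(?D (z - y) - (root z - root y) * ?D e) / ?D e\<bar>"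
        using e_pos a_pos by simp
      also have "(?D (z - y) - (root z - root y) * ?D e) / ?D e = - (root z - root y - ?D (z - y) / ?D e)"
        using e_pos a_pos by (simp add: diff_divide_distrib)
      finally show ?thesis by simp
    qed
    moreover have "0 < d / (1 + L / a)" using d(1) a_pos L_nonneg by (simp add: add_pos_nonneg)
    ultimately show "\<exists>d>0. \<forall>z\<in>cball x0 inner_radius. norm (z - y) < d \<longrightarrow>
      norm (root z - root y - ?D (z - y) / ?D e) \<le> \<eta> * norm (z - y)" by blast
  qed
qed

definition root_speed where
  "root_speed y v = fderiv f (foot y) v / fderiv f (foot y) e"

text \<open>The component of \<open>v\<close> in the kernel of the differential at the foot, with
  respect to the splitting into this kernel and the line of \<open>e\<close>.\<close>

definition foot_velocity where "foot_velocity y v = v - root_speed y v *\<^sub>R e"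

lemma foot_velocity_tangent:
  assumes y: "y \<in> cball x0 inner_radius"
  shows "fderiv f (foot y) (foot_velocity y v) = 0"
  using slope_pos[OF foot_in[OF y]] derivative_linear[OF foot_in[OF y]]
  by (simp add: foot_velocity_def root_speed_def linear_diff linear_cmul)

lemma root_speed_bound:
  assumes y: "y \<in> cball x0 inner_radius"
  shows "\<bar>root_speed y v\<bar> \<le> L / a * norm v"
proof -
  have "\<bar>root_speed y v\<bar> \<le> L * norm v / a"
    unfolding root_speed_def abs_divide
    using bound[OF foot_in[OF y]] slope[OF foot_in[OF y]] a_pos L_nonneg by (intro frac_le) auto
  then show ?thesis by simp
qed

lemma root_curve:
  assumes x: "(x has_vector_derivative v) (at t within I)" and sub: "x ` I \<subseteq> cball x0 inner_radius" "t \<in> I"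
  shows "((\<lambda>s. root (x s)) has_real_derivative root_speed (x t) v) (at t within I)"
    and "((\<lambda>s. foot (x s)) has_vector_derivative foot_velocity (x t) v) (at t within I)"
proof -
  have "(root has_derivative (\<lambda>h. root_speed (x t) h)) (at (x t) within x ` I)"
    unfolding root_speed_def using sub
    by (intro has_derivative_subset[OF root_has_derivative]) auto
  then show 1: "((\<lambda>s. root (x s)) has_real_derivative root_speed (x t) v) (at t within I)"
    using vector_derivative_diff_chain_within[OF x]
    by (auto simp: o_def has_real_derivative_iff_has_vector_derivative)
  show "((\<lambda>s. foot (x s)) has_vector_derivative foot_velocity (x t) v) (at t within I)"
    unfolding foot_def foot_velocity_def using x 1
    by (auto intro!: derivative_eq_intros)
qed

text \<open>Quotient rule. The derivative of the denominator supplies the term that turns the second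
  derivative in the directions \<open>foot_velocity\<close> and \<open>v\<close> into the one with
  \<open>foot_velocity\<close> twice, so that only tangent directions occur.\<close>

lemma root_speed_curve:
  assumes x: "\<And>s. s \<in> I \<Longrightarrow> (x has_vector_derivative v s) (at s within I)"
    and v: "(v has_vector_derivative w) (at t within I)"
    and sub: "x ` I \<subseteq> cball x0 inner_radius" "t \<in> I"
  shows "((\<lambda>s. root_speed (x s) (v s)) has_real_derivative
    (fderiv2 f (foot (x t)) (foot_velocity (x t) (v t)) (foot_velocity (x t) (v t)) +
      fderiv f (foot (x t)) w) / fderiv f (foot (x t)) e) (at t within I)"
proof -
  let ?b = "foot (x t)" and ?b' = "foot_velocity (x t) (v t)"
  have b: "?b \<in> cball x0 r" "?b \<in> S" using sub ball_S foot_in by blast+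
  note foot = root_curve(2)[OF x[OF sub(2)] sub]
  have N: "((\<lambda>s. fderiv f (foot (x s)) (v s)) has_real_derivative
      fderiv2 f ?b ?b' (v t) + fderiv f ?b w) (at t within I)"
    using has_vector_derivative_derivative_C2[OF open_S C2 b(2) foot v]
    by (simp add: has_real_derivative_iff_has_vector_derivative)
  have M: "((\<lambda>s. fderiv f (foot (x s)) e) has_real_derivative
      fderiv2 f ?b ?b' e) (at t within I)"
    using has_vector_derivative_derivative_C2[OF open_S C2 b(2) foot has_vector_derivative_const[of e]]
      linear_0[OF derivative_linear[OF b(1)]]
    by (simp add: has_real_derivative_iff_has_vector_derivative)
  note lin = C2_second_derivative_linear_right[OF open_S C2 b(2), of ?b']
  have split: "fderiv2 f ?b ?b' ?b' =
      fderiv2 f ?b ?b' (v t) - root_speed (x t) (v t) * fderiv2 f ?b ?b' e"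
    using linear_diff[OF lin, of "v t" "root_speed (x t) (v t) *\<^sub>R e"] linear_cmul[OF lin, of _ e]
    by (simp add: foot_velocity_def[of "x t" "v t", symmetric])
  have quotient: "((P + W) * D - N * Q) / (D * D) = (R + W) / D" if "D \<noteq> 0" "R = P - N / D * Q"
    for P Q R N D W :: real unfolding that(2) using that(1) by (simp add: field_simps)
  have nz: "fderiv f ?b e \<noteq> 0" using slope_pos[OF b(1)] by simp
  show ?thesis
    unfolding root_speed_def
    by (rule DERIV_divide[OF N M nz, THEN DERIV_cong]) (rule quotient[OF nz split[unfolded root_speed_def]])
qed

lemma foot_fixed:
  assumes "y \<in> cball x0 inner_radius" "f y = 0"
  shows "foot y = y" "root y = 0"
  using root_pos_iff(2)[OF assms(1)] assms(2) by (auto simp: foot_def)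

lemma foot_velocity_fixed:
  assumes "y \<in> cball x0 inner_radius" "f y = 0" "fderiv f y v = 0"
  shows "root_speed y v = 0" "foot_velocity y v = v"
  using foot_fixed[OF assms(1,2)] assms(3) by (auto simp: foot_velocity_def root_speed_def)

lemma foot_continuous:
  assumes "continuous_on I x" "x ` I \<subseteq> cball x0 inner_radius"
  shows "continuous_on I (\<lambda>t. foot (x t))"
proof -
  have "continuous_on (cball x0 inner_radius) root"
    using root_has_derivative by (rule has_derivative_continuous_on)
  then have "continuous_on I (\<lambda>t. root (x t))" using assms by (rule continuous_on_compose2)
  then show ?thesis unfolding foot_def by (intro continuous_intros assms)
qed

lemma foot_velocity_continuous:
  assumes x: "continuous_on I x" "x ` I \<subseteq> cball x0 inner_radius" and v: "continuous_on I v"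
  shows "continuous_on I (\<lambda>t. foot_velocity (x t) (v t))"
proof -
  have sub: "(\<lambda>t. foot (x t)) ` I \<subseteq> S" using x(2) foot_in ball_S by blast
  have nz: "fderiv f (foot (x t)) e \<noteq> 0" if "t \<in> I" for t
    using slope_pos[OF foot_in, of "x t"] x(2) that by (auto simp: image_subset_iff)
  show ?thesis
    unfolding foot_velocity_def root_speed_def
    by (intro continuous_intros continuous_on_derivative_C2[OF C2] foot_continuous x sub v ballI nz)
qed

end

lemma linear_bound_on_cball:
  fixes f :: "real^'n \<Rightarrow> 'b::real_normed_vector"
  assumes f: "Ck_on 2 S f" and sub: "cball x0 r \<subseteq> S" and r: "0 \<le> r"
  shows "\<exists>L\<ge>0. \<forall>y\<in>cball x0 r. \<forall>h. norm (fderiv f y h) \<le> L * norm h"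
proof -
  have "\<exists>B. \<forall>y\<in>cball x0 r. norm (fderiv f y (axis j 1)) \<le> B" for j
  proof -
    have "continuous_on (cball x0 r) (\<lambda>y. fderiv f y (axis j 1))"
      by (rule continuous_on_derivative_C2[OF f]) (use sub in \<open>auto intro!: continuous_intros\<close>)
    then have "bounded ((\<lambda>y. fderiv f y (axis j 1)) ` cball x0 r)"
      by (intro compact_imp_bounded compact_continuous_image) auto
    then show ?thesis by (auto simp: bounded_iff)
  qed
  then obtain B where B: "\<And>j y. y \<in> cball x0 r \<Longrightarrow> norm (fderiv f y (axis j 1)) \<le> B j"
    by metis
  have B0: "0 \<le> B j" for j using B[of x0 j] r by (auto intro: order_trans[OF norm_ge_zero])
  show ?thesis
  proof (intro exI[of _ "sum B UNIV"] conjI ballI allI)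
    show "0 \<le> sum B UNIV" using B0 by (simp add: sum_nonneg)
    fix y h assume y: "y \<in> cball x0 r"
    have "norm (fderiv f y h) \<le> (\<Sum>j\<in>UNIV. norm ((h $ j) *\<^sub>R fderiv f y (axis j 1)))"
      using y sub by (subst C2_derivative_sum[OF f]) (blast, rule norm_sum)
    also have "\<dots> \<le> (\<Sum>j\<in>UNIV. B j * norm h)"
      using B[OF y] B0 component_le_norm_cart[of h]
      by (auto intro!: sum_mono mult_mono simp: mult.commute[of "B _"])
    finally show "norm (fderiv f y h) \<le> sum B UNIV * norm h"
      by (simp add: sum_distrib_right)
  qed
qed

lemma transversal_exists:
  assumes S: "open S" and f: "Ck_on 2 S f" and x0: "x0 \<in> S" "f x0 = 0"
    and e: "norm e = 1" "0 < fderiv f x0 e" and r0: "0 < r0"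
  shows "\<exists>r a L. r \<le> r0 \<and> transversal f S x0 e r a L"
proof -
  let ?a = "fderiv f x0 e / 2"
  have "continuous_on S (\<lambda>y. fderiv f y e)"
    by (rule continuous_on_derivative_C2[OF f]) (auto intro!: continuous_intros)
  then have "open {y \<in> S. ?a < fderiv f y e}"
    using S by (auto simp: continuous_on_open_vimage Collect_conj_eq vimage_def Int_commute dest: spec[of _ "{?a<..}"])
  then obtain d where d: "0 < d" "ball x0 d \<subseteq> {y \<in> S. ?a < fderiv f y e}"
    using x0 e by (force simp: open_contains_ball)
  define r where "r = min (d / 2) r0"
  have r: "0 < r" "r \<le> r0" and sub: "cball x0 r \<subseteq> {y \<in> S. ?a < fderiv f y e}"
    using d r0 unfolding r_def by (auto simp: subset_iff)
  obtain L where L: "0 \<le> L" "\<And>y h. y \<in> cball x0 r \<Longrightarrow> norm (fderiv f y h) \<le> L * norm h"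
    using linear_bound_on_cball[OF f, of x0 r] sub r by (metis (no_types, lifting) less_imp_le mem_Collect_eq subset_iff)
  have "transversal f S x0 e r ?a L"
    by unfold_locales (use S f r e L x0 sub in \<open>auto simp: less_imp_le\<close>)
  with r show ?thesis by blast
qed

section \<open>Charts and tangent vectors\<close>

locale C2_manifold =
  fixes A :: "('a::{t2_space,second_countable_topology}, 'n::finite) chart set"
  assumes atlas: "C2_atlas A"
begin

abbreviation transition :: "('a, 'n) chart \<Rightarrow> ('a, 'n) chart \<Rightarrow> real^'n \<Rightarrow> real^'n" where
  "transition c d \<equiv> snd d \<circ> chart_inv c"

abbreviation transition_deriv :: "('a, 'n) chart \<Rightarrow> ('a, 'n) chart \<Rightarrow> 'a \<Rightarrow> real^'n \<Rightarrow> real^'n" where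
  "transition_deriv c d x \<equiv> fderiv (transition c d) (snd c x)"

abbreviation chart_image :: "('a, 'n) chart \<Rightarrow> (real^'n) set" where
  "chart_image c \<equiv> snd c ` fst c"

lemma open_chart: "c \<in> A \<Longrightarrow> open (fst c)" "c \<in> A \<Longrightarrow> open (chart_image c)"
  and chart_homeomorphism: "c \<in> A \<Longrightarrow> homeomorphism (fst c) (chart_image c) (snd c) (chart_inv c)"
  and transition_C2: "c \<in> A \<Longrightarrow> d \<in> A \<Longrightarrow> Ck_on 2 (snd c ` (fst c \<inter> fst d)) (transition c d)"
  and chart_cover: "(\<Union>c\<in>A. fst c) = UNIV"
  using atlas unfolding C2_atlas_def by blast+

lemma chart_inv_chart [simp]: "c \<in> A \<Longrightarrow> x \<in> fst c \<Longrightarrow> chart_inv c (snd c x) = x"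
  and chart_chart_inv [simp]: "c \<in> A \<Longrightarrow> y \<in> chart_image c \<Longrightarrow> snd c (chart_inv c y) = y"
  and chart_inv_in: "c \<in> A \<Longrightarrow> y \<in> chart_image c \<Longrightarrow> chart_inv c y \<in> fst c"
  using chart_homeomorphism[of c] unfolding homeomorphism_def by auto

lemma open_chart_overlap:
  assumes "c \<in> A" "d \<in> A"
  shows "open (snd c ` (fst c \<inter> fst d))"
proof -
  have "openin (top_of_set (chart_image c)) (snd c ` (fst c \<inter> fst d))"
    using open_chart[OF assms(2)]
    by (intro homeomorphism_imp_open_map[OF chart_homeomorphism[OF assms(1)]]) (auto simp: openin_open)
  then show ?thesis using open_chart(2)[OF assms(1)] openin_open_trans by blast
qed

lemma chart_at: "chart_at A x \<in> charts_at A x"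
proof -
  have "\<exists>c. c \<in> charts_at A x" using chart_cover unfolding charts_at_def by blast
  then show ?thesis unfolding chart_at_def by (rule someI_ex)
qed

lemma charts_atD: "c \<in> charts_at A x \<Longrightarrow> c \<in> A" "c \<in> charts_at A x \<Longrightarrow> x \<in> fst c"
  "c \<in> charts_at A x \<Longrightarrow> snd c x \<in> chart_image c"
  by (auto simp: charts_at_def)

lemma charts_at_chart_inv: "c \<in> A \<Longrightarrow> y \<in> chart_image c \<Longrightarrow> c \<in> charts_at A (chart_inv c y)"
  by (simp add: charts_at_def chart_inv_in)

lemma overlap: "c \<in> charts_at A x \<Longrightarrow> d \<in> charts_at A x \<Longrightarrow> snd c x \<in> snd c ` (fst c \<inter> fst d)"
  by (auto simp: charts_at_def)

lemma transition_has_derivative: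
  assumes "c \<in> charts_at A x" "d \<in> charts_at A x"
  shows "(transition c d has_derivative transition_deriv c d x) (at (snd c x))"
  using C2_has_derivative[OF transition_C2 overlap] assms charts_atD by blast

lemma transition_deriv_linear:
  assumes "c \<in> charts_at A x" "d \<in> charts_at A x"
  shows "linear (transition_deriv c d x)"
  using transition_has_derivative[OF assms] by (rule has_derivative_linear)

lemma transition_deriv_self:
  assumes "c \<in> charts_at A x"
  shows "transition_deriv c c x u = u"
proof -
  have "(transition c c has_derivative id) (at (snd c x))"
    by (rule has_derivative_transform_within_open[OF has_derivative_id open_chart(2)])
       (use charts_atD[OF assms] in auto)
  then show ?thesis by (metis frechet_derivative_at id_apply)
qed

text \<open>Cocycle rule, from the chain rule on the overlap of \<open>c\<close> and
  \<open>d\<close>, where the detour through \<open>d\<close> changes nothing.\<close>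

lemma transition_deriv_compose:
  assumes c: "c \<in> charts_at A x" and d: "d \<in> charts_at A x" and e: "e \<in> charts_at A x"
  shows "transition_deriv d e x (transition_deriv c d x u) = transition_deriv c e x u"
proof -
  have cA: "c \<in> A" "d \<in> A" "x \<in> fst c" using c d charts_atD by auto
  have "(transition d e \<circ> transition c d has_derivative transition_deriv d e x \<circ> transition_deriv c d x) (at (snd c x))"
    using transition_has_derivative[OF c d] transition_has_derivative[OF d e] cA
    by (intro diff_chain_at) auto
  then have "(transition c e has_derivative transition_deriv d e x \<circ> transition_deriv c d x) (at (snd c x))"
    by (rule has_derivative_transform_within_open[OF _ open_chart_overlap[OF cA(1,2)] overlap[OF c d]])
       (use cA in auto)
  from frechet_derivative_at[OF this] show ?thesis by (metis o_apply)
qed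

lemma tangent_of_apply: "d \<in> charts_at A x \<Longrightarrow> tangent_of A c x u d = transition_deriv c d x u"
  by (simp add: tangent_of_def)

lemma tangent_of_self: "c \<in> charts_at A x \<Longrightarrow> tangent_of A c x u c = u"
  by (simp add: tangent_of_apply transition_deriv_self)

lemma tangent_of_in: "c \<in> charts_at A x \<Longrightarrow> tangent_of A c x u \<in> tangent_space A x"
  by (simp add: tangent_space_def tangent_of_apply transition_deriv_compose) (simp add: tangent_of_def)

lemma tangent_component:
  assumes "v \<in> tangent_space A x" "c \<in> charts_at A x" "d \<in> charts_at A x"
  shows "v d = transition_deriv c d x (v c)"
  using assms unfolding tangent_space_def by blast

lemma tangent_of_component:
  assumes "v \<in> tangent_space A x" "c \<in> charts_at A x"
  shows "tangent_of A c x (v c) = v"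
proof
  fix d
  show "tangent_of A c x (v c) d = v d"
  proof (cases "d \<in> charts_at A x")
    case True
    then show ?thesis using tangent_component[OF assms] by (simp add: tangent_of_def)
  next
    case False
    then have "v d = 0" using assms(1) unfolding tangent_space_def by blast
    with False show ?thesis by (simp add: tangent_of_def)
  qed
qed

lemma tangent_of_change:
  assumes "c \<in> charts_at A x" "d \<in> charts_at A x"
  shows "tangent_of A d x (transition_deriv c d x u) = tangent_of A c x u"
proof
  fix e
  show "tangent_of A d x (transition_deriv c d x u) e = tangent_of A c x u e"
    using transition_deriv_compose[OF assms] by (simp add: tangent_of_def)
qed

lemma tangent_of_combination:
  assumes "c \<in> charts_at A x"
  shows "tangent_of A c x (a *\<^sub>R u + b *\<^sub>R v) = (\<lambda>d. a *\<^sub>R tangent_of A c x u d + b *\<^sub>R tangent_of A c x v d)"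
proof
  fix d
  show "tangent_of A c x (a *\<^sub>R u + b *\<^sub>R v) d = a *\<^sub>R tangent_of A c x u d + b *\<^sub>R tangent_of A c x v d"
    using transition_deriv_linear[OF assms, of d]
    by (cases "d \<in> charts_at A x") (auto simp: tangent_of_def linear_add linear_cmul)
qed

lemma tangent_of_zero: "c \<in> charts_at A x \<Longrightarrow> tangent_of A c x 0 = zero_tangent"
  using tangent_of_combination[of c x 0 0 0 0] by (simp add: zero_tangent_def)

lemma curve_in_chart_eventually:
  assumes "(\<gamma> \<longlongrightarrow> \<gamma> t) (at t within I)" "c \<in> charts_at A (\<gamma> t)"
  shows "eventually (\<lambda>s. \<gamma> s \<in> fst c) (at t within I)"
  using topological_tendstoD[OF assms(1) open_chart(1)] assms(2) charts_atD by blast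

lemma curve_change_chart:
  assumes \<gamma>: "(\<gamma> \<longlongrightarrow> \<gamma> t) (at t within I)" and c: "c \<in> charts_at A (\<gamma> t)" and d: "d \<in> charts_at A (\<gamma> t)"
    and v: "((snd c \<circ> \<gamma>) has_vector_derivative v) (at t within I)"
  shows "((snd d \<circ> \<gamma>) has_vector_derivative transition_deriv c d (\<gamma> t) v) (at t within I)"
proof -
  have "((transition c d \<circ> (snd c \<circ> \<gamma>)) has_vector_derivative transition_deriv c d (\<gamma> t) v) (at t within I)"
    using vector_derivative_diff_chain_within[OF v has_derivative_at_withinI] transition_has_derivative[OF c d]
    by auto
  then show ?thesis
  proof (rule has_vector_derivative_transform_eventually)
    show "eventually (\<lambda>s. (transition c d \<circ> (snd c \<circ> \<gamma>)) s = (snd d \<circ> \<gamma>) s) (at t within I)"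
      using curve_in_chart_eventually[OF \<gamma> c] by eventually_elim (use charts_atD(1)[OF c] in auto)
  qed (use c charts_atD in auto)
qed

text \<open>A derivative computed in one chart determines the others through the transition maps.
  The filter must be nontrivial for \<open>vector_derivative\<close> to be unique.\<close>

lemma velocity_eq:
  assumes \<gamma>: "(\<gamma> \<longlongrightarrow> \<gamma> t) (at t within I)" and c: "c \<in> charts_at A (\<gamma> t)"
    and v: "((snd c \<circ> \<gamma>) has_vector_derivative v) (at t within I)" and I: "at t within I \<noteq> bot"
  shows "velocity A I \<gamma> t = tangent_of A c (\<gamma> t) v"
proof
  fix d
  show "velocity A I \<gamma> t d = tangent_of A c (\<gamma> t) v d"
    using vector_derivative_within[OF I curve_change_chart[OF \<gamma> c _ v]]
    by (simp add: velocity_def tangent_of_def)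
qed

lemma chart_curve:
  assumes c: "c \<in> A" and x: "\<And>t. t \<in> I \<Longrightarrow> x t \<in> chart_image c"
    and v: "\<And>t. t \<in> I \<Longrightarrow> (x has_vector_derivative v t) (at t within I)"
    and I: "\<And>t. t \<in> I \<Longrightarrow> at t within I \<noteq> bot"
  defines "\<gamma> \<equiv> chart_inv c \<circ> x"
  shows chart_curve_continuous: "continuous_on I \<gamma>"
    and chart_curve_velocity: "t \<in> I \<Longrightarrow> velocity A I \<gamma> t = tangent_of A c (\<gamma> t) (v t)"
    and chart_curve_differentiable:
      "t \<in> I \<Longrightarrow> d \<in> charts_at A (\<gamma> t) \<Longrightarrow> (snd d \<circ> \<gamma>) differentiable (at t within I)"
proof -
  have "continuous_on I x"
    using has_vector_derivative_continuous[OF v] unfolding continuous_on_eq_continuous_within by blast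
  then show cont: "continuous_on I \<gamma>"
    unfolding \<gamma>_def o_def
    by (rule continuous_on_compose2[OF homeomorphism_cont2[OF chart_homeomorphism[OF c]]]) (use x in auto)
  have lim: "(\<gamma> \<longlongrightarrow> \<gamma> t) (at t within I)" if "t \<in> I" for t
    using cont that by (simp add: continuous_on_def)
  have ct: "c \<in> charts_at A (\<gamma> t)" if "t \<in> I" for t
    using charts_at_chart_inv[OF c x[OF that]] by (simp add: \<gamma>_def)
  have der: "((snd c \<circ> \<gamma>) has_vector_derivative v t) (at t within I)" if "t \<in> I" for t
    by (rule has_vector_derivative_transform[OF that _ v[OF that]]) (use x c in \<open>auto simp: \<gamma>_def\<close>)
  show "velocity A I \<gamma> t = tangent_of A c (\<gamma> t) (v t)" if "t \<in> I"
    by (rule velocity_eq[OF lim[OF that] ct[OF that] der[OF that] I[OF that]])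
  show "(snd d \<circ> \<gamma>) differentiable (at t within I)" if "t \<in> I" "d \<in> charts_at A (\<gamma> t)"
    using curve_change_chart[OF lim[OF that(1)] ct[OF that(1)] that(2) der[OF that(1)]]
    by (rule differentiableI_vector)
qed

lemma chart_curve_C1:
  assumes c: "c \<in> A" and x: "\<And>t. t \<in> I \<Longrightarrow> x t \<in> chart_image c"
    and v: "\<And>t. t \<in> I \<Longrightarrow> (x has_vector_derivative v t) (at t within I)"
    and I: "\<And>t. t \<in> I \<Longrightarrow> at t within I \<noteq> bot" and cont: "continuous_on I v"
  shows "C1_curve A I (chart_inv c \<circ> x)"
  unfolding C1_curve_def
proof (intro conjI ballI impI)
  let ?\<gamma> = "chart_inv c \<circ> x"
  note curve = chart_curve[OF c, of I x v, OF x v I]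
  show "continuous_on I ?\<gamma>" by (rule curve(1))
  fix d assume d: "d \<in> A"
  show "(snd d \<circ> ?\<gamma>) differentiable (at t within I)" if "t \<in> I" "?\<gamma> t \<in> fst d" for t
    by (rule curve(3)) (use that d in \<open>auto simp: charts_at_def\<close>)
  let ?I = "{t \<in> I. ?\<gamma> t \<in> fst d}"
  have *: "c \<in> charts_at A (?\<gamma> t)" "d \<in> charts_at A (?\<gamma> t)" "snd c (?\<gamma> t) = x t" if "t \<in> ?I" for t
    using that d c x[of t] charts_at_chart_inv[OF c x] by (auto simp: charts_at_def)
  have xI: "continuous_on ?I x"
    using has_vector_derivative_continuous[OF v] unfolding continuous_on_eq_continuous_within
    by (auto intro: continuous_within_subset)
  have "continuous_on ?I (\<lambda>t. fderiv (transition c d) (x t) (v t))"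
  proof (rule continuous_on_derivative_C2[OF transition_C2[OF c d] xI])
    show "continuous_on ?I v" using cont by (rule continuous_on_subset) auto
    show "x ` ?I \<subseteq> snd c ` (fst c \<inter> fst d)"
      using overlap[OF *(1,2)] *(3) by (metis (no_types, lifting) image_subsetI)
  qed
  then show "continuous_on ?I (\<lambda>t. velocity A I ?\<gamma> t d)"
    by (rule continuous_on_eq) (use * in \<open>simp add: curve(2) tangent_of_apply\<close>)
qed

lemma C2_function_chart: "C2_function A f \<Longrightarrow> c \<in> A \<Longrightarrow> Ck_on 2 (chart_image c) (f \<circ> chart_inv c)"
  by (simp add: C2_function_def)

text \<open>Chain rule for \<open>f\<close> read through the chart \<open>d\<close>; this makes
  \<open>differential\<close>, which is computed in one selected chart, independent of the
  chart.\<close>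

lemma function_change_chart:
  assumes f: "C2_function A f" and c: "c \<in> charts_at A x" and d: "d \<in> charts_at A x"
  shows "fderiv (f \<circ> chart_inv d) (snd d x) (transition_deriv c d x u) =
    fderiv (f \<circ> chart_inv c) (snd c x) u"
proof -
  have cA: "c \<in> A" "d \<in> A" "x \<in> fst c" using c d charts_atD by auto
  have "(f \<circ> chart_inv d has_derivative fderiv (f \<circ> chart_inv d) (snd d x)) (at (snd d x))"
    by (rule C2_has_derivative[OF C2_function_chart[OF f cA(2)] charts_atD(3)[OF d]])
  then have "((f \<circ> chart_inv d) \<circ> transition c d has_derivative
      fderiv (f \<circ> chart_inv d) (snd d x) \<circ> transition_deriv c d x) (at (snd c x))"
    using transition_has_derivative[OF c d] cA by (intro diff_chain_at) auto
  then have "(f \<circ> chart_inv c has_derivative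
      fderiv (f \<circ> chart_inv d) (snd d x) \<circ> transition_deriv c d x) (at (snd c x))"
    by (rule has_derivative_transform_within_open[OF _ open_chart_overlap[OF cA(1,2)] overlap[OF c d]])
       (use cA in auto)
  from frechet_derivative_at[OF this] show ?thesis by (metis o_apply)
qed

lemma differential_eq:
  assumes f: "C2_function A f" and v: "v \<in> tangent_space A x" and c: "c \<in> charts_at A x"
  shows "differential A f x v = fderiv (f \<circ> chart_inv c) (snd c x) (v c)"
  using function_change_chart[OF f c chart_at] tangent_component[OF v c chart_at]
  by (simp add: differential_def)

end

section \<open>The metric and its Christoffel symbols in charts\<close>

locale semi_riemannian = C2_manifold A
  for A :: "('a::{t2_space,second_countable_topology}, 'n::finite) chart set" +
  fixes g :: "('a, 'n) metric"
  assumes manifold: "semi_riemannian_manifold A g"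
begin

text \<open>The coordinate expressions are kept as forms in vectors: the metric, its derivative in a
  direction \<open>h\<close> (\<open>dgform\<close>) and the Christoffel form \<Gamma>(u, v)
  (\<open>gamma\<close>). Changes of chart then come from differentiating along lines instead of
  from index calculations.\<close>

definition gform :: "('a, 'n) chart \<Rightarrow> real^'n \<Rightarrow> real^'n \<Rightarrow> real^'n \<Rightarrow> real" where
  "gform c y u w = (\<Sum>i\<in>UNIV. \<Sum>j\<in>UNIV. u $ i * w $ j * metric_matrix A g c y $ i $ j)"

definition dgform :: "('a, 'n) chart \<Rightarrow> real^'n \<Rightarrow> real^'n \<Rightarrow> real^'n \<Rightarrow> real^'n \<Rightarrow> real" where
  "dgform c y h u w = (\<Sum>i\<in>UNIV. \<Sum>j\<in>UNIV. u $ i * w $ j * (\<Sum>k\<in>UNIV. h $ k * metric_deriv A g c y k i j))"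

definition gamma :: "('a, 'n) chart \<Rightarrow> real^'n \<Rightarrow> real^'n \<Rightarrow> real^'n \<Rightarrow> real^'n" where
  "gamma c y u v = (\<chi> k. \<Sum>i\<in>UNIV. \<Sum>j\<in>UNIV. christoffel A g c y k i j * u $ i * v $ j)"

lemma scalar_product: "scalar_product_on (tangent_space A x) (g x)"
  using manifold unfolding semi_riemannian_manifold_def by blast

lemma metric_sym: "u \<in> tangent_space A x \<Longrightarrow> v \<in> tangent_space A x \<Longrightarrow> g x u v = g x v u"
  using scalar_product unfolding scalar_product_on_def by blast

lemma metric_matrix_chart:
  "c \<in> charts_at A x \<Longrightarrow> metric_matrix A g c (snd c x) $ i $ j =
    g x (tangent_of A c x (axis i 1)) (tangent_of A c x (axis j 1))"
  by (simp add: metric_matrix_def Let_def charts_atD)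

text \<open>\<open>scalar_product_on\<close> states linearity in the first argument; symmetry
  carries it to the second, and both are expanded in the basis.\<close>

lemma metric_tangent_of:
  assumes c: "c \<in> charts_at A x"
  shows "g x (tangent_of A c x u) (tangent_of A c x w) = gform c (snd c x) u w"
proof -
  define B where "B u w = g x (tangent_of A c x u) (tangent_of A c x w)" for u w
  have comb: "B (a *\<^sub>R u + b *\<^sub>R v) w = a * B u w + b * B v w" for a b u v w
    using scalar_product tangent_of_in[OF c]
    unfolding B_def tangent_of_combination[OF c] scalar_product_on_def by blast
  have lin: "linear (\<lambda>u. B u w)" for w
    using comb[of 1 _ 1] comb[of _ _ 0] by (intro linearI) auto
  have sym: "B u w = B w u" for u w
    unfolding B_def using metric_sym tangent_of_in[OF c] by blast
  have "B (axis i 1) w = (\<Sum>j\<in>UNIV. w $ j * B (axis i 1) (axis j 1))" for i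
    using linear_sum_axis[OF lin[of "axis i 1"], of w] by (simp add: sym[of _ "axis i 1"])
  then have "B u w = (\<Sum>i\<in>UNIV. u $ i * (\<Sum>j\<in>UNIV. w $ j * B (axis i 1) (axis j 1)))"
    using linear_sum_axis[OF lin[of w], of u] by simp
  then show ?thesis
    unfolding B_def gform_def metric_matrix_chart[OF c] by (simp add: sum_distrib_left mult.assoc)
qed

lemma chart_point: "c \<in> A \<Longrightarrow> y \<in> chart_image c \<Longrightarrow> \<exists>x. c \<in> charts_at A x \<and> y = snd c x"
  using charts_at_def by fastforce

lemma metric_matrix_sym:
  "c \<in> A \<Longrightarrow> y \<in> chart_image c \<Longrightarrow> metric_matrix A g c y $ i $ j = metric_matrix A g c y $ j $ i"
  using chart_point[of c y] metric_matrix_chart metric_sym tangent_of_in by metis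

lemma gform_linear: "linear (\<lambda>u. gform c y u w)" "linear (gform c y u)"
  by (auto intro!: linearI simp: gform_def sum.distrib sum_distrib_left algebra_simps)

lemma gform_sym:
  assumes "c \<in> A" "y \<in> chart_image c"
  shows "gform c y u w = gform c y w u"
  unfolding gform_def by (subst sum.swap) (simp add: metric_matrix_sym[OF assms] mult.commute mult.left_commute)

lemma gform_nondegenerate:
  assumes c: "c \<in> A" "y \<in> chart_image c" and z: "\<And>w. gform c y u w = 0"
  shows "u = 0"
proof -
  obtain x where x: "c \<in> charts_at A x" "y = snd c x" using chart_point[OF c] by blast
  have "g x (tangent_of A c x u) w = 0" if "w \<in> tangent_space A x" for w
    using metric_tangent_of[OF x(1), of u "w c"] z x(2) tangent_of_component[OF that x(1)] by simp
  then have "tangent_of A c x u = zero_tangent"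
    using scalar_product[of x] tangent_of_in[OF x(1), of u] unfolding scalar_product_on_def by blast
  then show ?thesis using tangent_of_self[OF x(1), of u] by (simp add: zero_tangent_def)
qed

lemma gform_matrix: "gform c y u w = w \<bullet> (transpose (metric_matrix A g c y) *v u)"
  unfolding gform_def inner_vec_def matrix_vector_mult_def transpose_def
  by (subst sum.swap) (simp add: sum_distrib_left mult_ac)

lemma metric_matrix_invertible:
  assumes c: "c \<in> A" "y \<in> chart_image c"
  shows "invertible (metric_matrix A g c y)"
proof -
  have "u = 0" if "transpose (metric_matrix A g c y) *v u = 0" for u
    using gform_nondegenerate[OF c, of u] that by (simp add: gform_matrix)
  then have "invertible (transpose (metric_matrix A g c y))"
    unfolding invertible_left_inverse matrix_left_invertible_ker by blast
  from transpose_invertible[OF this] show ?thesis by simp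
qed

lemma gform_change:
  assumes "c \<in> charts_at A x" "d \<in> charts_at A x"
  shows "gform d (snd d x) (transition_deriv c d x u) (transition_deriv c d x w) = gform c (snd c x) u w"
  using metric_tangent_of[OF assms(1)] metric_tangent_of[OF assms(2)] tangent_of_change[OF assms] by metis

lemma metric_matrix_C11: "c \<in> A \<Longrightarrow> C11_on (chart_image c) (\<lambda>y. metric_matrix A g c y $ i $ j)"
  using manifold unfolding semi_riemannian_manifold_def by blast

lemma metric_matrix_has_derivative:
  assumes "c \<in> A" "y \<in> chart_image c"
  shows "((\<lambda>z. metric_matrix A g c z $ i $ j) has_derivative
    (\<lambda>h. \<Sum>k\<in>UNIV. h $ k * metric_deriv A g c y k i j)) (at y)"
proof -
  have D: "(\<lambda>z. metric_matrix A g c z $ i $ j) differentiable (at y)"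
    using metric_matrix_C11[OF assms(1)] assms(2) unfolding C11_on_def by blast
  show ?thesis
  proof (rule has_derivative_eq_rhs[OF D[unfolded frechet_derivative_works]])
    show "fderiv (\<lambda>z. metric_matrix A g c z $ i $ j) y =
        (\<lambda>h. \<Sum>k\<in>UNIV. h $ k * metric_deriv A g c y k i j)"
      by (rule ext, rule trans[OF linear_sum_axis[OF linear_frechet_derivative[OF D]]])
         (simp add: metric_deriv_def)
  qed
qed

lemma vec_nth_has_real_derivative:
  "(h has_vector_derivative k) (at t within I) \<Longrightarrow> ((\<lambda>s. h s $ j) has_real_derivative k $ j) (at t within I)"
  using bounded_linear.has_vector_derivative[OF bounded_linear_vec_nth]
  by (simp add: has_real_derivative_iff_has_vector_derivative)

lemma gform_curve:
  assumes c: "c \<in> A" "y t \<in> chart_image c"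
    and y: "(y has_vector_derivative h) (at t within I)"
    and u: "(u has_vector_derivative u') (at t within I)"
    and w: "(w has_vector_derivative w') (at t within I)"
  shows "((\<lambda>s. gform c (y s) (u s) (w s)) has_real_derivative
    dgform c (y t) h (u t) (w t) + gform c (y t) u' (w t) + gform c (y t) (u t) w') (at t within I)"
proof -
  have G: "((\<lambda>s. metric_matrix A g c (y s) $ i $ j) has_real_derivative
      (\<Sum>k\<in>UNIV. h $ k * metric_deriv A g c (y t) k i j)) (at t within I)" for i j
    using vector_derivative_diff_chain_within[OF y has_derivative_at_withinI[OF metric_matrix_has_derivative[OF c]]]
    by (simp add: has_real_derivative_iff_has_vector_derivative o_def)
  note u' = vec_nth_has_real_derivative[OF u] and w' = vec_nth_has_real_derivative[OF w]
  have "((\<lambda>s. gform c (y s) (u s) (w s)) has_real_derivative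
     (\<Sum>i\<in>UNIV. \<Sum>j\<in>UNIV. (u' $ i * w t $ j + w' $ j * u t $ i) * metric_matrix A g c (y t) $ i $ j +
        (\<Sum>k\<in>UNIV. h $ k * metric_deriv A g c (y t) k i j) * (u t $ i * w t $ j))) (at t within I)"
    unfolding gform_def by (intro DERIV_sum DERIV_mult u' w' G)
  also have "(\<Sum>i\<in>UNIV. \<Sum>j\<in>UNIV. (u' $ i * w t $ j + w' $ j * u t $ i) * metric_matrix A g c (y t) $ i $ j +
        (\<Sum>k\<in>UNIV. h $ k * metric_deriv A g c (y t) k i j) * (u t $ i * w t $ j)) =
      dgform c (y t) h (u t) (w t) + gform c (y t) u' (w t) + gform c (y t) (u t) w'"
    unfolding dgform_def gform_def sum.distrib[symmetric]
    by (intro sum.cong refl) (simp add: algebra_simps)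
  finally show ?thesis .
qed

lemma gamma_sym:
  assumes c: "c \<in> A" "y \<in> chart_image c"
  shows "gamma c y u v = gamma c y v u"
proof -
  have "christoffel A g c y k i j = christoffel A g c y k j i" for k i j
    by (rule christoffel_sym[OF open_chart(2)[OF c(1)] c(2)]) (rule metric_matrix_sym[OF c(1)])
  then show ?thesis
    unfolding gamma_def vec_eq_iff by (subst sum.swap) (simp add: mult_ac)
qed

text \<open>Compatibility of the connection with the metric, \<nabla>g = 0, in vector form. The
  exchanges of sums only bring both sides to the same order of summation.\<close>

lemma dgform_gamma:
  assumes c: "c \<in> A" "y \<in> chart_image c"
  shows "dgform c y h u w = gform c y (gamma c y h u) w + gform c y u (gamma c y h w)"
proof -
  let ?C = "christoffel A g c y" and ?G = "metric_matrix A g c y"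
  have D: "metric_deriv A g c y k i j = (\<Sum>l\<in>UNIV. ?C l k i * ?G $ l $ j) + (\<Sum>l\<in>UNIV. ?C l k j * ?G $ i $ l)" for k i j
    by (rule christoffel_metric[OF open_chart(2)[OF c(1)] c(2) _ metric_matrix_invertible[OF c]])
       (rule metric_matrix_sym[OF c(1)])
  have "gform c y (gamma c y h u) w =
      (\<Sum>l\<in>UNIV. \<Sum>j\<in>UNIV. \<Sum>k\<in>UNIV. \<Sum>i\<in>UNIV. ?C l k i * h $ k * u $ i * w $ j * ?G $ l $ j)"
    by (simp add: gform_def gamma_def sum_distrib_right sum_distrib_left mult_ac)
  also have "\<dots> = (\<Sum>j\<in>UNIV. \<Sum>l\<in>UNIV. \<Sum>k\<in>UNIV. \<Sum>i\<in>UNIV. ?C l k i * h $ k * u $ i * w $ j * ?G $ l $ j)"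
    by (rule sum.swap)
  also have "\<dots> = (\<Sum>j\<in>UNIV. \<Sum>k\<in>UNIV. \<Sum>l\<in>UNIV. \<Sum>i\<in>UNIV. ?C l k i * h $ k * u $ i * w $ j * ?G $ l $ j)"
    by (rule sum.cong[OF refl], rule sum.swap)
  also have "\<dots> = (\<Sum>j\<in>UNIV. \<Sum>k\<in>UNIV. \<Sum>i\<in>UNIV. \<Sum>l\<in>UNIV. ?C l k i * h $ k * u $ i * w $ j * ?G $ l $ j)"
    by (rule sum.cong[OF refl], rule sum.cong[OF refl], rule sum.swap)
  also have "\<dots> = (\<Sum>j\<in>UNIV. \<Sum>i\<in>UNIV. \<Sum>k\<in>UNIV. \<Sum>l\<in>UNIV. ?C l k i * h $ k * u $ i * w $ j * ?G $ l $ j)"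
    by (rule sum.cong[OF refl], rule sum.swap)
  also have "\<dots> = (\<Sum>i\<in>UNIV. \<Sum>j\<in>UNIV. \<Sum>k\<in>UNIV. \<Sum>l\<in>UNIV. ?C l k i * h $ k * u $ i * w $ j * ?G $ l $ j)"
    by (rule sum.swap)
  finally have 1: "gform c y (gamma c y h u) w = \<dots>" .
  have "gform c y u (gamma c y h w) =
      (\<Sum>i\<in>UNIV. \<Sum>l\<in>UNIV. \<Sum>k\<in>UNIV. \<Sum>j\<in>UNIV. ?C l k j * h $ k * u $ i * w $ j * ?G $ i $ l)"
    by (simp add: gform_def gamma_def sum_distrib_right sum_distrib_left mult_ac)
  also have "\<dots> = (\<Sum>i\<in>UNIV. \<Sum>k\<in>UNIV. \<Sum>l\<in>UNIV. \<Sum>j\<in>UNIV. ?C l k j * h $ k * u $ i * w $ j * ?G $ i $ l)"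
    by (rule sum.cong[OF refl], rule sum.swap)
  also have "\<dots> = (\<Sum>i\<in>UNIV. \<Sum>k\<in>UNIV. \<Sum>j\<in>UNIV. \<Sum>l\<in>UNIV. ?C l k j * h $ k * u $ i * w $ j * ?G $ i $ l)"
    by (rule sum.cong[OF refl], rule sum.cong[OF refl], rule sum.swap)
  also have "\<dots> = (\<Sum>i\<in>UNIV. \<Sum>j\<in>UNIV. \<Sum>k\<in>UNIV. \<Sum>l\<in>UNIV. ?C l k j * h $ k * u $ i * w $ j * ?G $ i $ l)"
    by (rule sum.cong[OF refl], rule sum.swap)
  finally have 2: "gform c y u (gamma c y h w) = \<dots>" .
  show ?thesis
    unfolding 1 2 dgform_def D sum.distrib[symmetric]
    by (intro sum.cong refl) (simp add: sum_distrib_left sum.distrib algebra_simps)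
qed

text \<open>Koszul's formula on the diagonal: compatibility and the symmetry of \<Gamma> eliminate
  g(v, \<Gamma>(v, w)). It expresses \<Gamma>(v, v) by derivatives of the metric alone.\<close>

lemma gform_gamma:
  assumes c: "c \<in> A" "y \<in> chart_image c"
  shows "gform c y (gamma c y v v) w = dgform c y v v w - dgform c y w v v / 2"
  unfolding dgform_gamma[OF c] gamma_sym[OF c, of w v] gform_sym[OF c, of v "gamma c y v w"] by simp

text \<open>Obtained by differentiating the tensor law \<open>gform_change\<close> along the line
  through \<open>snd c x\<close> in the direction \<open>h\<close>; the terms with \<open>D2\<close>
  come from the moving Jacobian.\<close>

lemma dgform_change:
  assumes c: "c \<in> charts_at A x" and d: "d \<in> charts_at A x"
  defines "J \<equiv> transition_deriv c d x" and "D2 \<equiv> fderiv2 (transition c d) (snd c x)"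
  shows "dgform c (snd c x) h u w = dgform d (snd d x) (J h) (J u) (J w) +
    gform d (snd d x) (D2 h u) (J w) + gform d (snd d x) (J u) (D2 h w)"
proof -
  have cA: "c \<in> A" "d \<in> A" "x \<in> fst c" "snd c x \<in> chart_image c" "snd d x \<in> chart_image d"
    using c d charts_atD by blast+
  let ?y = "\<lambda>s::real. snd c x + s *\<^sub>R h" and ?\<psi> = "transition c d" and ?S = "snd c ` (fst c \<inter> fst d)"
  note S = open_chart_overlap[OF cA(1,2)] and C2 = transition_C2[OF cA(1,2)]
  have y: "(?y has_vector_derivative h) (at 0)" by (auto intro!: derivative_eq_intros)
  have y0: "?y 0 \<in> ?S" using overlap[OF c d] by simp
  have \<psi>: "((\<lambda>s. ?\<psi> (?y s)) has_vector_derivative J h) (at 0)"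
    using has_vector_derivative_compose_C2[OF C2 y0 y] by (simp add: J_def)
  have J: "((\<lambda>s. fderiv ?\<psi> (?y s) k) has_vector_derivative D2 h k) (at 0)" for k
    using has_vector_derivative_derivative_C2[OF S C2 y0 y has_vector_derivative_const[of k]]
      linear_0[OF transition_deriv_linear[OF c d]]
    by (simp add: D2_def)
  have left: "((\<lambda>s. gform c (?y s) u w) has_real_derivative dgform c (snd c x) h u w) (at 0)"
    using gform_curve[OF cA(1) _ y has_vector_derivative_const[of u] has_vector_derivative_const[of w]] cA
      linear_0[OF gform_linear(1)] linear_0[OF gform_linear(2)] by simp
  have right: "((\<lambda>s. gform d (?\<psi> (?y s)) (fderiv ?\<psi> (?y s) u) (fderiv ?\<psi> (?y s) w))
      has_real_derivative dgform d (snd d x) (J h) (J u) (J w) +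
        gform d (snd d x) (D2 h u) (J w) + gform d (snd d x) (J u) (D2 h w)) (at 0)"
    using gform_curve[OF cA(2) _ \<psi> J J, of u w] cA by (simp add: J_def)
  have "eventually (\<lambda>s. ?y s \<in> ?S) (at 0)"
    using eventually_in_open[OF y S y0] .
  then have ev: "eventually (\<lambda>s. gform d (?\<psi> (?y s)) (fderiv ?\<psi> (?y s) u) (fderiv ?\<psi> (?y s) w)
      = gform c (?y s) u w) (at 0)"
  proof eventually_elim
    fix s assume "?y s \<in> ?S"
    then obtain z where z: "z \<in> fst c" "z \<in> fst d" "?y s = snd c z" by auto
    then have "c \<in> charts_at A z" "d \<in> charts_at A z" using cA by (auto simp: charts_at_def)
    from gform_change[OF this, of u w] show "gform d (?\<psi> (?y s)) (fderiv ?\<psi> (?y s) u)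
      (fderiv ?\<psi> (?y s) w) = gform c (?y s) u w"
      unfolding z(3) using z cA by simp
  qed
  have "((\<lambda>s. gform c (?y s) u w) has_real_derivative dgform d (snd d x) (J h) (J u) (J w) +
        gform d (snd d x) (D2 h u) (J w) + gform d (snd d x) (J u) (D2 h w)) (at 0)"
    using right unfolding has_real_derivative_iff_has_vector_derivative
    by (rule has_vector_derivative_transform_eventually[OF _ ev])
       (use gform_change[OF c d, of u w] cA in simp)
  from DERIV_unique[OF left this] show ?thesis .
qed

text \<open>The inhomogeneous transformation law of the Christoffel symbols. Koszul's formula in
  both charts identifies the two sides when paired with any \<open>?J w\<close>; \<open>?J\<close>
  is onto and the metric nondegenerate.\<close>

lemma gamma_change:
  assumes c: "c \<in> charts_at A x" and d: "d \<in> charts_at A x"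
  shows "transition_deriv c d x (gamma c (snd c x) v v) =
    gamma d (snd d x) (transition_deriv c d x v) (transition_deriv c d x v) +
      fderiv2 (transition c d) (snd c x) v v"
proof -
  let ?J = "transition_deriv c d x" and ?D2 = "fderiv2 (transition c d) (snd c x)"
  let ?u = "?J (gamma c (snd c x) v v) - (gamma d (snd d x) (?J v) (?J v) + ?D2 v v)"
  have cA: "c \<in> A" "d \<in> A" "x \<in> fst c" "snd c x \<in> chart_image c" "snd d x \<in> chart_image d"
    using c d charts_atD by blast+
  note c' = cA(1,4) and d' = cA(2,5)
  \<comment> \<open>Symmetry of the second derivative of the transition cancels the terms that pair
    \<open>?J v\<close> with a second derivative.\<close>
  have sym: "?D2 h k = ?D2 k h" for h k
    by (rule second_derivative_sym[OF open_chart_overlap[OF cA(1,2)] transition_C2[OF cA(1,2)] overlap[OF c d]])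
  have "gform d (snd d x) ?u (?J w) = 0" for w
  proof -
    have "gform d (snd d x) (?J (gamma c (snd c x) v v)) (?J w) = gform c (snd c x) (gamma c (snd c x) v v) w"
      by (rule gform_change[OF c d])
    also have "\<dots> = gform d (snd d x) (gamma d (snd d x) (?J v) (?J v)) (?J w) + gform d (snd d x) (?D2 v v) (?J w)"
      unfolding gform_gamma[OF c'] gform_gamma[OF d'] dgform_change[OF c d] sym[of w v]
        gform_sym[OF d', of "?D2 v w"] by (simp add: field_simps)
    finally show ?thesis
      by (simp add: linear_diff[OF gform_linear(1)] linear_add[OF gform_linear(1)])
  qed
  moreover have "\<exists>w. ?J w = k" for k
    using transition_deriv_compose[OF d c d] transition_deriv_self[OF d] by metis
  ultimately have "?u = 0" by (intro gform_nondegenerate[OF d']) metis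
  then show ?thesis by simp
qed

section \<open>Geodesics and the Hessian in charts\<close>

lemma gamma_linear: "linear (\<lambda>u. gamma c y u w)" "linear (gamma c y u)"
  by (auto intro!: linearI simp: gamma_def vec_eq_iff sum.distrib sum_distrib_left algebra_simps)

lemma gamma_scale: "gamma c y (a *\<^sub>R u) (b *\<^sub>R w) = (a * b) *\<^sub>R gamma c y u w"
  using linear_cmul[OF gamma_linear(1)[of c y "b *\<^sub>R w"], of a u] linear_cmul[OF gamma_linear(2)[of c y u], of b w]
  by simp

section \<open>Lipschitz bounds for the Christoffel symbols\<close>

lemma metric_deriv_lipschitz_near:
  assumes "c \<in> A" "y0 \<in> chart_image c"
  shows "lipschitz_near y0 (\<lambda>y. metric_deriv A g c y k i j)"
proof -
  obtain u L where u: "0 < u" and "L-lipschitz_on (cball y0 u \<inter> chart_image c)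
      (\<lambda>x. fderiv (\<lambda>y. metric_matrix A g c y $ i $ j) x (axis k 1))"
    using metric_matrix_C11[OF assms(1)] assms(2) unfolding C11_on_def locally_Lipschitz_on_def by blast
  then have L: "\<And>y z. y \<in> cball y0 u \<inter> chart_image c \<Longrightarrow> z \<in> cball y0 u \<inter> chart_image c \<Longrightarrow>
      norm (metric_deriv A g c y k i j - metric_deriv A g c z k i j) \<le> L * norm (y - z)"
    unfolding metric_deriv_def by (auto dest: lipschitz_onD simp: dist_norm)
  obtain s where s: "0 < s" "cball y0 s \<subseteq> chart_image c"
    using open_chart(2)[OF assms(1)] assms(2) open_contains_cball by blast
  have sub: "cball y0 (min u s) \<subseteq> cball y0 u \<inter> chart_image c" using s(2) by (auto simp: subset_iff)
  show ?thesis
  proof (rule lipschitz_nearI)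
    show "0 < min u s" using u s by simp
    fix y z assume "y \<in> cball y0 (min u s)" "z \<in> cball y0 (min u s)"
    then show "norm (metric_deriv A g c y k i j - metric_deriv A g c z k i j) \<le> L * norm (y - z)"
      using sub by (intro L) blast+
  qed
qed

lemma metric_matrix_lipschitz_near:
  assumes c: "c \<in> A" "y0 \<in> chart_image c"
  shows "lipschitz_near y0 (\<lambda>y. metric_matrix A g c y $ i $ j)"
proof -
  obtain s where s: "0 < s" "cball y0 s \<subseteq> chart_image c"
    using open_chart(2)[OF c(1)] c(2) open_contains_cball by blast
  have "\<exists>r L. 0 < r \<and> r \<le> s \<and> 0 \<le> L \<and> (\<forall>k. \<forall>y\<in>cball y0 r. norm (metric_deriv A g c y k i j) \<le> L \<and>
      (\<forall>z\<in>cball y0 r. norm (metric_deriv A g c y k i j - metric_deriv A g c z k i j) \<le> L * norm (y - z)))"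
    by (rule lipschitz_near_finite[OF metric_deriv_lipschitz_near[OF c] s(1)])
  then obtain r L where r: "0 < r" "r \<le> s" and L: "0 \<le> L"
     "\<And>k y. y \<in> cball y0 r \<Longrightarrow> norm (metric_deriv A g c y k i j) \<le> L"
    by (elim exE conjE) (rule that, blast+)
  show ?thesis
  proof (rule lipschitz_nearI[OF r(1)])
    fix y z assume yz: "y \<in> cball y0 r" "z \<in> cball y0 r"
    show "norm (metric_matrix A g c y $ i $ j - metric_matrix A g c z $ i $ j) \<le>
        (real CARD('n) * L) * norm (y - z)"
    proof (rule differentiable_bound[OF convex_cball _ _ yz])
      fix x assume x: "x \<in> cball y0 r"
      then have "x \<in> chart_image c" using r s by (auto simp: subset_iff)
      from metric_matrix_has_derivative[OF c(1) this]
      show "((\<lambda>z. metric_matrix A g c z $ i $ j) has_derivative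
          (\<lambda>h. \<Sum>k\<in>UNIV. h $ k * metric_deriv A g c x k i j)) (at x within cball y0 r)"
        by (rule has_derivative_at_withinI)
      show "onorm (\<lambda>h. \<Sum>k\<in>UNIV. h $ k * metric_deriv A g c x k i j) \<le> real CARD('n) * L"
      proof (rule onorm_le)
        fix h :: "real^'n"
        have "norm (\<Sum>k\<in>UNIV. h $ k * metric_deriv A g c x k i j) \<le> (\<Sum>k\<in>(UNIV::'n set). norm h * L)"
          using L(2)[OF x] L(1) component_le_norm_cart[of h]
          by (intro sum_norm_le) (auto simp: abs_mult intro!: mult_mono)
        then show "norm (\<Sum>k\<in>UNIV. h $ k * metric_deriv A g c x k i j) \<le> real CARD('n) * L * norm h"
          by (simp add: mult_ac)
      qed
    qed
  qed
qed

lemma christoffel_lipschitz_near: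
  assumes c: "c \<in> A" "y0 \<in> chart_image c"
  shows "lipschitz_near y0 (\<lambda>y. christoffel A g c y k i j)"
proof -
  have "lipschitz_near y0 (\<lambda>y. matrix_inv (metric_matrix A g c y) $ k $ l)" for k l
    by (rule lipschitz_near_matrix_inv[OF metric_matrix_lipschitz_near[OF c] open_chart(2)[OF c(1)] c(2)])
       (rule metric_matrix_invertible[OF c(1)])
  moreover have "lipschitz_near y0 (\<lambda>y. metric_deriv A g c y i j l + metric_deriv A g c y j i l
      + (-1) * metric_deriv A g c y l i j)" for l
    by (intro lipschitz_near_add lipschitz_near_mult lipschitz_near_const metric_deriv_lipschitz_near[OF c])
  then have "lipschitz_near y0 (\<lambda>y. metric_deriv A g c y i j l + metric_deriv A g c y j i l - metric_deriv A g c y l i j)" for l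
    by simp
  ultimately show ?thesis
    unfolding christoffel_def
    by (intro lipschitz_near_mult lipschitz_near_sum lipschitz_near_const) blast+
qed

lemma gamma_local_bounds:
  assumes c: "c \<in> A" "y0 \<in> chart_image c"
  shows "\<exists>r>0. \<exists>K\<ge>0. cball y0 r \<subseteq> chart_image c \<and>
    (\<forall>y\<in>cball y0 r. \<forall>u w. norm (gamma c y u w) \<le> K * (norm u * norm w) \<and>
      (\<forall>z\<in>cball y0 r. norm (gamma c y u w - gamma c z u w) \<le> K * norm (y - z) * (norm u * norm w)))"
proof -
  obtain s where s: "0 < s" "cball y0 s \<subseteq> chart_image c"
    using open_chart(2)[OF c(1)] c(2) open_contains_cball by blast
  \<comment> \<open>The three indices are packed into one index of finite type, so that a single
    radius and constant serve all Christoffel symbols.\<close>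
  let ?C = "\<lambda>(k, i, j) y. christoffel A g c y k i j"
  have "lipschitz_near y0 (?C p)" for p
    using christoffel_lipschitz_near[OF c] by (cases p) simp
  from lipschitz_near_finite[of y0 ?C, OF this s(1)] obtain r L where r: "0 < r" "r \<le> s" "0 \<le> L"
    and L: "\<And>p y. y \<in> cball y0 r \<Longrightarrow> norm (?C p y) \<le> L \<and> (\<forall>z\<in>cball y0 r. norm (?C p y - ?C p z) \<le> L * norm (y - z))"
    by metis
  let ?N = "real CARD('n)"
  \<comment> \<open>The norm is at most the sum of the absolute components, and each component is a
    sum over \<open>i\<close> and \<open>j\<close>: three factors \<open>?N\<close>.\<close>
  have est: "norm (\<chi> k. \<Sum>i\<in>UNIV. \<Sum>j\<in>UNIV. M k i j * u $ i * w $ j) \<le> ?N * (?N * (?N * B)) * (norm u * norm w)"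
    if M: "\<And>k i j. \<bar>M k i j\<bar> \<le> B" for M :: "'n \<Rightarrow> 'n \<Rightarrow> 'n \<Rightarrow> real" and B and u w :: "real^'n"
  proof -
    have B: "0 \<le> B" using M[of undefined undefined undefined] by linarith
    have "\<bar>M k i j * u $ i * w $ j\<bar> \<le> B * norm u * norm w" for k i j
      unfolding abs_mult using M B component_le_norm_cart[of u] component_le_norm_cart[of w]
      by (intro mult_mono) auto
    then have "\<bar>\<Sum>i\<in>UNIV. \<Sum>j\<in>UNIV. M k i j * u $ i * w $ j\<bar> \<le> (\<Sum>i\<in>(UNIV::'n set). \<Sum>j\<in>(UNIV::'n set). B * norm u * norm w)" for k
      by (intro order_trans[OF sum_abs] sum_mono) auto
    then have "norm (\<chi> k. \<Sum>i\<in>UNIV. \<Sum>j\<in>UNIV. M k i j * u $ i * w $ j) \<le>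
        (\<Sum>k\<in>(UNIV::'n set). \<Sum>i\<in>(UNIV::'n set). \<Sum>j\<in>(UNIV::'n set). B * norm u * norm w)"
      by (intro order_trans[OF norm_le_l1_cart] sum_mono) simp
    then show ?thesis by (simp add: mult_ac)
  qed
  let ?K = "?N * (?N * (?N * L))"
  have "norm (gamma c y u w) \<le> ?K * (norm u * norm w)" if y: "y \<in> cball y0 r" for y u w
    unfolding gamma_def by (rule est) (use L[OF y] in \<open>auto simp: split_paired_all\<close>)
  moreover have "norm (gamma c y u w - gamma c z u w) \<le> ?K * norm (y - z) * (norm u * norm w)"
    if y: "y \<in> cball y0 r" and z: "z \<in> cball y0 r" for y z u w
  proof -
    have eq: "gamma c y u w - gamma c z u w = (\<chi> k. \<Sum>i\<in>UNIV. \<Sum>j\<in>UNIV.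
        (christoffel A g c y k i j - christoffel A g c z k i j) * u $ i * w $ j)"
      by (simp add: gamma_def vec_eq_iff sum_subtractf algebra_simps)
    have "norm (gamma c y u w - gamma c z u w) \<le> ?N * (?N * (?N * (L * norm (y - z)))) * (norm u * norm w)"
      unfolding eq by (rule est) (use L[OF y] z in \<open>auto simp: split_paired_all\<close>)
    then show ?thesis by (simp add: mult_ac)
  qed
  moreover have "cball y0 r \<subseteq> chart_image c" using r s by (auto simp: subset_iff)
  moreover have "0 \<le> ?K" using r by simp
  ultimately show ?thesis using r(1) by blast
qed

section \<open>The Hessian as a quadratic form in charts\<close>

definition hess :: "('a \<Rightarrow> real) \<Rightarrow> ('a, 'n) chart \<Rightarrow> real^'n \<Rightarrow> real^'n \<Rightarrow> real" where
  "hess f c y v = fderiv2 (f \<circ> chart_inv c) y v v -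
     fderiv (f \<circ> chart_inv c) y (gamma c y v v)"

text \<open>Differentiating the invariance of the differential along a line, the second derivative
  of \<open>f\<close> gains the differential of \<open>f\<close> applied to the second derivative of
  the transition. By \<open>gamma_change\<close> the Christoffel part gains the same term, so the
  difference is invariant.\<close>

lemma hess_change:
  assumes f: "C2_function A f" and c: "c \<in> charts_at A x" and d: "d \<in> charts_at A x"
  shows "hess f d (snd d x) (transition_deriv c d x v) = hess f c (snd c x) v"
proof -
  have cA: "c \<in> A" "d \<in> A" "x \<in> fst c" "snd c x \<in> chart_image c" "snd d x \<in> chart_image d"
    using c d charts_atD by blast+
  let ?y = "\<lambda>s::real. snd c x + s *\<^sub>R v" and ?\<psi> = "transition c d" and ?S = "snd c ` (fst c \<inter> fst d)"
  let ?J = "transition_deriv c d x" and ?D2 = "fderiv2 ?\<psi> (snd c x)"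
  let ?fc = "f \<circ> chart_inv c" and ?fd = "f \<circ> chart_inv d"
  note S = open_chart_overlap[OF cA(1,2)] and C2 = transition_C2[OF cA(1,2)]
  note fc = C2_function_chart[OF f cA(1)] and fd = C2_function_chart[OF f cA(2)]
  have y: "(?y has_vector_derivative v) (at 0)" by (auto intro!: derivative_eq_intros)
  have y0: "?y 0 \<in> ?S" using overlap[OF c d] by simp
  have \<psi>: "((\<lambda>s. ?\<psi> (?y s)) has_vector_derivative ?J v) (at 0)"
    using has_vector_derivative_compose_C2[OF C2 y0 y] by simp
  have J: "((\<lambda>s. fderiv ?\<psi> (?y s) v) has_vector_derivative ?D2 v v) (at 0)"
    using has_vector_derivative_derivative_C2[OF S C2 y0 y has_vector_derivative_const[of v]]
      linear_0[OF transition_deriv_linear[OF c d]] by simp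
  have left: "((\<lambda>s. fderiv ?fc (?y s) v) has_vector_derivative fderiv2 ?fc (snd c x) v v) (at 0)"
    using has_vector_derivative_derivative_C2[OF open_chart(2)[OF cA(1)] fc _ y has_vector_derivative_const[of v]]
      linear_0[OF C2_derivative_linear[OF fc cA(4)]] cA(4) by simp
  have right: "((\<lambda>s. fderiv ?fd (?\<psi> (?y s)) (fderiv ?\<psi> (?y s) v)) has_vector_derivative
      fderiv2 ?fd (snd d x) (?J v) (?J v) + fderiv ?fd (snd d x) (?D2 v v)) (at 0)"
    using has_vector_derivative_derivative_C2[OF open_chart(2)[OF cA(2)] fd _ \<psi> J] cA by simp
  have "eventually (\<lambda>s. ?y s \<in> ?S) (at 0)"
    using eventually_in_open[OF y S y0] .
  then have ev: "eventually (\<lambda>s. fderiv ?fd (?\<psi> (?y s)) (fderiv ?\<psi> (?y s) v) =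
      fderiv ?fc (?y s) v) (at 0)"
  proof eventually_elim
    fix s assume "?y s \<in> ?S"
    then obtain z where z: "z \<in> fst c" "z \<in> fst d" "?y s = snd c z" by auto
    then have "c \<in> charts_at A z" "d \<in> charts_at A z" using cA by (auto simp: charts_at_def)
    from function_change_chart[OF f this, of v]
    show "fderiv ?fd (?\<psi> (?y s)) (fderiv ?\<psi> (?y s) v) =
      fderiv ?fc (?y s) v"
      unfolding z(3) using z cA by simp
  qed
  have "fderiv2 ?fc (snd c x) v v =
      fderiv2 ?fd (snd d x) (?J v) (?J v) + fderiv ?fd (snd d x) (?D2 v v)"
    using vector_derivative_unique_at[OF left has_vector_derivative_transform_eventually[OF right ev]]
      function_change_chart[OF f c d, of v] cA by simp
  moreover have "fderiv ?fc (snd c x) (gamma c (snd c x) v v) =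
      fderiv ?fd (snd d x) (gamma d (snd d x) (?J v) (?J v)) + fderiv ?fd (snd d x) (?D2 v v)"
    unfolding function_change_chart[OF f c d, symmetric] gamma_change[OF c d]
    by (rule linear_add[OF C2_derivative_linear[OF fd cA(5)]])
  ultimately show ?thesis by (simp add: hess_def)
qed

text \<open>\<open>hessian\<close> is evaluated in the selected chart \<open>chart_at A x\<close>;
  its value there is \<open>hess\<close>, which \<open>hess_change\<close> moves to any
  chart.\<close>

lemma hessian_eq_hess:
  assumes f: "C2_function A f" and v: "v \<in> tangent_space A x" and d: "d \<in> charts_at A x"
  shows "hessian A g f x v v = hess f d (snd d x) (v d)"
proof -
  define c where "c = chart_at A x"
  have c: "c \<in> charts_at A x" unfolding c_def by (rule chart_at)
  let ?y = "snd c x" and ?f = "f \<circ> chart_inv c"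
  have cA: "c \<in> A" "?y \<in> chart_image c" using charts_atD[OF c] by auto
  note S = open_chart(2)[OF cA(1)] and C2 = C2_function_chart[OF f cA(1)]
  have coeff: "form_coeff A (differential A f) c z j = fderiv ?f z (axis j 1)"
    if z: "z \<in> chart_image c" for z j
    using differential_eq[OF f tangent_of_in charts_at_chart_inv[OF cA(1) z]] charts_at_chart_inv[OF cA(1) z] cA(1) z
    by (simp add: form_coeff_def Let_def tangent_of_self)
  have dcoeff: "fderiv (\<lambda>z. form_coeff A (differential A f) c z j) ?y (axis i 1) =
      fderiv2 ?f ?y (axis i 1) (axis j 1)" for i j
  proof -
    have "((\<lambda>z. form_coeff A (differential A f) c z j) has_derivative (\<lambda>h. fderiv2 ?f ?y h (axis j 1))) (at ?y)"
      by (rule has_derivative_transform_within_open[OF C2_has_fderiv2[OF C2 cA(2)] S cA(2)])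
         (simp add: coeff)
    from frechet_derivative_at[OF this] show ?thesis by metis
  qed
  let ?v = "v c"
  have "hessian A g f x v v = (\<Sum>i\<in>UNIV. \<Sum>j\<in>UNIV. ?v $ i * ?v $ j *
      (fderiv2 ?f ?y (axis i 1) (axis j 1) -
        (\<Sum>k\<in>UNIV. christoffel A g c ?y k i j * fderiv ?f ?y (axis k 1))))"
    unfolding hessian_def cov_deriv_form_def Let_def c_def[symmetric] dcoeff coeff[OF cA(2)] ..
  also have "\<dots> = fderiv2 ?f ?y ?v ?v - (\<Sum>i\<in>UNIV. \<Sum>j\<in>UNIV. \<Sum>k\<in>UNIV.
      christoffel A g c ?y k i j * ?v $ i * ?v $ j * fderiv ?f ?y (axis k 1))"
    by (subst C2_second_derivative_sum[OF S C2 cA(2)])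
       (simp add: sum_subtractf right_diff_distrib sum_distrib_left mult_ac)
  also have "(\<Sum>i\<in>UNIV. \<Sum>j\<in>UNIV. \<Sum>k\<in>UNIV.
      christoffel A g c ?y k i j * ?v $ i * ?v $ j * fderiv ?f ?y (axis k 1)) =
    (\<Sum>i\<in>UNIV. \<Sum>k\<in>UNIV. \<Sum>j\<in>UNIV.
      christoffel A g c ?y k i j * ?v $ i * ?v $ j * fderiv ?f ?y (axis k 1))"
    by (rule sum.cong[OF refl], rule sum.swap)
  also have "\<dots> = (\<Sum>k\<in>UNIV. \<Sum>i\<in>UNIV. \<Sum>j\<in>UNIV.
      christoffel A g c ?y k i j * ?v $ i * ?v $ j * fderiv ?f ?y (axis k 1))"
    by (rule sum.swap)
  also have "\<dots> = fderiv ?f ?y (gamma c ?y ?v ?v)"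
    by (subst C2_derivative_sum[OF C2 cA(2)]) (simp add: gamma_def sum_distrib_right)
  finally have "hessian A g f x v v = hess f c ?y ?v" by (simp add: hess_def o_def)
  also have "\<dots> = hess f d (snd d x) (v d)"
    using hess_change[OF f c d, of ?v] tangent_component[OF v c d] by simp
  finally show ?thesis .
qed

section \<open>Geodesics in a single chart\<close>

definition chart_geodesic :: "('a, 'n) chart \<Rightarrow> real set \<Rightarrow> (real \<Rightarrow> real^'n) \<Rightarrow> (real \<Rightarrow> real^'n) \<Rightarrow> bool" where
  "chart_geodesic c I x v \<longleftrightarrow> (\<forall>t\<in>I. x t \<in> chart_image c \<and> (x has_vector_derivative v t) (at t within I) \<and>
     (v has_vector_derivative - gamma c (x t) (v t) (v t)) (at t within I))"

lemma chart_geodesicD: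
  assumes "chart_geodesic c I x v" "t \<in> I"
  shows "x t \<in> chart_image c" "(x has_vector_derivative v t) (at t within I)"
    "(v has_vector_derivative - gamma c (x t) (v t) (v t)) (at t within I)"
  using assms unfolding chart_geodesic_def by blast+

lemma gamma_components:
  "(\<chi> k. - (\<Sum>i\<in>UNIV. \<Sum>j\<in>UNIV. christoffel A g c y k i j * u $ i * w $ j)) = - gamma c y u w"
  by (simp add: gamma_def vec_eq_iff)

lemma geodesic_onD:
  assumes "geodesic_on A g I \<gamma>" "c \<in> A" and t: "t \<in> I" "\<gamma> t \<in> fst c"
  shows "((\<lambda>t. snd c (\<gamma> t)) has_vector_derivative velocity A I \<gamma> t c) (at t within I)"
    and "((\<lambda>s. velocity A I \<gamma> s c) has_vector_derivative
      - gamma c (snd c (\<gamma> t)) (velocity A I \<gamma> t c) (velocity A I \<gamma> t c)) (at t within I)"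
proof -
  have "(snd c \<circ> \<gamma>) differentiable (at t within I)" and
    V: "((\<lambda>s. velocity A I \<gamma> s c) has_vector_derivative
      - gamma c (snd c (\<gamma> t)) (velocity A I \<gamma> t c) (velocity A I \<gamma> t c)) (at t within I)"
    using assms unfolding geodesic_on_def gamma_components by blast+
  then have "((snd c \<circ> \<gamma>) has_vector_derivative velocity A I \<gamma> t c) (at t within I)"
    using t assms(2) by (simp add: velocity_def charts_at_def vector_derivative_works)
  then show "((\<lambda>t. snd c (\<gamma> t)) has_vector_derivative velocity A I \<gamma> t c) (at t within I)"
    by (simp add: o_def)
  show "((\<lambda>s. velocity A I \<gamma> s c) has_vector_derivative
      - gamma c (snd c (\<gamma> t)) (velocity A I \<gamma> t c) (velocity A I \<gamma> t c)) (at t within I)"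
    by (rule V)
qed

lemma geodesic_on_chart:
  assumes "geodesic_on A g I \<gamma>" "c \<in> A" "J \<subseteq> I" "\<And>t. t \<in> J \<Longrightarrow> \<gamma> t \<in> fst c"
  shows "chart_geodesic c J (\<lambda>t. snd c (\<gamma> t)) (\<lambda>t. velocity A I \<gamma> t c)"
  unfolding chart_geodesic_def
  using has_vector_derivative_within_subset[OF geodesic_onD(1)[OF assms(1,2)] assms(3)]
    has_vector_derivative_within_subset[OF geodesic_onD(2)[OF assms(1,2)] assms(3)] assms(3,4)
  by blast

text \<open>\<open>geodesic_on\<close> asks for the equation in every chart;
  \<open>gamma_change\<close> is exactly the cancellation that transports it from \<open>c\<close>
  to the others.\<close>

lemma chart_geodesic_on:
  assumes c: "c \<in> A" and geo: "chart_geodesic c I x v" and I: "\<And>t. t \<in> I \<Longrightarrow> at t within I \<noteq> bot"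
  shows "geodesic_on A g I (chart_inv c \<circ> x)"
    and "t \<in> I \<Longrightarrow> velocity A I (chart_inv c \<circ> x) t = tangent_of A c (chart_inv c (x t)) (v t)"
proof -
  let ?\<gamma> = "chart_inv c \<circ> x"
  note x = chart_geodesicD(1)[OF geo] and v = chart_geodesicD(2)[OF geo] and a = chart_geodesicD(3)[OF geo]
  note vel = chart_curve_velocity[OF c x v I]
  show "velocity A I ?\<gamma> t = tangent_of A c (chart_inv c (x t)) (v t)" if "t \<in> I"
    using vel[OF _ _ _ that] by simp
  show "geodesic_on A g I ?\<gamma>" unfolding geodesic_on_def gamma_components
  proof (intro conjI ballI impI)
    show "continuous_on I ?\<gamma>" by (rule chart_curve_continuous[OF c x v I])
    fix d t assume d: "d \<in> A" and t: "t \<in> I" "?\<gamma> t \<in> fst d"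
    have dt: "d \<in> charts_at A (?\<gamma> t)" using d t by (simp add: charts_at_def)
    have ct: "c \<in> charts_at A (?\<gamma> t)" using charts_at_chart_inv[OF c x[OF t(1)]] by simp
    show "(snd d \<circ> ?\<gamma>) differentiable (at t within I)"
      by (rule chart_curve_differentiable[OF c x v I t(1) dt])
    let ?\<psi> = "transition c d" and ?S = "snd c ` (fst c \<inter> fst d)"
    have xt: "snd c (?\<gamma> t) = x t" "x t \<in> ?S" using overlap[OF ct dt] c x[OF t(1)] by auto
    note S = open_chart_overlap[OF c d] and C2 = transition_C2[OF c d]
    have vel_d: "velocity A I ?\<gamma> s d = fderiv ?\<psi> (x s) (v s)" if "s \<in> I" "x s \<in> ?S" for s
    proof -
      have "d \<in> charts_at A (?\<gamma> s)" using that(2) c d by (auto simp: charts_at_def)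
      moreover have "velocity A I ?\<gamma> s = tangent_of A c (?\<gamma> s) (v s)" by (rule vel[OF _ _ _ that(1)])
      moreover have "snd c (?\<gamma> s) = x s" using c x[OF that(1)] by simp
      ultimately show ?thesis by (metis tangent_of_apply)
    qed
    have "((\<lambda>s. fderiv ?\<psi> (x s) (v s)) has_vector_derivative
        fderiv2 ?\<psi> (x t) (v t) (v t) + fderiv ?\<psi> (x t) (- gamma c (x t) (v t) (v t))) (at t within I)"
      by (rule has_vector_derivative_derivative_C2[OF S C2 xt(2) v[OF t(1)] a[OF t(1)]])
    also have "fderiv2 ?\<psi> (x t) (v t) (v t) + fderiv ?\<psi> (x t) (- gamma c (x t) (v t) (v t)) =
        - gamma d (snd d (?\<gamma> t)) (velocity A I ?\<gamma> t d) (velocity A I ?\<gamma> t d)"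
      using gamma_change[OF ct dt, of "v t"] linear_neg[OF transition_deriv_linear[OF ct dt]]
      unfolding xt(1) vel_d[OF t(1) xt(2)] by simp
    finally show "((\<lambda>s. velocity A I ?\<gamma> s d) has_vector_derivative
        - gamma d (snd d (?\<gamma> t)) (velocity A I ?\<gamma> t d) (velocity A I ?\<gamma> t d)) (at t within I)"
    proof (rule has_vector_derivative_transform_eventually)
      have "eventually (\<lambda>s. s \<in> I) (at t within I)" by (simp add: eventually_at_filter)
      with eventually_in_open[OF v[OF t(1)] S xt(2)]
      show "eventually (\<lambda>s. fderiv ?\<psi> (x s) (v s) = velocity A I ?\<gamma> s d) (at t within I)"
        by eventually_elim (simp add: vel_d)
      show "fderiv ?\<psi> (x t) (v t) = velocity A I ?\<gamma> t d"
        by (rule vel_d[OF t(1) xt(2), symmetric])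
    qed
  qed
qed

text \<open>The factor \<open>b\<close> of the velocity appears squared in the acceleration and, by
  bilinearity, in the Christoffel term.\<close>

lemma chart_geodesic_affine:
  assumes geo: "chart_geodesic c J x v" and sub: "(\<lambda>t. a + b * t) ` I \<subseteq> J"
  shows "chart_geodesic c I (\<lambda>t. x (a + b * t)) (\<lambda>t. b *\<^sub>R v (a + b * t))"
  unfolding chart_geodesic_def
proof (intro ballI conjI)
  fix t assume t: "t \<in> I"
  then have J: "a + b * t \<in> J" using sub by blast
  note D = chart_geodesicD[OF geo J]
  show "x (a + b * t) \<in> chart_image c" by (rule D(1))
  have l: "((\<lambda>t. a + b * t) has_vector_derivative b) (at t within I)"
    by (auto intro!: derivative_eq_intros)
  have chain: "((\<lambda>t. f (a + b * t)) has_vector_derivative b *\<^sub>R f') (at t within I)"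
    if "(f has_vector_derivative f') (at (a + b * t) within J)" for f :: "real \<Rightarrow> real^'n" and f'
    using vector_diff_chain_within[OF l has_vector_derivative_within_subset[OF that sub]] by (simp add: o_def)
  show "((\<lambda>t. x (a + b * t)) has_vector_derivative b *\<^sub>R v (a + b * t)) (at t within I)"
    by (rule chain[OF D(2)])
  show "((\<lambda>t. b *\<^sub>R v (a + b * t)) has_vector_derivative
      - gamma c (x (a + b * t)) (b *\<^sub>R v (a + b * t)) (b *\<^sub>R v (a + b * t))) (at t within I)"
    unfolding gamma_scale
    using bounded_linear.has_vector_derivative[OF bounded_linear_scaleR_right[of b] chain[OF D(3)]] by simp
qed

definition gamma_bounded :: "('a, 'n) chart \<Rightarrow> real^'n \<Rightarrow> real \<Rightarrow> real \<Rightarrow> bool" where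
  "gamma_bounded c y0 r K \<longleftrightarrow> 0 < r \<and> 0 \<le> K \<and> cball y0 r \<subseteq> chart_image c \<and>
    (\<forall>y\<in>cball y0 r. \<forall>u w. norm (gamma c y u w) \<le> K * (norm u * norm w) \<and>
      (\<forall>z\<in>cball y0 r. norm (gamma c y u w - gamma c z u w) \<le> K * norm (y - z) * (norm u * norm w)))"

lemma gamma_bounded_exists: "c \<in> A \<Longrightarrow> y0 \<in> chart_image c \<Longrightarrow> \<exists>r K. gamma_bounded c y0 r K"
  using gamma_local_bounds[of c y0] unfolding gamma_bounded_def by blast

lemma gamma_boundedD:
  assumes "gamma_bounded c y0 r K"
  shows "0 < r" "0 \<le> K" "cball y0 r \<subseteq> chart_image c"
    and "y \<in> cball y0 r \<Longrightarrow> norm (gamma c y u w) \<le> K * (norm u * norm w)"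
    and "y \<in> cball y0 r \<Longrightarrow> z \<in> cball y0 r \<Longrightarrow>
      norm (gamma c y u w - gamma c z u w) \<le> K * norm (y - z) * (norm u * norm w)"
  using assms unfolding gamma_bounded_def by blast+

text \<open>Move the base point with \<open>u\<close> fixed, then the vectors at \<open>z\<close> by
  bilinearity. Both the existence of geodesics and the barrier rest on this splitting.\<close>

lemma gamma_diff:
  assumes b: "gamma_bounded c y0 r K" and y: "y \<in> cball y0 r" and z: "z \<in> cball y0 r"
  shows "norm (gamma c y u u - gamma c z w w) \<le>
    K * norm (y - z) * (norm u * norm u) + K * (norm (u - w) * (norm u + norm w))"
proof -
  have "gamma c z u u - gamma c z w w = gamma c z (u - w) u + gamma c z w (u - w)"
    by (simp add: linear_diff[OF gamma_linear(1)] linear_diff[OF gamma_linear(2)])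
  then have "norm (gamma c z u u - gamma c z w w) \<le> K * (norm (u - w) * norm u) + K * (norm w * norm (u - w))"
    using gamma_boundedD(4)[OF b z, of "u - w" u] gamma_boundedD(4)[OF b z, of w "u - w"]
    by (auto intro!: norm_triangle_le)
  moreover have "norm (gamma c y u u - gamma c z w w) \<le>
      norm (gamma c y u u - gamma c z u u) + norm (gamma c z u u - gamma c z w w)"
    using norm_triangle_ineq[of "gamma c y u u - gamma c z u u" "gamma c z u u - gamma c z w w"] by simp
  ultimately show ?thesis using gamma_boundedD(5)[OF b y z, of u u] by (simp add: algebra_simps)
qed

text \<open>The first-order system is solved on a short interval \<open>{- T..T}\<close> for all
  velocities up to \<open>\<rho>\<close>. Stretching time to \<open>{- 1..1}\<close> multiplies the
  initial velocity by \<open>T\<close>, whence the bound \<open>T * \<rho>\<close> for the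
  admissible \<open>w\<close>.\<close>

lemma chart_geodesic_exists:
  assumes c: "c \<in> A" "y0 \<in> chart_image c"
  shows "\<exists>\<delta>>0. \<forall>w. norm w \<le> \<delta> \<longrightarrow> (\<exists>x v. x 0 = y0 \<and> v 0 = w \<and> chart_geodesic c {- 1..1} x v)"
proof -
  obtain r K where b: "gamma_bounded c y0 r K" using gamma_bounded_exists[OF c] by blast
  note r = gamma_boundedD(1)[OF b] and K = gamma_boundedD(2)[OF b] and sub = gamma_boundedD(3)[OF b]
  \<comment> \<open>\<open>r1 \<le> 1\<close> keeps speeds at most 1, so the quadratic field is
    Lipschitz with constant \<open>1 + 3 * K\<close>. The halving in \<open>\<rho>\<close> leaves
    room for balls of radius \<open>\<rho>\<close> about \<open>(y0, u)\<close>. \<open>T\<close>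
    satisfies \<open>(1 + 3 * K) * T = \<rho> / 2\<close>, which gives confinement and contraction
    together.\<close>
  define r1 where "r1 = min r 1"
  define \<rho> where "\<rho> = r1 / 2"
  define T where "T = \<rho> / (2 * (1 + 3 * K))"
  have r1: "0 < r1" "r1 \<le> r" "r1 \<le> 1" using r by (auto simp: r1_def)
  have \<rho>: "0 < \<rho>" "\<rho> \<le> 1 / 2" using r1 by (auto simp: \<rho>_def)
  have "D * (\<rho> / (2 * D)) = \<rho> / 2" if "0 < D" for D :: real using that by simp
  from this[of "1 + 3 * K"] have T: "0 < T" "(1 + 3 * K) * T = \<rho> / 2" using \<rho> K unfolding T_def by auto
  have KT: "0 \<le> K * T" using K T by simp
  define F where "F p = (snd p, - gamma c (fst p) (snd p) (snd p))" for p :: "(real^'n) \<times> (real^'n)"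
  have ball: "fst p \<in> cball y0 r1" "norm (snd p) \<le> 1" if p: "p \<in> cball (y0, 0) r1" for p :: "(real^'n) \<times> (real^'n)"
  proof -
    have "norm (fst p - y0) \<le> r1" "norm (snd p) \<le> r1"
      using dist_fst_le[of p "(y0, 0)"] dist_snd_le[of p "(y0, 0)"] p
      by (simp_all add: dist_norm[symmetric] dist_commute)
    then show "fst p \<in> cball y0 r1" "norm (snd p) \<le> 1"
      using r1 by (auto simp: dist_norm norm_minus_commute)
  qed
  have r1r: "cball y0 r1 \<subseteq> cball y0 r" using r1 by (simp add: subset_cball)
  have F_lip: "norm (F p - F q) \<le> (1 + 3 * K) * norm (p - q)"
    if p: "p \<in> cball (y0, 0) r1" and q: "q \<in> cball (y0, 0) r1" for p q
  proof -
    have n: "norm (fst p - fst q) \<le> norm (p - q)" "norm (snd p - snd q) \<le> norm (p - q)"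
      using norm_fst_le[of "fst p - fst q" "snd p - snd q"] norm_snd_le[of "snd p - snd q" "fst p - fst q"]
      by (metis fst_diff prod.collapse snd_diff)+
    have "norm (gamma c (fst p) (snd p) (snd p) - gamma c (fst q) (snd q) (snd q)) \<le>
        K * norm (fst p - fst q) * (norm (snd p) * norm (snd p)) + K * (norm (snd p - snd q) * (norm (snd p) + norm (snd q)))"
      using ball(1)[OF p] ball(1)[OF q] r1r by (intro gamma_diff[OF b]) auto
    also have "\<dots> \<le> K * norm (p - q) * (1 * 1) + K * (norm (p - q) * (1 + 1))"
      using n ball(2)[OF p] ball(2)[OF q] K by (intro add_mono mult_mono mult_nonneg_nonneg) auto
    finally have "norm (gamma c (fst p) (snd p) (snd p) - gamma c (fst q) (snd q) (snd q)) \<le> 3 * K * norm (p - q)"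
      by simp
    then have "norm (snd p - snd q) + norm (- gamma c (fst p) (snd p) (snd p) - - gamma c (fst q) (snd q) (snd q)) \<le>
        (1 + 3 * K) * norm (p - q)"
      using n(2) by (simp add: algebra_simps norm_minus_commute)
    then show ?thesis unfolding F_def diff_Pair by (rule order_trans[OF norm_Pair_le])
  qed
  have F_bound: "norm (F p) \<le> 1 + K" if p: "p \<in> cball (y0, 0) r1" for p
  proof -
    have "norm (gamma c (fst p) (snd p) (snd p)) \<le> K * (norm (snd p) * norm (snd p))"
      using ball(1)[OF p] r1r by (intro gamma_boundedD(4)[OF b]) auto
    also have "\<dots> \<le> K * (1 * 1)" using ball(2)[OF p] K by (intro mult_left_mono mult_mono) auto
    finally have "norm (snd p) + norm (- gamma c (fst p) (snd p) (snd p)) \<le> 1 + K"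
      using ball(2)[OF p] by simp
    then show ?thesis unfolding F_def by (rule order_trans[OF norm_Pair_le])
  qed
  have main: "\<exists>x v. x 0 = y0 \<and> v 0 = w \<and> chart_geodesic c {- 1..1} x v" if w: "norm w \<le> T * \<rho>" for w
  proof -
    define u where "u = (1 / T) *\<^sub>R w"
    have u: "norm u \<le> \<rho>" using w T by (simp add: u_def pos_divide_le_eq mult.commute)
    have "cball (y0, u) \<rho> \<subseteq> cball (y0, 0) r1"
    proof
      fix p assume "p \<in> cball (y0, u) \<rho>"
      then have "dist (y0, u) p \<le> \<rho>" by simp
      moreover have "dist (y0, 0) (y0, u) \<le> \<rho>" using u by (simp add: dist_Pair_Pair dist_norm)
      ultimately show "p \<in> cball (y0, 0) r1"
        using dist_triangle[of "(y0, 0)" p "(y0, u)"] by (simp add: \<rho>_def)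
    qed
    then have F: "\<And>p q. p \<in> cball (y0, u) \<rho> \<Longrightarrow> q \<in> cball (y0, u) \<rho> \<Longrightarrow> norm (F p - F q) \<le> (1 + 3 * K) * norm (p - q)"
        "\<And>p. p \<in> cball (y0, u) \<rho> \<Longrightarrow> norm (F p) \<le> 1 + K"
      and sub1: "cball (y0, u) \<rho> \<subseteq> cball (y0, 0) r1"
      using F_lip F_bound by blast+
    have "(1 + K) * T \<le> \<rho>" "(1 + 3 * K) * T < 1" using T \<rho> KT by (auto simp: algebra_simps)
    then obtain z where z: "z 0 = (y0, u)" "\<And>t. t \<in> {- T..T} \<Longrightarrow> z t \<in> cball (y0, u) \<rho>"
      "\<And>t. t \<in> {- T..T} \<Longrightarrow> (z has_vector_derivative F (z t)) (at t within {- T..T})"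
      using picard_lindelof[of "(y0, u)" \<rho> F "1 + 3 * K" "1 + K" T, OF F] \<rho> K T by fastforce
    have geo: "chart_geodesic c {- T..T} (\<lambda>t. fst (z t)) (\<lambda>t. snd (z t))"
      unfolding chart_geodesic_def
    proof (intro ballI conjI)
      fix t assume t: "t \<in> {- T..T}"
      show "fst (z t) \<in> chart_image c"
        using ball(1)[of "z t"] z(2)[OF t] sub1 r1r sub by blast
      show "((\<lambda>t. fst (z t)) has_vector_derivative snd (z t)) (at t within {- T..T})"
        using bounded_linear.has_vector_derivative[OF bounded_linear_fst z(3)[OF t]] by (simp add: F_def)
      show "((\<lambda>t. snd (z t)) has_vector_derivative - gamma c (fst (z t)) (snd (z t)) (snd (z t))) (at t within {- T..T})"
        using bounded_linear.has_vector_derivative[OF bounded_linear_snd z(3)[OF t]] by (simp add: F_def)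
    qed
    have "(\<lambda>t. 0 + T * t) ` {- 1..1} \<subseteq> {- T..T}"
    proof
      fix y assume "y \<in> (\<lambda>t. 0 + T * t) ` {- 1..1}"
      then obtain t where t: "y = 0 + T * t" "t \<in> {- 1..1}" by blast
      then have "\<bar>y\<bar> \<le> T * 1" using T unfolding t(1) add_0 abs_mult by (intro mult_mono) auto
      then show "y \<in> {- T..T}" by auto
    qed
    from chart_geodesic_affine[OF geo this] have "chart_geodesic c {- 1..1} (\<lambda>t. fst (z (0 + T * t))) (\<lambda>t. T *\<^sub>R snd (z (0 + T * t)))" .
    moreover have "fst (z (0 + T * 0)) = y0" "T *\<^sub>R snd (z (0 + T * 0)) = w" using z(1) T by (auto simp: u_def)
    ultimately show ?thesis
      by - (rule exI[of _ "\<lambda>t. fst (z (0 + T * t))"], rule exI[of _ "\<lambda>t. T *\<^sub>R snd (z (0 + T * t))"], simp)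
  qed
  moreover have "0 < T * \<rho>" using T \<rho> by simp
  ultimately show ?thesis by blast
qed

text \<open>The acceleration is quadratic in the velocity, so a small velocity stays small in unit time.\<close>

lemma geodesic_small:
  assumes c: "c \<in> A" and b: "gamma_bounded c (snd c (\<gamma> 0)) r K"
    and \<delta>: "0 < \<delta>" "2 * \<delta> < r" "4 * K * \<delta> < 1"
    and geo: "geodesic_on A g {0..1} \<gamma>" and start: "\<gamma> 0 \<in> fst c" "norm (velocity A {0..1} \<gamma> 0 c) \<le> \<delta>"
    and t: "t \<in> {0..1}"
  shows "\<gamma> t \<in> fst c" "snd c (\<gamma> t) \<in> cball (snd c (\<gamma> 0)) (2 * \<delta>)" "norm (velocity A {0..1} \<gamma> t c) \<le> 2 * \<delta>"
    "norm (velocity A {0..1} \<gamma> t c - velocity A {0..1} \<gamma> 0 c) \<le> 4 * K * \<delta> * \<delta>"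
proof -
  define y0 where "y0 = snd c (\<gamma> 0)"
  define x where "x = (\<lambda>t. snd c (\<gamma> t))"
  define v where "v = (\<lambda>t. velocity A {0..1} \<gamma> t c)"
  note K = gamma_boundedD(2)[OF b] and sub = gamma_boundedD(3)[OF b, folded y0_def]
  \<comment> \<open>Continuity argument: \<open>Good\<close> persists for nearby times, and as long
    as it has held throughout, \<open>est\<close> gives strictly better bounds, which survive in the
    limit.\<close>
  define Good where "Good t \<longleftrightarrow> \<gamma> t \<in> fst c \<and> x t \<in> ball y0 r \<and> norm (v t) < 2 * \<delta>" for t
  have cont: "continuous_on {0..1} \<gamma>" using geo unfolding geodesic_on_def by blast
  have der: "(x has_vector_derivative v t) (at t within {0..1})"
    "(v has_vector_derivative - gamma c (x t) (v t) (v t)) (at t within {0..1})"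
    if "t \<in> {0..1}" "\<gamma> t \<in> fst c" for t
    using geodesic_onD[OF geo c that] unfolding x_def v_def .
  have Good_open: "eventually Good (at t within {0..1})" if t: "t \<in> {0..1}" "Good t" for t
  proof -
    have \<gamma>t: "\<gamma> t \<in> fst c" using t(2) by (simp add: Good_def)
    note d = der[OF t(1) \<gamma>t]
    have "(\<gamma> \<longlongrightarrow> \<gamma> t) (at t within {0..1})" using cont t(1) by (simp add: continuous_on_def)
    then have "eventually (\<lambda>s. \<gamma> s \<in> fst c) (at t within {0..1})"
      using open_chart(1)[OF c] \<gamma>t by (rule topological_tendstoD)
    moreover have "eventually (\<lambda>s. x s \<in> ball y0 r) (at t within {0..1})"
      using t(2) by (intro eventually_in_open[OF d(1)]) (auto simp: Good_def)
    moreover have "eventually (\<lambda>s. v s \<in> ball 0 (2 * \<delta>)) (at t within {0..1})"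
      using t(2) by (intro eventually_in_open[OF d(2)]) (auto simp: Good_def)
    ultimately show ?thesis by eventually_elim (simp add: Good_def)
  qed
  have y00: "x 0 = y0" "y0 \<in> ball y0 r" using gamma_boundedD(1)[OF b] by (auto simp: x_def y0_def)
  have est: "norm (v s - v 0) \<le> 4 * K * \<delta> * \<delta>" "norm (v s) \<le> \<delta> + 4 * K * \<delta> * \<delta>" "x s \<in> cball y0 (2 * \<delta>)"
    if s: "0 \<le> s" "s \<le> 1" and G: "\<And>q. 0 \<le> q \<Longrightarrow> q \<le> s \<Longrightarrow> Good q" for s
  proof -
    have d: "(x has_vector_derivative v q) (at q within {0..s})"
      "(v has_vector_derivative - gamma c (x q) (v q) (v q)) (at q within {0..s})" if q: "q \<in> {0..s}" for q
      using der[of q] G[of q] q s by (auto simp: Good_def intro: has_vector_derivative_within_subset)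
    have acc: "norm (- gamma c (x q) (v q) (v q)) \<le> 4 * K * \<delta> * \<delta>" if q: "q \<in> {0..s}" for q
    proof -
      have "norm (gamma c (x q) (v q) (v q)) \<le> K * (norm (v q) * norm (v q))"
        using G[of q] q by (intro gamma_boundedD(4)[OF b]) (auto simp: Good_def y0_def)
      also have "\<dots> \<le> K * ((2 * \<delta>) * (2 * \<delta>))"
        using G[of q] q K \<delta> by (intro mult_left_mono mult_mono) (auto simp: Good_def)
      finally show ?thesis by (simp add: algebra_simps)
    qed
    have bound: "norm (f s - f 0) \<le> B"
      if f: "\<And>q. q \<in> {0..s} \<Longrightarrow> (f has_vector_derivative f' q) (at q within {0..s})"
        and B: "\<And>q. q \<in> {0..s} \<Longrightarrow> norm (f' q) \<le> B" for f f' :: "real \<Rightarrow> real^'n" and B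
    proof -
      have B0: "0 \<le> B" using B[of 0] s norm_ge_zero[of "f' 0"] by (simp del: norm_ge_zero)
      have "norm (f s - f 0) \<le> B * norm (s - 0)"
      proof (rule differentiable_bound[of "{0..s}" f "\<lambda>q h. h *\<^sub>R f' q"])
        show "onorm (\<lambda>h. h *\<^sub>R f' q) \<le> B" if "q \<in> {0..s}" for q
          by (rule onorm_le) (use B[OF that] in \<open>simp add: mult.commute[of B] mult_left_mono\<close>)
      qed (use f s in \<open>auto simp: has_vector_derivative_def\<close>)
      also have "\<dots> \<le> B * 1" using B0 s by (intro mult_left_mono) auto
      finally show ?thesis by simp
    qed
    show "norm (v s - v 0) \<le> 4 * K * \<delta> * \<delta>" by (rule bound[OF d(2) acc])
    then show "norm (v s) \<le> \<delta> + 4 * K * \<delta> * \<delta>"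
      using start(2) norm_triangle_sub[of "v s" "v 0"] by (simp add: v_def)
    have "norm (x s - x 0) \<le> 2 * \<delta>"
      by (rule bound[OF d(1)]) (use G in \<open>auto simp: Good_def less_imp_le\<close>)
    then show "x s \<in> cball y0 (2 * \<delta>)" by (simp add: y00 dist_norm norm_minus_commute)
  qed
  have strict: "\<delta> + 4 * K * \<delta> * \<delta> < 2 * \<delta>" using \<delta> mult_strict_right_mono[OF \<delta>(3,1)] by simp
  have Good0: "Good 0" using start y00 \<delta> by (auto simp: Good_def v_def)
  have all: "Good t" if "t \<in> {0..1}" for t
  proof (rule ccontr)
    assume "\<not> Good t"
    define Bad where "Bad = {t \<in> {0..1}. \<not> Good t}"
    have ne: "Bad \<noteq> {}" using that \<open>\<not> Good t\<close> by (auto simp: Bad_def)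
    have bdd: "bdd_below Bad" by (auto simp: Bad_def intro: bdd_belowI[of _ 0])
    define t1 where "t1 = Inf Bad"
    have t1: "0 \<le> t1" "t1 \<le> 1"
    proof -
      obtain s where s: "s \<in> Bad" using ne by blast
      have "t1 \<le> s" unfolding t1_def by (rule cInf_lower[OF s bdd])
      then show "t1 \<le> 1" using s by (simp add: Bad_def)
      show "0 \<le> t1" unfolding t1_def by (rule cInf_greatest[OF ne]) (simp add: Bad_def)
    qed
    have before: "Good s" if "0 \<le> s" "s < t1" for s
    proof (rule ccontr)
      assume "\<not> Good s"
      then have "s \<in> Bad" using that t1 by (auto simp: Bad_def)
      then show False using cInf_lower[OF _ bdd] that by (simp add: t1_def leD)
    qed
    have "Good t1"
    proof (cases "t1 = 0")
      case False
      then have t1': "0 < t1" using t1 by simp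
      have F: "at t1 within {0..<t1} \<noteq> bot"
        using t1' by (simp add: trivial_limit_within islimpt_greaterThanLessThan1 at_within_eq_bot_iff)
      have sub01: "{0..<t1} \<subseteq> {0..1}" using t1 by auto
      \<comment> \<open>At a limit time \<gamma> might leave the chart. The set of points with
        coordinates in a closed ball is compact, hence closed in the Hausdorff manifold, and so
        contains the limit.\<close>
      let ?C = "chart_inv c ` cball y0 (2 * \<delta>)"
      have dr: "cball y0 (2 * \<delta>) \<subseteq> ball y0 r" using \<delta> by (auto simp: subset_iff)
      then have dc: "cball y0 (2 * \<delta>) \<subseteq> chart_image c" using sub by (meson ball_subset_cball order_trans)
      have "compact ?C"
        by (rule compact_continuous_image[OF continuous_on_subset[OF homeomorphism_cont2[OF chart_homeomorphism[OF c]] dc]]) simp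
      then have closed: "closed ?C" by (rule compact_imp_closed)
      have good: "\<forall>\<^sub>F s in at t1 within {0..<t1}. \<gamma> s \<in> ?C \<and> norm (v s) \<le> \<delta> + 4 * K * \<delta> * \<delta>"
        unfolding eventually_at_filter
      proof (rule always_eventually, intro allI impI)
        fix s assume s: "s \<in> {0..<t1}"
        have "\<gamma> s = chart_inv c (x s)" using before[of s] s c by (simp add: x_def Good_def)
        moreover have "x s \<in> cball y0 (2 * \<delta>)" "norm (v s) \<le> \<delta> + 4 * K * \<delta> * \<delta>"
          using est[of s] before s t1 by auto
        ultimately show "\<gamma> s \<in> ?C \<and> norm (v s) \<le> \<delta> + 4 * K * \<delta> * \<delta>" by blast
      qed
      have "(\<gamma> \<longlongrightarrow> \<gamma> t1) (at t1 within {0..<t1})"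
        using cont t1 sub01 by (meson atLeastAtMost_iff continuous_on_def tendsto_within_subset)
      moreover have "\<forall>\<^sub>F s in at t1 within {0..<t1}. \<gamma> s \<in> ?C"
        using good by (rule eventually_mono) blast
      ultimately have \<gamma>C: "\<gamma> t1 \<in> ?C" using Lim_in_closed_set[OF closed _ F] by blast
      then have \<gamma>c: "\<gamma> t1 \<in> fst c" "x t1 \<in> ball y0 r"
      proof -
        obtain y where y: "\<gamma> t1 = chart_inv c y" "y \<in> cball y0 (2 * \<delta>)" using \<gamma>C by blast
        then have "y \<in> chart_image c" "y \<in> ball y0 r" using dc dr by blast+
        then show "\<gamma> t1 \<in> fst c" "x t1 \<in> ball y0 r"
          using y(1) c chart_inv_in[OF c] by (simp_all add: x_def)
      qed
      have "(v \<longlongrightarrow> v t1) (at t1 within {0..1})"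
        using has_vector_derivative_continuous[OF der(2)[of t1]] \<gamma>c t1 by (simp add: continuous_within)
      then have "(v \<longlongrightarrow> v t1) (at t1 within {0..<t1})" using sub01 by (rule tendsto_within_subset)
      then have "norm (v t1) \<le> \<delta> + 4 * K * \<delta> * \<delta>"
        using good by (intro Lim_norm_ubound[OF F]) (auto elim: eventually_mono)
      then show ?thesis using \<gamma>c strict by (simp add: Good_def)
    qed (simp add: Good0)
    then have "eventually Good (at t1 within {0..1})" using Good_open t1 by simp
    then obtain d where d: "0 < d" "\<And>s. s \<in> {0..1} \<Longrightarrow> s \<noteq> t1 \<Longrightarrow> dist s t1 < d \<Longrightarrow> Good s"
      unfolding eventually_at by blast
    have "t1 + d \<le> s" if "s \<in> Bad" for s
    proof (rule ccontr)
      assume s: "\<not> t1 + d \<le> s"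
      have "t1 \<le> s" using cInf_lower[OF that bdd] by (simp add: t1_def)
      then have "Good s" using d(2)[of s] s that \<open>Good t1\<close> by (cases "s = t1") (auto simp: Bad_def dist_real_def)
      then show False using that by (simp add: Bad_def)
    qed
    then have "t1 + d \<le> t1" unfolding t1_def using cInf_greatest[OF ne] by blast
    then show False using d(1) by simp
  qed
  have tt: "0 \<le> t" "t \<le> 1" using t by auto
  note e = est[OF tt all]
  show "\<gamma> t \<in> fst c" using all[OF t] by (simp add: Good_def)
  show "snd c (\<gamma> t) \<in> cball (snd c (\<gamma> 0)) (2 * \<delta>)" using e(3) tt by (simp add: x_def y0_def)
  show "norm (velocity A {0..1} \<gamma> t c) \<le> 2 * \<delta>" using all[OF t] by (simp add: Good_def v_def)
  show "norm (velocity A {0..1} \<gamma> t c - velocity A {0..1} \<gamma> 0 c) \<le> 4 * K * \<delta> * \<delta>"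
    using e(1) tt by (simp add: v_def)
qed

section \<open>Continuity and scaling of the coordinate expressions\<close>

lemma gamma_continuous:
  assumes c: "c \<in> A" and "continuous_on T y" "continuous_on T u" "continuous_on T w" "y ` T \<subseteq> chart_image c"
  shows "continuous_on T (\<lambda>t. gamma c (y t) (u t) (w t))"
proof -
  have "continuous_on (chart_image c) (\<lambda>y. christoffel A g c y k i j)" for k i j
    by (intro continuous_at_imp_continuous_on ballI lipschitz_near_isCont christoffel_lipschitz_near[OF c])
  then have "continuous_on T (\<lambda>t. christoffel A g c (y t) k i j)" for k i j
    using assms(2,5) by (rule continuous_on_compose2)
  then show ?thesis unfolding gamma_def by (intro continuous_intros assms)
qed

lemma gform_continuous:
  assumes c: "c \<in> A" and "continuous_on T y" "continuous_on T u" "continuous_on T w" "y ` T \<subseteq> chart_image c"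
  shows "continuous_on T (\<lambda>t. gform c (y t) (u t) (w t))"
proof -
  have "continuous_on (chart_image c) (\<lambda>y. metric_matrix A g c y $ i $ j)" for i j
    by (intro continuous_at_imp_continuous_on ballI lipschitz_near_isCont metric_matrix_lipschitz_near[OF c])
  then have M: "continuous_on T (\<lambda>t. metric_matrix A g c (y t) $ i $ j)" for i j
    using assms(2,5) by (rule continuous_on_compose2)
  have sum: "continuous_on T (\<lambda>t. \<Sum>i\<in>UNIV. \<Sum>j\<in>UNIV. u t $ i * w t $ j * N i j t)"
    if "\<And>i j. continuous_on T (N i j)" for N :: "'n \<Rightarrow> 'n \<Rightarrow> _ \<Rightarrow> real"
    by (intro continuous_intros assms that)
  show ?thesis unfolding gform_def
    by (rule sum[of "\<lambda>i j t. metric_matrix A g c (y t) $ i $ j", OF M])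
qed

lemma hess_continuous:
  assumes f: "C2_function A f" and c: "c \<in> A"
    and y: "continuous_on T y" "y ` T \<subseteq> chart_image c" and u: "continuous_on T u"
  shows "continuous_on T (\<lambda>t. hess f c (y t) (u t))"
  unfolding hess_def
  by (intro continuous_intros continuous_on_second_derivative_C2[OF open_chart(2)[OF c] C2_function_chart[OF f c]]
      continuous_on_derivative_C2[OF C2_function_chart[OF f c]] gamma_continuous[OF c] y u)

lemma gform_scale: "gform c y (a *\<^sub>R u) (b *\<^sub>R w) = a * b * gform c y u w"
  using linear_cmul[OF gform_linear(1)[of c y "b *\<^sub>R w"], of a u] linear_cmul[OF gform_linear(2)[of c y u], of b w]
  by simp

lemma hess_scale:
  assumes f: "C2_function A f" and c: "c \<in> A" and y: "y \<in> chart_image c"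
  shows "hess f c y (s *\<^sub>R u) = s * s * hess f c y u"
proof -
  note C2 = C2_function_chart[OF f c]
  note l1 = C2_second_derivative_linear[OF C2 y, of "s *\<^sub>R u"]
    and l2 = C2_second_derivative_linear_right[OF open_chart(2)[OF c] C2 y, of u]
    and l3 = C2_derivative_linear[OF C2 y]
  show ?thesis
    using linear_cmul[OF l1, of s u] linear_cmul[OF l2, of s u] linear_cmul[OF l3, of "s * s"]
    by (simp add: hess_def gamma_scale algebra_simps)
qed

lemma metric_zero: "g x zero_tangent zero_tangent = 0"
  using metric_tangent_of[OF chart_at, of x 0 0] gform_scale[of _ _ 0 0 0 0]
  by (simp add: tangent_of_zero[OF chart_at])

lemma timelike_iff: "timelike A g x v \<longleftrightarrow> v \<in> tangent_space A x \<and> g x v v < 0"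
  and spacelike_iff: "spacelike A g x v \<longleftrightarrow> v \<in> tangent_space A x \<and> g x v v > 0"
  using metric_zero by (auto simp: timelike_def spacelike_def)

lemma geodesic_velocity:
  assumes geo: "geodesic_on A g I \<gamma>" and t: "t \<in> I" "at t within I \<noteq> bot" and c: "c \<in> charts_at A (\<gamma> t)"
  shows "velocity A I \<gamma> t = tangent_of A c (\<gamma> t) (velocity A I \<gamma> t c)"
proof -
  have lim: "(\<gamma> \<longlongrightarrow> \<gamma> t) (at t within I)"
    using geo t(1) unfolding geodesic_on_def continuous_on_def by blast
  have "((snd c \<circ> \<gamma>) has_vector_derivative velocity A I \<gamma> t c) (at t within I)"
    using geodesic_onD(1)[OF geo _ t(1)] charts_atD[OF c] by (simp add: o_def)
  from velocity_eq[OF lim c this t(2)] show ?thesis .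
qed

lemma geodesic_velocity_in_tangent_space:
  assumes "geodesic_on A g {a..b} \<gamma>" "a < b" "t \<in> {a..b}"
  shows "velocity A {a..b} \<gamma> t \<in> tangent_space A (\<gamma> t)"
  using geodesic_velocity[OF assms(1,3) Icc_nontrivial[OF assms(2,3)] chart_at] tangent_of_in[OF chart_at] by metis

lemma chart_geodesic_subset: "chart_geodesic c I x v \<Longrightarrow> J \<subseteq> I \<Longrightarrow> chart_geodesic c J x v"
  unfolding chart_geodesic_def by (meson has_vector_derivative_within_subset subsetD)

lemma chart_geodesic_continuous:
  assumes "chart_geodesic c I x v"
  shows "continuous_on I x" "continuous_on I v"
  using has_vector_derivative_continuous[OF chart_geodesicD(2)[OF assms]]
    has_vector_derivative_continuous[OF chart_geodesicD(3)[OF assms]]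
  unfolding continuous_on_eq_continuous_within by blast+

text \<open>The acceleration is -\<Gamma>(v, v), so the second derivative along the geodesic is
  exactly the Hessian on the velocity.\<close>

lemma function_along_geodesic:
  assumes f: "C2_function A f" and c: "c \<in> A" and geo: "chart_geodesic c I x v" and t: "t \<in> I"
  shows "((\<lambda>t. (f \<circ> chart_inv c) (x t)) has_real_derivative fderiv (f \<circ> chart_inv c) (x t) (v t)) (at t within I)"
    and "((\<lambda>t. fderiv (f \<circ> chart_inv c) (x t) (v t)) has_real_derivative hess f c (x t) (v t)) (at t within I)"
proof -
  note D = chart_geodesicD[OF geo t] and C2 = C2_function_chart[OF f c]
  show "((\<lambda>t. (f \<circ> chart_inv c) (x t)) has_real_derivative fderiv (f \<circ> chart_inv c) (x t) (v t)) (at t within I)"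
    using has_vector_derivative_compose_C2[OF C2 D(1,2)] by (simp only: has_real_derivative_iff_has_vector_derivative)
  show "((\<lambda>t. fderiv (f \<circ> chart_inv c) (x t) (v t)) has_real_derivative hess f c (x t) (v t)) (at t within I)"
    using has_vector_derivative_derivative_C2[OF open_chart(2)[OF c] C2 D(1,2,3)]
      linear_neg[OF C2_derivative_linear[OF C2 D(1)]]
    by (simp add: has_real_derivative_iff_has_vector_derivative hess_def)
qed

end

section \<open>The boundary and its tangent vectors\<close>

locale convexity_setting = semi_riemannian A g
  for A :: "('a::{t2_space,second_countable_topology}, 'n::finite) chart set" and g :: "('a, 'n) metric" +
  fixes \<Omega> :: "'a set" and \<phi> :: "'a \<Rightarrow> real"
  assumes open_\<Omega>: "open \<Omega>" and \<phi>_C2: "C2_function A \<phi>" and regular: "regular_value A \<phi> 0"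
    and frontier_eq: "frontier \<Omega> = \<phi> -` {0}" and \<phi>_pos: "\<forall>x\<in>\<Omega>. \<phi> x > 0"
begin

abbreviation chart_\<phi> :: "('a, 'n) chart \<Rightarrow> real^'n \<Rightarrow> real" where
  "chart_\<phi> c \<equiv> \<phi> \<circ> chart_inv c"

lemma chart_\<phi>_C2: "c \<in> A \<Longrightarrow> Ck_on 2 (chart_image c) (chart_\<phi> c)"
  by (rule C2_function_chart[OF \<phi>_C2])

lemma chart_inv_at [simp]: "c \<in> charts_at A x \<Longrightarrow> chart_inv c (snd c x) = x"
  by (simp add: charts_at_def)

lemma regular_direction:
  assumes x: "x \<in> frontier \<Omega>" and c: "c \<in> charts_at A x"
  shows "\<exists>e. norm e = 1 \<and> 0 < fderiv (chart_\<phi> c) (snd c x) e"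
proof -
  have "1 \<in> differential A \<phi> x ` tangent_space A x"
    using regular x frontier_eq unfolding regular_value_def by auto
  then obtain v where v: "v \<in> tangent_space A x" "differential A \<phi> x v = 1" by auto
  let ?D = "fderiv (chart_\<phi> c) (snd c x)"
  have lin: "linear ?D" by (rule C2_derivative_linear[OF chart_\<phi>_C2]) (use c charts_atD in auto)
  have D: "?D (v c) = 1" using differential_eq[OF \<phi>_C2 v(1) c] v(2) by simp
  then have nz: "v c \<noteq> 0" using linear_0[OF lin] by auto
  then show ?thesis using D linear_cmul[OF lin]
    by (intro exI[of _ "(1 / norm (v c)) *\<^sub>R v c"]) simp
qed

lemma transversal_at:
  assumes x: "x \<in> frontier \<Omega>" and c: "c \<in> charts_at A x" and r0: "0 < r0"
  shows "\<exists>e r a L. r \<le> r0 \<and> transversal (chart_\<phi> c) (chart_image c) (snd c x) e r a L"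
proof -
  obtain e where e: "norm e = 1" "0 < fderiv (chart_\<phi> c) (snd c x) e"
    using regular_direction[OF x c] by blast
  have "chart_\<phi> c (snd c x) = 0" using x c frontier_eq by simp
  from transversal_exists[OF open_chart(2) chart_\<phi>_C2 _ this e r0] c charts_atD
  show ?thesis by blast
qed

text \<open>A curve in the boundary keeps \<phi> at 0, so the differential annihilates its velocity.
  Conversely, the feet of a straight chart line in a kernel direction form a C1 curve in the
  boundary with that velocity.\<close>

lemma tangent_space_sub_frontier:
  assumes x: "x \<in> frontier \<Omega>"
  shows "tangent_space_sub A (frontier \<Omega>) x = {v \<in> tangent_space A x. differential A \<phi> x v = 0}"
proof (intro equalityI subsetI)
  define c where "c = chart_at A x"
  have c: "c \<in> charts_at A x" unfolding c_def by (rule chart_at)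
  note cA = charts_atD[OF c]
  let ?D = "fderiv (chart_\<phi> c) (snd c x)"
  {
    fix v assume "v \<in> tangent_space_sub A (frontier \<Omega>) x"
    then obtain \<epsilon> \<gamma> where \<epsilon>: "0 < \<epsilon>" and C1: "C1_curve A {- \<epsilon><..<\<epsilon>} \<gamma>"
      and \<gamma>: "\<gamma> ` {- \<epsilon><..<\<epsilon>} \<subseteq> frontier \<Omega>" "\<gamma> 0 = x" "velocity A {- \<epsilon><..<\<epsilon>} \<gamma> 0 = v"
      unfolding tangent_space_sub_def by blast
    let ?I = "{- \<epsilon><..<\<epsilon>}"
    have I: "at 0 within ?I = at 0" using \<epsilon> by (intro at_within_open) auto
    have lim: "(\<gamma> \<longlongrightarrow> \<gamma> 0) (at 0 within ?I)"
      using C1 \<epsilon> unfolding C1_curve_def continuous_on_def by auto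
    have "(snd c \<circ> \<gamma>) differentiable (at 0 within ?I)"
      using C1 \<epsilon> \<gamma>(2) cA unfolding C1_curve_def by auto
    then obtain w where w: "((snd c \<circ> \<gamma>) has_vector_derivative w) (at 0 within ?I)"
      by (auto simp: vector_derivative_works)
    have c0: "c \<in> charts_at A (\<gamma> 0)" using c \<gamma>(2) by simp
    have v: "v = tangent_of A c x w"
      using velocity_eq[OF lim c0 w] I \<gamma> by simp
    have "((\<lambda>t. chart_\<phi> c ((snd c \<circ> \<gamma>) t)) has_vector_derivative ?D w) (at 0 within ?I)"
      using has_vector_derivative_compose_C2[OF chart_\<phi>_C2 _ w] cA \<gamma>(2) by simp
    moreover have "((\<lambda>t. chart_\<phi> c ((snd c \<circ> \<gamma>) t)) has_vector_derivative 0) (at 0 within ?I)"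
    proof (rule has_vector_derivative_transform_eventually[OF has_vector_derivative_const[of 0]])
      have "eventually (\<lambda>s. s \<in> ?I) (at 0 within ?I)" by (simp add: eventually_at_filter)
      with curve_in_chart_eventually[OF lim c0]
      show "\<forall>\<^sub>F s in at 0 within ?I. 0 = chart_\<phi> c ((snd c \<circ> \<gamma>) s)"
      proof eventually_elim
        fix s assume "\<gamma> s \<in> fst c" "s \<in> ?I"
        moreover have "\<phi> (\<gamma> s) = 0" using \<gamma>(1) \<open>s \<in> ?I\<close> frontier_eq by blast
        ultimately show "0 = chart_\<phi> c ((snd c \<circ> \<gamma>) s)" using cA by simp
      qed
    qed (use x frontier_eq \<gamma>(2) cA in auto)
    ultimately have "?D w = 0"
      unfolding I by (rule vector_derivative_unique_at)
    then have "differential A \<phi> x v = 0"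
      using differential_eq[OF \<phi>_C2 tangent_of_in[OF c] c, of w] v tangent_of_self[OF c] by simp
    then show "v \<in> {v \<in> tangent_space A x. differential A \<phi> x v = 0}"
      using v tangent_of_in[OF c] by simp
  }
  fix v assume "v \<in> {v \<in> tangent_space A x. differential A \<phi> x v = 0}"
  then have v: "v \<in> tangent_space A x" "?D (v c) = 0" using differential_eq[OF \<phi>_C2 _ c] by auto
  obtain e r a L where "transversal (chart_\<phi> c) (chart_image c) (snd c x) e r a L"
    using transversal_at[OF x c zero_less_one] by blast
  then interpret T: transversal "chart_\<phi> c" "chart_image c" "snd c x" e r a L .
  let ?u = "v c" and ?y = "\<lambda>t. snd c x + t *\<^sub>R v c"
  \<comment> \<open>Keeps the line inside the inner ball, where the foot is controlled; the 1 covers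
    \<open>v c = 0\<close>.\<close>
  define \<epsilon> where "\<epsilon> = T.inner_radius / (norm ?u + 1)"
  have \<epsilon>: "0 < \<epsilon>" "\<epsilon> * norm ?u \<le> T.inner_radius"
    using T.inner_radius(1) by (auto simp: \<epsilon>_def field_simps add_pos_nonneg)
  let ?I = "{- \<epsilon><..<\<epsilon>}"
  have sub: "?y ` ?I \<subseteq> cball (snd c x) T.inner_radius"
  proof
    fix z assume "z \<in> ?y ` ?I"
    then obtain t where "t \<in> ?I" and t: "z = ?y t" by blast
    then have "\<bar>t\<bar> \<le> \<epsilon>" by auto
    then have "\<bar>t\<bar> * norm ?u \<le> \<epsilon> * norm ?u" by (intro mult_right_mono) auto
    then show "z \<in> cball (snd c x) T.inner_radius" using \<epsilon>(2) t by (simp add: dist_norm)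
  qed
  have y: "(?y has_vector_derivative ?u) (at t within ?I)" for t by (auto intro!: derivative_eq_intros)
  have x0: "snd c x \<in> cball (snd c x) T.inner_radius" using T.inner_radius(1) by simp
  have phi0: "chart_\<phi> c (snd c x) = 0" using x c frontier_eq by simp
  have img: "T.foot (?y t) \<in> chart_image c" if "t \<in> ?I" for t
  proof -
    have "?y t \<in> cball (snd c x) T.inner_radius" using sub that unfolding image_subset_iff by (rule bspec)
    from subsetD[OF T.ball_S T.foot_in[OF this]] show ?thesis .
  qed
  have I: "at t within ?I \<noteq> bot" if "t \<in> ?I" for t
    using that at_within_open[of t ?I] trivial_limit_at[of t] open_greaterThanLessThan by metis
  note foot_der = T.root_curve(2)[OF y sub]
  let ?\<gamma> = "chart_inv c \<circ> (\<lambda>t. T.foot (?y t))"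
  have "C1_curve A ?I ?\<gamma>"
    by (rule chart_curve_C1[OF cA(1) img foot_der I])
       (auto intro!: T.foot_velocity_continuous[OF _ sub] continuous_intros)
  moreover have "?\<gamma> ` ?I \<subseteq> frontier \<Omega>"
    using T.root(2)[of "?y _"] sub unfolding frontier_eq by fastforce
  moreover have g0: "?\<gamma> 0 = x" using T.foot_fixed(1)[OF x0 phi0] cA by simp
  moreover have "velocity A ?I ?\<gamma> 0 = v"
  proof -
    have "velocity A ?I ?\<gamma> 0 = tangent_of A c (?\<gamma> 0) (T.foot_velocity (?y 0) ?u)"
      by (rule chart_curve_velocity[OF cA(1) img foot_der I]) (use \<epsilon> in auto)
    also have "\<dots> = tangent_of A c x ?u" using T.foot_velocity_fixed(2)[OF x0 phi0 v(2)] g0 by simp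
    finally show ?thesis using tangent_of_component[OF v(1) c] by simp
  qed
  ultimately show "v \<in> tangent_space_sub A (frontier \<Omega>) x"
    unfolding tangent_space_sub_def using \<epsilon>(1) by blast
qed

text \<open>Near a boundary point, \<open>{\<phi> > 0}\<close> is connected (push along the transversal direction), hence on one side of \<open>\<partial>\<Omega>\<close>.\<close>

lemma positive_side:
  assumes x: "x \<in> frontier \<Omega>" and c: "c \<in> charts_at A x"
  shows "\<exists>\<rho>>0. cball (snd c x) \<rho> \<subseteq> chart_image c \<and>
    (\<forall>y\<in>cball (snd c x) \<rho>. 0 < chart_\<phi> c y \<longrightarrow> chart_inv c y \<in> \<Omega>)"
proof -
  note cA = charts_atD[OF c]
  obtain e r a L where "transversal (chart_\<phi> c) (chart_image c) (snd c x) e r a L"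
    using transversal_at[OF x c zero_less_one] by blast
  then interpret T: transversal "chart_\<phi> c" "chart_image c" "snd c x" e r a L .
  let ?x0 = "snd c x" and ?f = "chart_\<phi> c"
  note r = T.r_pos and a = T.a_pos and L = T.L_nonneg
  \<comment> \<open>The first bound leaves room for shifts up to \<open>r / 2\<close> along
    \<open>e\<close>; the second makes the possible loss \<open>L * \<rho>\<close> smaller than the
    gain \<open>a * (r / 2)\<close>, so that \<phi> is positive on the ball shifted by
    \<open>r / 2\<close>.\<close>
  define \<rho> where "\<rho> = min (r / 2) (a * r / (4 * (L + 1)))"
  have \<rho>: "0 < \<rho>" "\<rho> \<le> r / 2" using r a L min.cobounded1[of "r / 2"] unfolding \<rho>_def by simp_all
  have L\<rho>: "L * \<rho> < a * (r / 2)"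
  proof -
    have "L * \<rho> \<le> L * (a * r / (4 * (L + 1)))" using L by (intro mult_left_mono) (auto simp: \<rho>_def)
    also have "\<dots> \<le> a * r / 4" using L a r by (simp add: field_simps)
    also have "\<dots> < a * (r / 2)" using a r by simp
    finally show ?thesis .
  qed
  have inr: "y + s *\<^sub>R e \<in> cball ?x0 r" if "y \<in> cball ?x0 \<rho>" "0 \<le> s" "s \<le> r / 2" for y s
  proof -
    have "norm (?x0 - (y + s *\<^sub>R e)) \<le> norm (?x0 - y) + norm (s *\<^sub>R e)"
      using norm_triangle_ineq4[of "?x0 - y" "s *\<^sub>R e"] by (simp add: algebra_simps)
    also have "\<dots> \<le> r" using that T.norm_e \<rho> by (simp add: dist_norm)
    finally show ?thesis by (simp add: dist_norm)
  qed
  have up: "?f y + a * s \<le> ?f (y + s *\<^sub>R e)" if "y \<in> cball ?x0 \<rho>" "0 \<le> s" "s \<le> r / 2" for y s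
    using T.decrease[of y "- s" 0] inr[OF that] inr[OF that(1), of 0] that r by simp
  define top where "top = (\<lambda>y. y + (r / 2) *\<^sub>R e) ` cball ?x0 \<rho>"
  have top_pos: "0 < ?f z \<and> z \<in> cball ?x0 r" if z: "z \<in> top" for z
  proof -
    obtain y where y: "y \<in> cball ?x0 \<rho>" "z = y + (r / 2) *\<^sub>R e" using z by (auto simp: top_def)
    have "\<bar>?f y\<bar> \<le> L * norm (y - ?x0)"
      using T.lipschitz[of ?x0 y] inr[OF y(1), of 0] T.zero r by simp
    also have "\<dots> \<le> L * \<rho>" using y(1) L by (intro mult_left_mono) (auto simp: dist_norm norm_minus_commute)
    finally have "- (L * \<rho>) \<le> ?f y" by (simp add: abs_le_iff)
    then show ?thesis using up[OF y(1), of "r / 2"] L\<rho> r inr[OF y(1), of "r / 2"] y(2) by simp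
  qed
  \<comment> \<open>The segment climbing from \<open>y\<close> together with the shifted ball: a
    connected set through each positive \<open>y\<close>, all of them sharing
    \<open>top\<close>.\<close>
  define lift where "lift y = (\<lambda>s. y + s *\<^sub>R e) ` {0..r / 2} \<union> top" for y
  have lift_conn: "connected (chart_inv c ` lift y)" and lift_pos: "\<And>z. z \<in> lift y \<Longrightarrow> 0 < ?f z"
    if y: "y \<in> cball ?x0 \<rho>" "0 < ?f y" for y
  proof -
    have seg: "0 < ?f z \<and> z \<in> cball ?x0 r" if z: "z \<in> (\<lambda>s. y + s *\<^sub>R e) ` {0..r / 2}" for z
    proof -
      obtain s where "s \<in> {0..r / 2}" and s1: "z = y + s *\<^sub>R e" using z by blast
      then have s: "z = y + s *\<^sub>R e" "0 \<le> s" "s \<le> r / 2" by auto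
      have "0 \<le> a * s" using a s by simp
      then show ?thesis using up[OF y(1) s(2,3)] y(2) inr[OF y(1) s(2,3)] unfolding s(1) by simp
    qed
    then show "0 < ?f z" if "z \<in> lift y" for z using that top_pos by (auto simp: lift_def)
    have "connected ((\<lambda>s. y + s *\<^sub>R e) ` {0..r / 2})"
      by (intro connected_continuous_image continuous_intros) auto
    moreover have "connected top"
      unfolding top_def by (intro connected_continuous_image continuous_intros) auto
    moreover have "y + (r / 2) *\<^sub>R e \<in> (\<lambda>s. y + s *\<^sub>R e) ` {0..r / 2} \<inter> top"
      using y(1) r by (auto simp: top_def)
    ultimately have conn: "connected (lift y)" unfolding lift_def by (intro connected_Un) blast+
    have "lift y \<subseteq> cball ?x0 r" unfolding lift_def by (rule Un_least; rule subsetI) (use seg top_pos in blast)+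
    then have "lift y \<subseteq> chart_image c" using T.ball_S by blast
    then show "connected (chart_inv c ` lift y)"
      by (intro connected_continuous_image conn continuous_on_subset[OF homeomorphism_cont2[OF chart_homeomorphism[OF cA(1)]]])
  qed
  \<comment> \<open>A connected set that meets \<Omega> without being contained in it meets the
    frontier, where \<phi> vanishes; on \<open>lift y\<close> it is positive.\<close>
  have transfer: "chart_inv c q \<in> \<Omega>"
    if y: "y \<in> cball ?x0 \<rho>" "0 < ?f y" and pq: "p \<in> lift y" "q \<in> lift y" "chart_inv c p \<in> \<Omega>" for y p q
  proof (rule ccontr)
    assume "chart_inv c q \<notin> \<Omega>"
    with pq have "chart_inv c ` lift y \<inter> frontier \<Omega> \<noteq> {}"
      by (intro connected_Int_frontier lift_conn[OF y]) blast+
    then show False using lift_pos[OF y] frontier_eq by fastforce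
  qed
  have y_in: "y \<in> lift y" for y
  proof -
    have "y + 0 *\<^sub>R e \<in> (\<lambda>s. y + s *\<^sub>R e) ` {0..r / 2}" using r by (intro imageI) simp
    then show ?thesis by (simp add: lift_def)
  qed
  \<comment> \<open>A point of \<Omega> near \<open>x\<close> decides the side: through
    \<open>top\<close> its membership passes to every positive \<open>y\<close>.\<close>
  have "x \<in> closure \<Omega>" using x by (simp add: frontier_def)
  moreover have "open (chart_inv c ` ball ?x0 \<rho>)"
  proof -
    have "ball ?x0 \<rho> \<subseteq> chart_image c" using \<rho> T.ball_S by (auto simp: subset_iff)
    then have "openin (top_of_set (fst c)) (chart_inv c ` ball ?x0 \<rho>)"
      by (rule homeomorphism_imp_open_map[OF chart_homeomorphism[OF cA(1), THEN homeomorphism_symD] open_subset[OF _ open_ball]])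
    then show ?thesis using open_chart(1)[OF cA(1)] openin_open_trans by blast
  qed
  moreover have "x \<in> chart_inv c ` ball ?x0 \<rho>" using \<rho> c by (intro image_eqI[of _ _ ?x0]) simp_all
  ultimately obtain p where "p \<in> \<Omega>" "p \<in> chart_inv c ` ball ?x0 \<rho>"
    by (meson closure_iff_nhds_not_empty disjoint_iff order_refl)
  then obtain y0 where "y0 \<in> ball ?x0 \<rho>" and y0_\<Omega>: "chart_inv c y0 \<in> \<Omega>" by blast
  then have y0: "y0 \<in> cball ?x0 \<rho>" "chart_inv c y0 \<in> \<Omega>" by auto
  then have y0_pos: "0 < ?f y0" using \<phi>_pos by auto
  have "?x0 + (r / 2) *\<^sub>R e \<in> top" using \<rho> by (auto simp: top_def)
  then have common: "?x0 + (r / 2) *\<^sub>R e \<in> lift y" for y by (simp add: lift_def)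
  have "chart_inv c (?x0 + (r / 2) *\<^sub>R e) \<in> \<Omega>"
    by (rule transfer[OF y0(1) y0_pos y_in common y0(2)])
  then have "chart_inv c y \<in> \<Omega>" if "y \<in> cball ?x0 \<rho>" "0 < ?f y" for y
    using transfer[OF that common y_in] by blast
  moreover have "cball ?x0 \<rho> \<subseteq> chart_image c" using \<rho> T.ball_S by (auto simp: subset_iff)
  ultimately show ?thesis using \<rho>(1) by blast
qed

text \<open>\<open>C\<close> collects the admissible values of g(v, v): \<open>UNIV\<close>, the
  negative and the positive reals give the plain, time and space versions. The tangent space of the
  boundary is already replaced by the kernel of the differential.\<close>

definition infinitesimally_convex_on :: "real set \<Rightarrow> bool" where
  "infinitesimally_convex_on C \<longleftrightarrow> (\<forall>x\<in>frontier \<Omega>. \<forall>v\<in>tangent_space A x.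
     differential A \<phi> x v = 0 \<longrightarrow> g x v v \<in> C \<longrightarrow> hessian A g \<phi> x v v \<le> 0)"

definition geometrically_convex_on :: "real set \<Rightarrow> bool" where
  "geometrically_convex_on C \<longleftrightarrow> (\<forall>p\<in>\<Omega>. \<forall>q\<in>\<Omega>. \<forall>\<gamma>. geodesic_arc A g p q \<gamma> \<longrightarrow>
     (\<forall>t\<in>{0..1}. g (\<gamma> t) (velocity A {0..1} \<gamma> t) (velocity A {0..1} \<gamma> t) \<in> C) \<longrightarrow>
     \<gamma> ` {0..1} \<subseteq> \<Omega> \<union> frontier \<Omega> \<longrightarrow> \<gamma> ` {0..1} \<subseteq> \<Omega>)"

lemma infinitesimally_convex_chart:
  assumes conv: "infinitesimally_convex_on C" and c: "c \<in> A" and y: "y \<in> chart_image c" "chart_\<phi> c y = 0"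
    and u: "fderiv (chart_\<phi> c) y u = 0" "gform c y u u \<in> C"
  shows "hess \<phi> c y u \<le> 0"
proof -
  let ?p = "chart_inv c y"
  have cp: "c \<in> charts_at A ?p" and yp: "snd c ?p = y" using charts_at_chart_inv[OF c y(1)] c y(1) by auto
  have p: "?p \<in> frontier \<Omega>" using y(2) frontier_eq by simp
  note T = tangent_of_in[OF cp, of u]
  have "hessian A g \<phi> ?p (tangent_of A c ?p u) (tangent_of A c ?p u) \<le> 0"
    using conv p T differential_eq[OF \<phi>_C2 T cp] metric_tangent_of[OF cp, of u u] u
    unfolding infinitesimally_convex_on_def yp by (simp add: tangent_of_self[OF cp])
  then show ?thesis using hessian_eq_hess[OF \<phi>_C2 T cp] by (simp add: yp tangent_of_self[OF cp])
qed

end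

section \<open>Geodesics do not cross an infinitesimally convex boundary\<close>

locale boundary_chart = convexity_setting A g \<Omega> \<phi> +
  transversal "\<phi> \<circ> chart_inv c" "snd c ` fst c" x0 e r a L
  for A :: "('a::{t2_space,second_countable_topology}, 'n::finite) chart set" and g :: "('a, 'n) metric"
    and \<Omega> :: "'a set" and \<phi> :: "'a \<Rightarrow> real" and c :: "('a, 'n) chart" and x0 e r a L +
  fixes r0 K
  assumes chart: "c \<in> A" and gamma: "gamma_bounded c x0 r0 K" and r_le: "r \<le> r0"
begin

text \<open>The root speed is at most \<open>L / a\<close> times the speed, and \<open>e\<close> is
  a unit vector.\<close>

definition foot_speed_bound :: "real \<Rightarrow> real" where
  "foot_speed_bound V = (1 + L / a) * V"

text \<open>The factor containing \<open>K\<close> bounds the difference of Christoffel terms by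
  \<open>gamma_diff\<close>; \<open>L / a\<close> comes from applying the differential and dividing
  by the slope along \<open>e\<close>. The constant tends to 0 with \<open>V\<close>.\<close>

definition comparison_const :: "real \<Rightarrow> real" where
  "comparison_const V = L / a * (K * (foot_speed_bound V * foot_speed_bound V + 2 * foot_speed_bound V))"

text \<open>Only the Christoffel symbols are compared at \<open>y\<close> and at its foot, and these are Lipschitz; the second derivatives
  of \<open>\<phi>\<close>, which are merely continuous, are evaluated at the boundary point only.\<close>

lemma root_acceleration_le:
  assumes y: "y \<in> cball x0 inner_radius" and V: "norm v \<le> V"
    and hess: "hess \<phi> c (foot y) (foot_velocity y v) \<le> 0"
  shows "(fderiv2 (chart_\<phi> c) (foot y) (foot_velocity y v) (foot_velocity y v) +
      fderiv (chart_\<phi> c) (foot y) (- gamma c y v v)) / fderiv (chart_\<phi> c) (foot y) e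
    \<le> comparison_const V * (\<bar>root y\<bar> + \<bar>root_speed y v\<bar>)"
proof -
  let ?b = "foot y" and ?w = "foot_velocity y v" and ?D = "fderiv (chart_\<phi> c) (foot y)"
  let ?V = "foot_speed_bound V"
  note b = foot_in[OF y]
  have V0: "0 \<le> V" using V norm_ge_zero order_trans by blast
  have La: "0 \<le> L / a" using L_nonneg a_pos by simp
  have K: "0 \<le> K" by (rule gamma_boundedD(2)[OF gamma])
  have VV: "V \<le> ?V" using mult_nonneg_nonneg[OF La V0] by (simp add: foot_speed_bound_def algebra_simps)
  have wv: "norm (?w - v) = \<bar>root_speed y v\<bar>" by (simp add: foot_velocity_def norm_e)
  have w: "norm ?w \<le> ?V"
  proof -
    have "norm ?w \<le> norm v + norm (?w - v)" by (rule norm_triangle_sub)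
    also have "\<dots> \<le> norm v + L / a * norm v" unfolding wv using root_speed_bound[OF y] by simp
    also have "\<dots> = (1 + L / a) * norm v" by (simp add: algebra_simps)
    also have "\<dots> \<le> ?V" unfolding foot_speed_bound_def using V La by (intro mult_left_mono) auto
    finally show ?thesis .
  qed
  have br: "?b \<in> cball x0 r0" "y \<in> cball x0 r0" using b y r_le inner_radius(3) by auto
  let ?G = "gamma c ?b ?w ?w - gamma c y v v"
  have by_: "norm (?b - y) = \<bar>root y\<bar>" by (simp add: foot_def norm_e)
  have "norm ?G \<le> K * norm (?b - y) * (norm ?w * norm ?w) + K * (norm (?w - v) * (norm ?w + norm v))"
    by (rule gamma_diff[OF gamma br])
  also have "\<dots> \<le> K * \<bar>root y\<bar> * (?V * ?V) + K * (\<bar>root_speed y v\<bar> * (?V + ?V))"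
    unfolding by_ wv using w V VV K V0
    by (intro add_mono mult_left_mono mult_mono mult_nonneg_nonneg) auto
  also have "\<dots> \<le> K * (?V * ?V + 2 * ?V) * (\<bar>root y\<bar> + \<bar>root_speed y v\<bar>)"
  proof -
    have "0 \<le> K * (2 * ?V) * \<bar>root y\<bar>" "0 \<le> K * (?V * ?V) * \<bar>root_speed y v\<bar>"
      using K VV V0 by (intro mult_nonneg_nonneg; linarith | simp)+
    then show ?thesis by (simp add: algebra_simps)
  qed
  finally have G: "norm ?G \<le> K * (?V * ?V + 2 * ?V) * (\<bar>root y\<bar> + \<bar>root_speed y v\<bar>)" .
  note lin = derivative_linear[OF b]
  \<comment> \<open>The Christoffel term at the foot is added and subtracted: convexity disposes of
    the Hessian there, and only the Lipschitz difference \<open>?G\<close> remains.\<close>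
  have num: "fderiv2 (chart_\<phi> c) ?b ?w ?w + ?D (- gamma c y v v) = hess \<phi> c ?b ?w + ?D ?G"
    by (simp add: hess_def linear_diff[OF lin] linear_neg[OF lin])
  have De: "a \<le> ?D e" "0 < ?D e" using slope[OF b] slope_pos[OF b] by auto
  have "(hess \<phi> c ?b ?w + ?D ?G) / ?D e \<le> (L * norm ?G) / ?D e"
    using hess bound[OF b, of ?G] De by (intro divide_right_mono) (auto simp: abs_le_iff)
  also have "\<dots> \<le> (L * norm ?G) / a"
    using De a_pos L_nonneg by (intro divide_left_mono) auto
  also have "\<dots> = L / a * norm ?G" by simp
  also have "\<dots> \<le> L / a * (K * (?V * ?V + 2 * ?V) * (\<bar>root y\<bar> + \<bar>root_speed y v\<bar>))"
    using G La by (rule mult_left_mono)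
  also have "\<dots> = comparison_const V * (\<bar>root y\<bar> + \<bar>root_speed y v\<bar>)"
    by (simp add: comparison_const_def)
  finally show ?thesis unfolding num .
qed

text \<open>The root along the geodesic satisfies the comparison inequality, started from whichever
  end carries the contact. The condition \<open>C\<close> is put on the foot velocity because
  convexity is applied at the foot.\<close>

lemma geodesic_barrier:
  assumes conv: "infinitesimally_convex_on C"
    and geo: "chart_geodesic c {p..q} x v" and sub: "x ` {p..q} \<subseteq> cball x0 inner_radius"
    and V: "\<And>t. t \<in> {p..q} \<Longrightarrow> norm (v t) \<le> V"
    and C: "\<And>t. t \<in> {p..q} \<Longrightarrow> gform c (foot (x t)) (foot_velocity (x t) (v t)) (foot_velocity (x t) (v t)) \<in> C"
    and small: "comparison_const V * (q - p) * (1 + (q - p)) < 1"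
    and s: "s = p \<or> s = q" and start: "chart_\<phi> c (x s) = 0" "fderiv (chart_\<phi> c) (x s) (v s) = 0"
    and t: "t \<in> {p..q}"
  shows "chart_\<phi> c (x t) \<le> 0"
proof -
  note D = chart_geodesicD[OF geo]
  have in_ball: "x t \<in> cball x0 inner_radius" if "t \<in> {p..q}" for t using sub that by blast
  have pq: "p \<in> {p..q}" "q \<in> {p..q}" "s \<in> {p..q}" using t s by auto
  have "0 \<le> V" using V[OF t] norm_ge_zero order_trans by blast
  then have const: "0 \<le> comparison_const V"
    using L_nonneg a_pos gamma_boundedD(2)[OF gamma]
    unfolding comparison_const_def foot_speed_bound_def by (intro mult_nonneg_nonneg add_nonneg_nonneg) auto
  have init: "root (x s) = 0" "root_speed (x s) (v s) = 0"
    using foot_fixed(2)[OF in_ball[OF pq(3)] start(1)] foot_velocity_fixed(1)[OF in_ball[OF pq(3)] start] by auto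
  have d1: "((\<lambda>s. root (x s)) has_real_derivative root_speed (x t) (v t)) (at t within {p..q})" if "t \<in> {p..q}" for t
    by (rule root_curve(1)[OF D(2)[OF that] sub that])
  note d2 = root_speed_curve[OF D(2) D(3) sub]
  have acc: "(fderiv2 (chart_\<phi> c) (foot (x t)) (foot_velocity (x t) (v t)) (foot_velocity (x t) (v t)) +
      fderiv (chart_\<phi> c) (foot (x t)) (- gamma c (x t) (v t) (v t))) / fderiv (chart_\<phi> c) (foot (x t)) e
    \<le> comparison_const V * (\<bar>root (x t)\<bar> + \<bar>root_speed (x t) (v t)\<bar>)" if t: "t \<in> {p..q}" for t
  proof (rule root_acceleration_le[OF in_ball[OF t] V[OF t]])
    show "hess \<phi> c (foot (x t)) (foot_velocity (x t) (v t)) \<le> 0"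
    proof (rule infinitesimally_convex_chart[OF conv chart])
      show "foot (x t) \<in> chart_image c" using foot_in[OF in_ball[OF t]] ball_S by blast
      show "chart_\<phi> c (foot (x t)) = 0" by (rule root(2)[OF in_ball[OF t]])
    qed (rule foot_velocity_tangent[OF in_ball[OF t]], rule C[OF t])
  qed
  have "root (x t) \<le> 0"
    using s
  proof
    assume "s = p"
    with init show ?thesis
      by (intro second_order_comparison[OF d1 d2 _ _ acc const small t]) auto
  next
    assume "s = q"
    with init show ?thesis
      by (intro second_order_comparison_left[OF d1 d2 _ _ acc const small t]) auto
  qed
  then show ?thesis using root_pos_iff(1)[OF in_ball[OF t]] by auto
qed

end

section \<open>The equivalences\<close>

context convexity_setting
begin

lemma frontier_disjoint: "x \<in> frontier \<Omega> \<Longrightarrow> x \<notin> \<Omega>"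
  using frontier_eq \<phi>_pos by fastforce

lemma boundary_chart_exists:
  assumes x: "x \<in> frontier \<Omega>" and c: "c \<in> charts_at A x"
  shows "\<exists>e r a L r0 K. boundary_chart A g \<Omega> \<phi> c (snd c x) e r a L r0 K"
proof -
  obtain r0 K where b: "gamma_bounded c (snd c x) r0 K"
    using gamma_bounded_exists charts_atD[OF c] by blast
  obtain e r a L where r: "r \<le> r0" and T: "transversal (chart_\<phi> c) (chart_image c) (snd c x) e r a L"
    using transversal_at[OF x c gamma_boundedD(1)[OF b]] by blast
  have "boundary_chart A g \<Omega> \<phi> c (snd c x) e r a L r0 K"
    by (intro boundary_chart.intro T convexity_setting_axioms boundary_chart_axioms.intro charts_atD(1)[OF c] b r)
  then show ?thesis by blast
qed

text \<open>At the first contact time \<phi> \<circ> \<gamma> has an interior minimum, so the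
  geodesic is tangent to the boundary. The barrier, run backwards in time, forces \<phi> \<le> 0
  just before, where the geodesic is still in \<Omega>.\<close>

lemma infinitesimally_imp_geometrically_convex:
  assumes C: "open C" and conv: "infinitesimally_convex_on C"
  shows "geometrically_convex_on C"
  unfolding geometrically_convex_on_def
proof (intro ballI allI impI)
  fix p q \<gamma> assume p: "p \<in> \<Omega>" and q: "q \<in> \<Omega>" and arc: "geodesic_arc A g p q \<gamma>"
    and causal: "\<forall>t\<in>{0..1}. g (\<gamma> t) (velocity A {0..1} \<gamma> t) (velocity A {0..1} \<gamma> t) \<in> C"
    and image: "\<gamma> ` {0..1} \<subseteq> \<Omega> \<union> frontier \<Omega>"
  have geo: "geodesic_on A g {0..1} \<gamma>" and ends: "\<gamma> 0 = p" "\<gamma> 1 = q"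
    using arc by (auto simp: geodesic_arc_def)
  have cont: "continuous_on {0..1} \<gamma>" using geo unfolding geodesic_on_def by blast
  show "\<gamma> ` {0..1} \<subseteq> \<Omega>"
  proof (rule ccontr)
    assume "\<not> \<gamma> ` {0..1} \<subseteq> \<Omega>"
    define Z where "Z = {0..1} \<inter> \<gamma> -` frontier \<Omega>"
    have "Z \<noteq> {}" using \<open>\<not> \<gamma> ` {0..1} \<subseteq> \<Omega>\<close> image unfolding Z_def by blast
    moreover have "compact Z"
      unfolding Z_def compact_eq_bounded_closed
      by (intro conjI bounded_Int disjI1 continuous_closed_preimage cont) auto
    ultimately obtain t0 where t0: "t0 \<in> Z" "\<And>t. t \<in> Z \<Longrightarrow> t0 \<le> t"
      using compact_attains_inf[of Z] by blast
    have x: "\<gamma> t0 \<in> frontier \<Omega>" and "t0 \<in> {0..1}" using t0(1) by (auto simp: Z_def)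
    then have t01: "0 < t0" "t0 < 1"
      using frontier_disjoint[OF x] ends p q by (auto simp: order.order_iff_strict)
    have before: "\<gamma> t \<in> \<Omega>" if "0 \<le> t" "t < t0" for t
    proof -
      have "t \<notin> Z" using t0(2)[of t] that by auto
      then show ?thesis using image that t01 by (auto simp: Z_def image_subset_iff)
    qed
    define c where "c = chart_at A (\<gamma> t0)"
    have c: "c \<in> charts_at A (\<gamma> t0)" unfolding c_def by (rule chart_at)
    note cA = charts_atD[OF c]
    define x0 where "x0 = snd c (\<gamma> t0)"
    define x where "x = (\<lambda>t. snd c (\<gamma> t))"
    define v where "v = (\<lambda>t. velocity A {0..1} \<gamma> t c)"
    obtain e r a L r0 K where "boundary_chart A g \<Omega> \<phi> c x0 e r a L r0 K"
      using boundary_chart_exists[OF x c] unfolding x0_def by blast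
    then interpret B: boundary_chart A g \<Omega> \<phi> c x0 e r a L r0 K .
    have chart0: "x t0 = x0" "chart_\<phi> c x0 = 0" "x0 \<in> cball x0 B.inner_radius"
      using B.inner_radius(1) B.zero by (auto simp: x_def x0_def)
    have "continuous_on (fst c) (snd c)"
      using homeomorphism_cont1[OF chart_homeomorphism[OF cA(1)]] .
    then have "open (fst c \<inter> snd c -` ball x0 B.inner_radius)"
      using open_chart(1)[OF cA(1)] by (intro continuous_open_preimage) auto
    then obtain d where d: "0 < d"
      "\<And>t. t \<in> {0..1} \<Longrightarrow> dist t t0 < d \<Longrightarrow> \<gamma> t \<in> fst c \<inter> snd c -` ball x0 B.inner_radius"
      using continuous_on_near[OF cont, of t0 "fst c \<inter> snd c -` ball x0 B.inner_radius"] t01 cA(2) B.inner_radius(1)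
      by (auto simp: x0_def)
    define d1 where "d1 = min (d / 2) (min t0 (1 - t0))"
    define J where "J = {t0 - d1..t0 + d1}"
    have d1: "0 < d1" "d1 < d" "d1 \<le> t0" "d1 \<le> 1 - t0" using d(1) t01 by (auto simp: d1_def)
    have J01: "J \<subseteq> {0..1}" and t0J: "t0 \<in> J" using d1 by (auto simp: J_def)
    have J: "\<gamma> t \<in> fst c" "x t \<in> ball x0 B.inner_radius" if "t \<in> J" for t
      using d(2)[of t] that J01 d1 by (auto simp: J_def dist_real_def x_def)
    have geoJ: "chart_geodesic c J x v"
      unfolding x_def v_def by (rule geodesic_on_chart[OF geo cA(1) J01 J(1)])
    have xJ: "x ` J \<subseteq> cball x0 B.inner_radius" using J(2) by (force simp: subset_iff)
    note contJ = chart_geodesic_continuous[OF geoJ]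
    have F: "chart_\<phi> c (x t) = \<phi> (\<gamma> t)" if "t \<in> J" for t
      using J(1)[OF that] cA(1) by (simp add: x_def)
    have tangent: "fderiv (chart_\<phi> c) x0 (v t0) = 0"
    proof -
      have "((\<lambda>t. chart_\<phi> c (x t)) has_real_derivative fderiv (chart_\<phi> c) x0 (v t0)) (at t0)"
        using function_along_geodesic(1)[OF \<phi>_C2 cA(1) geoJ t0J] chart0(1) d1
        by (simp add: J_def at_within_Icc_at)
      moreover have "\<forall>t. \<bar>t0 - t\<bar> < d1 \<longrightarrow> chart_\<phi> c (x t0) \<le> chart_\<phi> c (x t)"
      proof (intro allI impI)
        fix t assume "\<bar>t0 - t\<bar> < d1"
        then have t: "t \<in> J" by (auto simp: J_def)
        then have "\<gamma> t \<in> \<Omega> \<union> frontier \<Omega>" using image J01 by blast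
        then have "0 \<le> \<phi> (\<gamma> t)" using \<phi>_pos frontier_eq by (auto intro: less_imp_le)
        then show "chart_\<phi> c (x t0) \<le> chart_\<phi> c (x t)" using F[OF t] chart0 by simp
      qed
      ultimately show ?thesis using d1(1) DERIV_local_min by blast
    qed
    \<comment> \<open>At the contact the foot velocity is the velocity itself, with value in
      \<open>C\<close>; openness of \<open>C\<close> extends this to nearby times.\<close>
    define h where "h t = gform c (B.foot (x t)) (B.foot_velocity (x t) (v t)) (B.foot_velocity (x t) (v t))" for t
    have "(\<lambda>t. B.foot (x t)) ` J \<subseteq> chart_image c" using B.foot_in xJ B.ball_S by blast
    then have h_cont: "continuous_on J h"
      unfolding h_def
      by (intro gform_continuous[OF cA(1)] B.foot_continuous B.foot_velocity_continuous contJ xJ)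
    have "h t0 = gform c x0 (v t0) (v t0)"
      unfolding h_def chart0(1) B.foot_fixed(1)[OF chart0(3,2)] B.foot_velocity_fixed(2)[OF chart0(3,2) tangent] ..
    also have "\<dots> = g (\<gamma> t0) (velocity A {0..1} \<gamma> t0) (velocity A {0..1} \<gamma> t0)"
    proof -
      have "velocity A {0..1} \<gamma> t0 = tangent_of A c (\<gamma> t0) (v t0)"
        unfolding v_def by (rule geodesic_velocity[OF geo _ Icc_nontrivial c]) (use t01 in auto)
      then show ?thesis using metric_tangent_of[OF c, of "v t0" "v t0"] unfolding x0_def by simp
    qed
    also have "\<dots> \<in> C" using causal t01 by simp
    finally obtain d2 where d2: "0 < d2" "\<And>t. t \<in> J \<Longrightarrow> dist t t0 < d2 \<Longrightarrow> h t \<in> C"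
      using continuous_on_near[OF h_cont t0J C] by blast
    have "compact (v ` J)" by (rule compact_continuous_image[OF contJ(2)]) (simp add: J_def)
    then obtain V where V: "\<And>t. t \<in> J \<Longrightarrow> norm (v t) \<le> V"
      using compact_imp_bounded bounded_iff by (metis imageI)
    \<comment> \<open>As \<open>l \<le> 1\<close>, the last bound makes the constant times
      \<open>l * (1 + l)\<close> smaller than 1; halving \<open>d2\<close> gives the strict
      \<open>l < d2\<close>.\<close>
    define l where "l = min d1 (min (d2 / 2) (1 / (2 * (\<bar>B.comparison_const V\<bar> + 1))))"
    have l: "0 < l" "l \<le> d1" "l < d2" "l \<le> 1 / (2 * (\<bar>B.comparison_const V\<bar> + 1))"
      using d1 d2(1) by (auto simp: l_def)
    have l1: "l \<le> 1" using d1 t01 l by linarith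
    have small: "B.comparison_const V * (t0 - (t0 - l)) * (1 + (t0 - (t0 - l))) < 1"
    proof -
      have "B.comparison_const V * l * (1 + l) \<le> \<bar>B.comparison_const V\<bar> * l * 2"
        using l l1 by (intro mult_mono mult_right_mono) auto
      also have "\<dots> < 2 * (\<bar>B.comparison_const V\<bar> + 1) * l" using l(1) by simp
      also have "\<dots> \<le> 1" using l(4) by (simp add: pos_le_divide_eq mult.commute)
      finally show ?thesis by simp
    qed
    have sub: "{t0 - l..t0} \<subseteq> J" using l d1 by (auto simp: J_def)
    have "chart_\<phi> c (x (t0 - l)) \<le> 0"
    proof (rule B.geodesic_barrier[OF conv chart_geodesic_subset[OF geoJ sub] _ _ _ small, of t0])
      show "x ` {t0 - l..t0} \<subseteq> cball x0 B.inner_radius" using xJ sub by blast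
      show "norm (v t) \<le> V" if "t \<in> {t0 - l..t0}" for t using V sub that by blast
      show "gform c (B.foot (x t)) (B.foot_velocity (x t) (v t)) (B.foot_velocity (x t) (v t)) \<in> C"
        if "t \<in> {t0 - l..t0}" for t
        using d2(2)[of t] sub that l by (auto simp: h_def dist_real_def)
    qed (use chart0 tangent l in auto)
    moreover have "0 < chart_\<phi> c (x (t0 - l))"
    proof -
      have "t0 - l \<in> J" using sub l(1) by auto
      moreover have "\<gamma> (t0 - l) \<in> \<Omega>" using before l d1 by simp
      ultimately show ?thesis using F \<phi>_pos by simp
    qed
    ultimately show False by simp
  qed
qed

text \<open>A positive Hessian makes \<phi> positive on both sides of the contact, so a short
  geodesic through \<open>x\<close> has its ends in \<Omega> and \<open>x\<close> at its midpoint,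
  against convexity. The cone property of \<open>C\<close> absorbs the rescalings of the
  velocity.\<close>

lemma geometrically_imp_infinitesimally_convex:
  assumes C: "open C" and cone: "\<And>s k. s \<in> C \<Longrightarrow> 0 < k \<Longrightarrow> k * s \<in> C" and conv: "geometrically_convex_on C"
  shows "infinitesimally_convex_on C"
  unfolding infinitesimally_convex_on_def
proof (intro ballI impI)
  fix x v assume x: "x \<in> frontier \<Omega>" and v: "v \<in> tangent_space A x"
    and tangent: "differential A \<phi> x v = 0" and causal: "g x v v \<in> C"
  show "hessian A g \<phi> x v v \<le> 0"
  proof (rule ccontr)
    assume H: "\<not> hessian A g \<phi> x v v \<le> 0"
    define c where "c = chart_at A x"
    have c: "c \<in> charts_at A x" unfolding c_def by (rule chart_at)
    note cA = charts_atD[OF c]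
    let ?x0 = "snd c x" and ?u = "v c"
    have H: "0 < hess \<phi> c ?x0 ?u" using H hessian_eq_hess[OF \<phi>_C2 v c] by simp
    have G: "gform c ?x0 ?u ?u \<in> C" using metric_tangent_of[OF c, of ?u ?u] tangent_of_component[OF v c] causal by simp
    have D: "fderiv (chart_\<phi> c) ?x0 ?u = 0" using differential_eq[OF \<phi>_C2 v c] tangent by simp
    obtain \<rho> where \<rho>: "0 < \<rho>" "\<And>y. y \<in> cball ?x0 \<rho> \<Longrightarrow> 0 < chart_\<phi> c y \<Longrightarrow> chart_inv c y \<in> \<Omega>"
      using positive_side[OF x c] by blast
    obtain \<delta> where \<delta>: "0 < \<delta>" "\<And>w. norm w \<le> \<delta> \<Longrightarrow> \<exists>x v. x 0 = ?x0 \<and> v 0 = w \<and> chart_geodesic c {- 1..1} x v"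
      using chart_geodesic_exists[OF cA(1,3)] by blast
    \<comment> \<open>Brings the velocity into the range where the geodesic exists on
      \<open>{- 1..1}\<close>; the Hessian, being quadratic, keeps its sign.\<close>
    define s where "s = \<delta> / (norm ?u + 1)"
    have s: "0 < s" "norm (s *\<^sub>R ?u) \<le> \<delta>" using \<delta>(1) by (auto simp: s_def field_simps add_pos_nonneg)
    obtain X V where XV: "X 0 = ?x0" "V 0 = s *\<^sub>R ?u" and geo: "chart_geodesic c {- 1..1} X V"
      using \<delta>(2)[OF s(2)] by blast
    note cont = chart_geodesic_continuous[OF geo]
    have X_img: "X ` {- 1..1} \<subseteq> chart_image c" using chart_geodesicD(1)[OF geo] by blast
    have "continuous_on {- 1..1} (\<lambda>t. hess \<phi> c (X t) (V t))"
      by (rule hess_continuous[OF \<phi>_C2 cA(1) cont(1) X_img cont(2)])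
    from continuous_on_near[OF this, of 0 "{0<..}"] obtain d1 where d1: "0 < d1"
      "\<And>t. t \<in> {- 1..1} \<Longrightarrow> \<bar>t\<bar> < d1 \<Longrightarrow> 0 < hess \<phi> c (X t) (V t)"
      using H s(1) by (auto simp: XV hess_scale[OF \<phi>_C2 cA(1,3)])
    have "continuous_on {- 1..1} (\<lambda>t. gform c (X t) (V t) (V t))"
      by (rule gform_continuous[OF cA(1) cont(1,2,2) X_img])
    from continuous_on_near[OF this, of 0 C] obtain d2 where d2: "0 < d2"
      "\<And>t. t \<in> {- 1..1} \<Longrightarrow> \<bar>t\<bar> < d2 \<Longrightarrow> gform c (X t) (V t) (V t) \<in> C"
      using C cone[OF G, of "s * s"] s(1) by (auto simp: XV gform_scale)
    from continuous_on_near[OF cont(1), of 0 "ball ?x0 \<rho>"] obtain d3 where d3: "0 < d3"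
      "\<And>t. t \<in> {- 1..1} \<Longrightarrow> \<bar>t\<bar> < d3 \<Longrightarrow> X t \<in> ball ?x0 \<rho>"
      using \<rho>(1) by (auto simp: XV)
    define d where "d = min 1 (min (d1 / 2) (min (d2 / 2) (d3 / 2)))"
    have d: "0 < d" "d \<le> 1" "d < d1" "d < d2" "d < d3" using d1(1) d2(1) d3(1) by (auto simp: d_def)
    have sub: "{- d..d} \<subseteq> {- 1..1}" using d by auto
    have pos: "0 < chart_\<phi> c (X t)" if t: "t \<in> {- d..d}" "t \<noteq> 0" for t
    proof (rule positive_of_second_derivative_pos[OF _ _ _ _ _ _ t])
      note F = function_along_geodesic[OF \<phi>_C2 cA(1) chart_geodesic_subset[OF geo sub]]
      show "((\<lambda>t. chart_\<phi> c (X t)) has_real_derivative fderiv (chart_\<phi> c) (X t) (V t)) (at t within {- d..d})"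
        if "t \<in> {- d..d}" for t by (rule F(1)[OF that])
      show "((\<lambda>t. fderiv (chart_\<phi> c) (X t) (V t)) has_real_derivative hess \<phi> c (X t) (V t)) (at t within {- d..d})"
        if "t \<in> {- d..d}" for t by (rule F(2)[OF that])
      show "0 < hess \<phi> c (X t) (V t)" if "t \<in> {- d..d}" for t
        using that d by (intro d1(2)) auto
      show "chart_\<phi> c (X 0) = 0" using XV x c frontier_eq by simp
      show "fderiv (chart_\<phi> c) (X 0) (V 0) = 0"
        unfolding XV using D linear_cmul[OF C2_derivative_linear[OF chart_\<phi>_C2[OF cA(1)] cA(3)]] by simp
    qed (use d in auto)
    have in_\<Omega>: "chart_inv c (X t) \<in> \<Omega>" if t: "t \<in> {- d..d}" "t \<noteq> 0" for t
    proof -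
      have "X t \<in> ball ?x0 \<rho>" using t d by (intro d3(2)) auto
      then show ?thesis using \<rho>(2)[of "X t"] pos[OF t] by auto
    qed
    \<comment> \<open>Affine map from \<open>{0..1}\<close> onto \<open>{- d..d}\<close>; the
      contact time 0 sits at parameter 1/2.\<close>
    let ?X = "\<lambda>t. X (- d + 2 * d * t)" and ?V = "\<lambda>t. (2 * d) *\<^sub>R V (- d + 2 * d * t)"
    let ?\<gamma> = "chart_inv c \<circ> ?X"
    have range: "- d + 2 * d * t \<in> {- d..d}" if "t \<in> {0..1}" for t
      using that d(1) mult_left_mono[of t 1 "2 * d"] by auto
    have "(\<lambda>t. - d + 2 * d * t) ` {0..1} \<subseteq> {- 1..1}" using range sub by blast
    from chart_geodesic_affine[OF geo this] have geo': "chart_geodesic c {0..1} ?X ?V" .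
    have nt: "at t within {0..1} \<noteq> bot" if "t \<in> {0..1}" for t :: real
      using Icc_nontrivial[OF zero_less_one that] .
    note \<gamma> = chart_geodesic_on[OF cA(1) geo' nt]
    have "geodesic_arc A g (?\<gamma> 0) (?\<gamma> 1) ?\<gamma>" using \<gamma>(1) by (simp add: geodesic_arc_def)
    moreover have "?\<gamma> 0 \<in> \<Omega>" "?\<gamma> 1 \<in> \<Omega>" using in_\<Omega>[of "- d"] in_\<Omega>[of d] d(1) by auto
    moreover have "g (?\<gamma> t) (velocity A {0..1} ?\<gamma> t) (velocity A {0..1} ?\<gamma> t) \<in> C" if t: "t \<in> {0..1}" for t
    proof -
      let ?s = "- d + 2 * d * t"
      have s1: "?s \<in> {- 1..1}" using range[OF t] sub by blast
      have "\<bar>?s\<bar> \<le> d" using range[OF t] unfolding atLeastAtMost_iff by linarith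
      then have "gform c (X ?s) (V ?s) (V ?s) \<in> C" using d by (intro d2(2)[OF s1]) linarith
      then have "gform c (X ?s) (?V t) (?V t) \<in> C" using cone[of _ "2 * d * (2 * d)"] d(1) by (simp add: gform_scale)
      moreover have "X ?s \<in> chart_image c" using chart_geodesicD(1)[OF geo s1] .
      ultimately show ?thesis
        using metric_tangent_of[OF charts_at_chart_inv[OF cA(1)], of "X ?s" "?V t" "?V t"] \<gamma>(2)[OF _ t] cA(1) by simp
    qed
    moreover have "?\<gamma> ` {0..1} \<subseteq> \<Omega> \<union> frontier \<Omega>"
    proof
      fix y assume "y \<in> ?\<gamma> ` {0..1}"
      then obtain t where t: "t \<in> {0..1}" "y = chart_inv c (X (- d + 2 * d * t))" by auto
      show "y \<in> \<Omega> \<union> frontier \<Omega>"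
      proof (cases "- d + 2 * d * t = 0")
        case True
        then have "y = x" unfolding t(2) True XV(1) using c by simp
        then show ?thesis using x by simp
      next
        case False
        then show ?thesis using in_\<Omega>[OF range[OF t(1)]] t(2) by simp
      qed
    qed
    ultimately have "?\<gamma> ` {0..1} \<subseteq> \<Omega>"
      using conv unfolding geometrically_convex_on_def by blast
    moreover have "?\<gamma> (1 / 2) = x" using XV(1) c by simp
    ultimately have "x \<in> \<Omega>" by (metis (no_types, lifting) atLeastAtMost_iff divide_le_eq_1_pos imageI in_mono
        one_le_numeral zero_le_divide_1_iff zero_le_numeral zero_less_numeral)
    then show False using frontier_disjoint[OF x] by simp
  qed
qed

text \<open>Here geodesics are followed for unit time, so smallness has to come from the initial
  velocity: as it shrinks, the geodesic stays in the chart and the barrier constant tends to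
  0.\<close>

lemma infinitesimally_imp_locally_convex:
  assumes conv: "infinitesimally_convex_on UNIV"
  shows "locally_convex A g \<Omega>"
  unfolding locally_convex_def
proof
  fix x assume x: "x \<in> frontier \<Omega>"
  define c where "c = chart_at A x"
  have c: "c \<in> charts_at A x" unfolding c_def by (rule chart_at)
  note cA = charts_atD[OF c]
  let ?T = "tangent_space_sub A (frontier \<Omega>) x"
  note T_eq = tangent_space_sub_frontier[OF x]
  obtain e r a L r0 K where "boundary_chart A g \<Omega> \<phi> c (snd c x) e r a L r0 K"
    using boundary_chart_exists[OF x c] by blast
  then interpret B: boundary_chart A g \<Omega> \<phi> c "snd c x" e r a L r0 K .
  obtain \<delta>0 where \<delta>0: "0 < \<delta>0" "\<And>w. norm w \<le> \<delta>0 \<Longrightarrow> \<exists>y v. y 0 = snd c x \<and> v 0 = w \<and> chart_geodesic c {- 1..1} y v"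
    using chart_geodesic_exists[OF cA(1,3)] by blast
  have lim: "((\<lambda>\<delta>. k * \<delta>) \<longlongrightarrow> 0) (at_right 0)" for k :: real
    by (auto intro!: tendsto_eq_intros)
  have lim': "((\<lambda>\<delta>. 2 * B.comparison_const (2 * \<delta>)) \<longlongrightarrow> 0) (at_right 0)"
    unfolding B.comparison_const_def B.foot_speed_bound_def
    using B.a_pos by (auto intro!: tendsto_eq_intros)
  \<comment> \<open>\<open>2 * \<delta>\<close> is the speed bound of \<open>geodesic_small\<close>,
    and the outer factor 2 is \<open>(q - p) * (1 + (q - p))\<close> for the unit interval.\<close>
  have "\<forall>\<^sub>F \<delta> in at_right 0. 0 < \<delta> \<and> 1 * \<delta> < \<delta>0 \<and> 2 * \<delta> < r0 \<and> 2 * \<delta> < B.inner_radius \<and> (4 * K) * \<delta> < 1 \<and>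
      2 * B.comparison_const (2 * \<delta>) < 1"
    using \<delta>0(1) gamma_boundedD(1)[OF B.gamma] B.inner_radius(1)
    by (intro eventually_conj order_tendstoD(2)[OF lim] order_tendstoD(2)[OF lim'] eventually_at_right_less) auto
  then obtain \<delta> where \<delta>: "0 < \<delta>" "\<delta> < \<delta>0" "2 * \<delta> < r0" "2 * \<delta> < B.inner_radius" "4 * K * \<delta> < 1"
      "2 * B.comparison_const (2 * \<delta>) < 1"
    using eventually_happens[of _ "at_right (0::real)"] by (metis (no_types, lifting) mult_1 trivial_limit_at_right_real)
  let ?U = "{v :: ('a, 'n) tangent. norm (v c) < \<delta>}"
  have "open ?U"
    by (intro open_Collect_less continuous_intros continuous_on_product_coordinates)
  then have "openin (top_of_set ?T) (?T \<inter> ?U)" by (rule openin_open_Int)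
  moreover have "zero_tangent \<in> ?T \<inter> ?U"
  proof -
    have zero: "zero_tangent \<in> tangent_space A x" using tangent_of_in[OF c, of 0] tangent_of_zero[OF c] by simp
    moreover have "differential A \<phi> x zero_tangent = 0"
      using differential_eq[OF \<phi>_C2 zero c] linear_0[OF C2_derivative_linear[OF chart_\<phi>_C2[OF cA(1)] cA(3)]]
      by (simp add: zero_tangent_def)
    ultimately show ?thesis using \<delta>(1) by (simp add: T_eq) (simp add: zero_tangent_def)
  qed
  moreover have "v \<in> exp_domain A g x \<and> exp_map A g x v \<in> - \<Omega>" if vTU: "v \<in> ?T \<inter> ?U" for v
  proof -
    have v: "v \<in> tangent_space A x" "differential A \<phi> x v = 0" "norm (v c) < \<delta>" using vTU by (auto simp: T_eq)
    obtain X V where XV: "X 0 = snd c x" "V 0 = v c" and geo: "chart_geodesic c {- 1..1} X V"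
      using \<delta>0(2)[of "v c"] v(3) \<delta>(2) by auto
    have geo01: "chart_geodesic c {0..1} X V" by (rule chart_geodesic_subset[OF geo]) simp
    note \<gamma> = chart_geodesic_on[OF cA(1) geo01 Icc_nontrivial[OF zero_less_one]]
    have "velocity A {0..1} (chart_inv c \<circ> X) 0 = v"
      using \<gamma>(2)[of 0] XV c tangent_of_component[OF v(1) c] by simp
    then have ex: "exp_geodesic A g x v (chart_inv c \<circ> X)"
      using \<gamma>(1) XV(1) c by (simp add: exp_geodesic_def)
    \<comment> \<open>The constructed geodesic shows that the exponential is defined at
      \<open>v\<close>. The one selected by \<open>exp_map\<close> is controlled by
      \<open>geodesic_small\<close>, which applies to any geodesic with these initial data.\<close>
    define \<gamma> where "\<gamma> = (SOME \<gamma>. exp_geodesic A g x v \<gamma>)"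
    have "exp_geodesic A g x v \<gamma>"
      unfolding \<gamma>_def using someI[of "exp_geodesic A g x v"] ex by blast
    then have geo: "geodesic_on A g {0..1} \<gamma>" and start: "\<gamma> 0 = x" "velocity A {0..1} \<gamma> 0 = v"
      by (auto simp: exp_geodesic_def)
    note small = geodesic_small[OF cA(1) _ \<delta>(1,3,5) geo, unfolded start, OF B.gamma cA(2) less_imp_le[OF v(3)]]
    let ?X = "\<lambda>t. snd c (\<gamma> t)" and ?V = "\<lambda>t. velocity A {0..1} \<gamma> t c"
    have geoc: "chart_geodesic c {0..1} ?X ?V"
      by (rule geodesic_on_chart[OF geo cA(1) order_refl small(1)])
    have "chart_\<phi> c (?X 1) \<le> 0"
    proof (rule B.geodesic_barrier[OF conv geoc, where V = "2 * \<delta>" and s = 0])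
      show "?X ` {0..1} \<subseteq> cball (snd c x) B.inner_radius"
        using small(2) \<delta>(4) by (fastforce simp: image_subset_iff)
      show "norm (?V t) \<le> 2 * \<delta>" if "t \<in> {0..1}" for t by (rule small(3)[OF that])
      show "B.comparison_const (2 * \<delta>) * (1 - 0) * (1 + (1 - 0)) < 1" using \<delta>(6) by simp
      show "chart_\<phi> c (?X 0) = 0" using start(1) B.zero by simp
      show "fderiv (chart_\<phi> c) (?X 0) (?V 0) = 0"
        unfolding start using differential_eq[OF \<phi>_C2 v(1) c] v(2) by simp
    qed auto
    moreover have "\<gamma> 1 \<in> fst c" using small(1) by simp
    ultimately have "\<phi> (\<gamma> 1) \<le> 0" using cA(1) by simp
    then have "exp_map A g x v \<notin> \<Omega>" using \<phi>_pos unfolding exp_map_def \<gamma>_def[symmetric] by fastforce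
    then show ?thesis using v(1) ex by (auto simp: exp_domain_def)
  qed
  ultimately show "\<exists>O'. openin (top_of_set ?T) O' \<and> zero_tangent \<in> O' \<and> O' \<subseteq> exp_domain A g x \<and> exp_map A g x ` O' \<subseteq> - \<Omega>"
    by (intro exI[of _ "?T \<inter> ?U"]) blast
qed

text \<open>If the Hessian is positive on \<open>v\<close>, the geodesic with initial velocity
  \<open>s v\<close> is in \<Omega> at time 1 for small \<open>s > 0\<close>, although
  \<open>s v\<close> lies in \<open>O'\<close>. Positivity of the Hessian up to time 1 is tested on
  the velocity divided by \<open>s\<close>, which stays close to \<open>v\<close>.\<close>

lemma locally_imp_infinitesimally_convex:
  assumes conv: "locally_convex A g \<Omega>"
  shows "infinitesimally_convex_on UNIV"
  unfolding infinitesimally_convex_on_def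
proof (intro ballI impI)
  fix x v assume x: "x \<in> frontier \<Omega>" and v: "v \<in> tangent_space A x" and tangent: "differential A \<phi> x v = 0"
  show "hessian A g \<phi> x v v \<le> 0"
  proof (rule ccontr)
    assume H: "\<not> hessian A g \<phi> x v v \<le> 0"
    define c where "c = chart_at A x"
    have c: "c \<in> charts_at A x" unfolding c_def by (rule chart_at)
    note cA = charts_atD[OF c]
    let ?x0 = "snd c x" and ?u = "v c"
    have H: "0 < hess \<phi> c ?x0 ?u" using H hessian_eq_hess[OF \<phi>_C2 v c] by simp
    have D: "fderiv (chart_\<phi> c) ?x0 ?u = 0" using differential_eq[OF \<phi>_C2 v c] tangent by simp
    note D_lin = C2_derivative_linear[OF chart_\<phi>_C2[OF cA(1)] cA(3)]
    obtain \<rho> where \<rho>: "0 < \<rho>" "\<And>y. y \<in> cball ?x0 \<rho> \<Longrightarrow> 0 < chart_\<phi> c y \<Longrightarrow> chart_inv c y \<in> \<Omega>"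
      using positive_side[OF x c] by blast
    obtain r K where b: "gamma_bounded c ?x0 r K" using gamma_bounded_exists[OF cA(1,3)] by blast
    \<comment> \<open>Joint continuity in point and vector, since both move along the
      geodesic.\<close>
    have "continuous_on (chart_image c \<times> UNIV) (\<lambda>p. hess \<phi> c (fst p) (snd p))"
      by (rule hess_continuous[OF \<phi>_C2 cA(1)]) (auto intro!: continuous_intros)
    from continuous_on_near[OF this, of "(?x0, ?u)" "{0<..}"] obtain \<eta> where \<eta>: "0 < \<eta>"
      "\<And>y w. y \<in> chart_image c \<Longrightarrow> dist (y, w) (?x0, ?u) < \<eta> \<Longrightarrow> 0 < hess \<phi> c y w"
      using H cA(3) by auto
    obtain O' where O': "openin (top_of_set (tangent_space_sub A (frontier \<Omega>) x)) O'" "zero_tangent \<in> O'"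
      "O' \<subseteq> exp_domain A g x" "exp_map A g x ` O' \<subseteq> - \<Omega>"
      using conv x unfolding locally_convex_def by blast
    obtain U where U: "open U" "O' = tangent_space_sub A (frontier \<Omega>) x \<inter> U"
      using O'(1) by (auto simp: openin_open)
    have "continuous_on UNIV (\<lambda>s::real. (\<lambda>d. s *\<^sub>R v d))"
      by (intro continuous_on_coordinatewise_then_product continuous_intros)
    from continuous_on_near[OF this, of 0 U] obtain s1 where s1: "0 < s1" "\<And>s. \<bar>s\<bar> < s1 \<Longrightarrow> (\<lambda>d. s *\<^sub>R v d) \<in> U"
      using U O'(2) by (auto simp: zero_tangent_def)
    have lim: "((\<lambda>s. k * s) \<longlongrightarrow> 0) (at_right 0)" for k :: real
      by (auto intro!: tendsto_eq_intros)
    \<comment> \<open>The last bound comes from the velocity drift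
      \<open>4 * K * ?\<delta> * ?\<delta>\<close> in \<open>geodesic_small\<close> with
      \<open>?\<delta> = norm ?u * s\<close>: after division by \<open>s\<close> one factor
      \<open>s\<close> is left.\<close>
    have "\<forall>\<^sub>F s in at_right 0. 0 < s \<and> 1 * s < s1 \<and> (2 * norm ?u) * s < r \<and> (2 * norm ?u) * s < \<rho> \<and>
        (4 * K * norm ?u) * s < 1 \<and> (2 * norm ?u) * s < \<eta> / 2 \<and> (4 * K * norm ?u * norm ?u) * s < \<eta> / 2"
      using s1(1) gamma_boundedD(1)[OF b] \<rho>(1) \<eta>(1)
      by (intro eventually_conj order_tendstoD(2)[OF lim] eventually_at_right_less) auto
    then obtain s where s: "0 < s" "s < s1" "2 * norm ?u * s < r" "2 * norm ?u * s < \<rho>" "4 * K * norm ?u * s < 1"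
        "2 * norm ?u * s < \<eta> / 2" "4 * K * norm ?u * norm ?u * s < \<eta> / 2"
      using eventually_happens[of _ "at_right (0::real)"] by (metis (no_types, lifting) mult_1 trivial_limit_at_right_real)
    define w where "w = (\<lambda>d. s *\<^sub>R v d)"
    have wc: "w c = s *\<^sub>R ?u" by (simp add: w_def)
    have w: "w = tangent_of A c x (s *\<^sub>R ?u)"
      using tangent_of_combination[OF c, of s ?u 0 0] tangent_of_component[OF v c] by (simp add: w_def)
    have w_T: "w \<in> tangent_space A x" unfolding w by (rule tangent_of_in[OF c])
    have Dw: "fderiv (chart_\<phi> c) ?x0 (w c) = 0" unfolding wc using D linear_cmul[OF D_lin] by simp
    have "w \<in> O'"
      using s1(2)[of s] s(1,2) w_T Dw differential_eq[OF \<phi>_C2 w_T c] tangent_space_sub_frontier[OF x] U(2)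
      by (simp add: w_def[symmetric])
    then obtain \<gamma>0 where "exp_geodesic A g x w \<gamma>0" using O'(3) by (auto simp: exp_domain_def)
    define \<gamma> where "\<gamma> = (SOME \<gamma>. exp_geodesic A g x w \<gamma>)"
    have "exp_geodesic A g x w \<gamma>"
      unfolding \<gamma>_def using someI[of "exp_geodesic A g x w"] \<open>exp_geodesic A g x w \<gamma>0\<close> by blast
    then have geo: "geodesic_on A g {0..1} \<gamma>" and start: "\<gamma> 0 = x" "velocity A {0..1} \<gamma> 0 = w"
      by (auto simp: exp_geodesic_def)
    have exp: "exp_map A g x w = \<gamma> 1" by (simp add: exp_map_def \<gamma>_def)
    have u: "?u \<noteq> 0"
    proof
      assume "?u = 0"
      then show False using H hess_scale[OF \<phi>_C2 cA(1,3), of 0 ?u] by simp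
    qed
    let ?\<delta> = "norm ?u * s"
    have \<delta>: "0 < ?\<delta>" "2 * ?\<delta> < r" "4 * K * ?\<delta> < 1" "norm (w c) \<le> ?\<delta>" using u s by (auto simp: wc mult_ac)
    note small = geodesic_small[OF cA(1) _ \<delta>(1,2,3) geo, unfolded start, OF b cA(2) \<delta>(4)]
    let ?X = "\<lambda>t. snd c (\<gamma> t)" and ?V = "\<lambda>t. velocity A {0..1} \<gamma> t c"
    have geoc: "chart_geodesic c {0..1} ?X ?V"
      by (rule geodesic_on_chart[OF geo cA(1) order_refl small(1)])
    have hess_pos: "0 < hess \<phi> c (?X t) (?V t)" if t: "t \<in> {0..1}" for t
    proof -
      have X: "?X t \<in> chart_image c" using chart_geodesicD(1)[OF geoc t] .
      have "(1 / s) *\<^sub>R ?V t - ?u = (1 / s) *\<^sub>R (?V t - w c)"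
        using s(1) unfolding wc by (simp add: scaleR_diff_right)
      then have "norm ((1 / s) *\<^sub>R ?V t - ?u) = (1 / s) * norm (?V t - w c)"
        using s(1) by simp
      also have "\<dots> \<le> (1 / s) * (4 * K * ?\<delta> * ?\<delta>)"
        using small(4)[OF t] s(1) by (intro mult_left_mono) auto
      also have "\<dots> = 4 * K * norm ?u * norm ?u * s" using s(1) by (simp add: field_simps)
      also have "\<dots> < \<eta> / 2" by (rule s(7))
      finally have "norm ((1 / s) *\<^sub>R ?V t - ?u) < \<eta> / 2" .
      moreover have "norm (?X t - ?x0) < \<eta> / 2"
        using small(2)[OF t] s(6) by (simp add: dist_norm norm_minus_commute mult_ac)
      ultimately have "dist (?X t, (1 / s) *\<^sub>R ?V t) (?x0, ?u) < \<eta>"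
        using norm_Pair_le[of "?X t - ?x0" "(1 / s) *\<^sub>R ?V t - ?u"] by (simp add: dist_norm)
      from \<eta>(2)[OF X this] have "0 < s * s * hess \<phi> c (?X t) ((1 / s) *\<^sub>R ?V t)" using s(1) by simp
      also have "\<dots> = hess \<phi> c (?X t) (?V t)"
        using hess_scale[OF \<phi>_C2 cA(1) X, of s "(1 / s) *\<^sub>R ?V t"] s(1) by simp
      finally show ?thesis .
    qed
    have "0 < chart_\<phi> c (?X 1)"
    proof (rule positive_of_second_derivative_pos[OF function_along_geodesic[OF \<phi>_C2 cA(1) geoc] hess_pos, where m = 0])
      show "chart_\<phi> c (?X 0) = 0" using start(1) x c frontier_eq by simp
      show "fderiv (chart_\<phi> c) (?X 0) (?V 0) = 0" unfolding start by (rule Dw)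
    qed auto
    moreover have "?X 1 \<in> cball ?x0 \<rho>" using small(2)[of 1] s(4) by (simp add: mult_ac)
    ultimately have "chart_inv c (?X 1) \<in> \<Omega>" by (rule \<rho>(2)[rotated])
    then have "exp_map A g x w \<in> \<Omega>" using small(1)[of 1] cA(1) exp by simp
    then show False using O'(4) \<open>w \<in> O'\<close> by blast
  qed
qed

lemma infinitesimally_iff_geometrically_convex:
  assumes "open C" "\<And>s k. s \<in> C \<Longrightarrow> 0 < k \<Longrightarrow> k * s \<in> C"
  shows "infinitesimally_convex_on C \<longleftrightarrow> geometrically_convex_on C"
  using infinitesimally_imp_geometrically_convex[OF assms(1)] geometrically_imp_infinitesimally_convex[OF assms]
  by blast

lemma infinitesimally_convex_iff:
  "infinitesimally_convex A g \<phi> \<Omega> \<longleftrightarrow> infinitesimally_convex_on UNIV"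
  "time_infinitesimally_convex A g \<phi> \<Omega> \<longleftrightarrow> infinitesimally_convex_on {..<0}"
  "space_infinitesimally_convex A g \<phi> \<Omega> \<longleftrightarrow> infinitesimally_convex_on {0<..}"
  unfolding infinitesimally_convex_def time_infinitesimally_convex_def space_infinitesimally_convex_def
    infinitesimally_convex_on_def timelike_iff spacelike_iff
  by (auto simp: tangent_space_sub_frontier)

text \<open>\<open>timelike\<close> and \<open>spacelike\<close> also ask that the velocity be a
  tangent vector; the fact \<open>*\<close> supplies this along any geodesic arc, and the sign
  condition becomes membership in \<open>C\<close>.\<close>

lemma geometrically_convex_iff:
  "geometrically_convex A g \<Omega> \<longleftrightarrow> geometrically_convex_on UNIV"
  "time_geometrically_convex A g \<Omega> \<longleftrightarrow> geometrically_convex_on {..<0}"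
  "space_geometrically_convex A g \<Omega> \<longleftrightarrow> geometrically_convex_on {0<..}"
proof -
  have *: "velocity A {0..1} \<gamma> t \<in> tangent_space A (\<gamma> t)" if "geodesic_arc A g p q \<gamma>" "t \<in> {0..1}" for p q \<gamma> t
    using that geodesic_velocity_in_tangent_space[of 0 1] by (simp add: geodesic_arc_def)
  show "geometrically_convex A g \<Omega> \<longleftrightarrow> geometrically_convex_on UNIV"
    "time_geometrically_convex A g \<Omega> \<longleftrightarrow> geometrically_convex_on {..<0}"
    "space_geometrically_convex A g \<Omega> \<longleftrightarrow> geometrically_convex_on {0<..}"
    unfolding geometrically_convex_def time_geometrically_convex_def space_geometrically_convex_def
      geometrically_convex_on_def timelike_iff spacelike_iff
    by (simp; blast intro: *)+
qed

end

theorem corollary4p5: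
  fixes A :: "('a::{t2_space,second_countable_topology}, 'n::finite) chart set"
    and g :: "('a, 'n) metric"
    and \<Omega> :: "'a set"
    and \<phi> :: "'a \<Rightarrow> real"
  assumes "semi_riemannian_manifold A g"
    and "open \<Omega>"
    and "C2_function A \<phi>"
    and "regular_value A \<phi> 0"
    and "frontier \<Omega> = \<phi> -` {0}"
    and "\<forall>x\<in>\<Omega>. \<phi> x > 0"
  shows "(locally_convex A g \<Omega> \<longleftrightarrow> infinitesimally_convex A g \<phi> \<Omega>) \<and>
         (infinitesimally_convex A g \<phi> \<Omega> \<longleftrightarrow> geometrically_convex A g \<Omega>) \<and>
         (time_infinitesimally_convex A g \<phi> \<Omega> \<longleftrightarrow> time_geometrically_convex A g \<Omega>) \<and>
         (space_infinitesimally_convex A g \<phi> \<Omega> \<longleftrightarrow> space_geometrically_convex A g \<Omega>)"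
proof -
  interpret convexity_setting A g \<Omega> \<phi>
    by unfold_locales (use assms in \<open>auto simp: semi_riemannian_manifold_def\<close>)
  show ?thesis
    unfolding infinitesimally_convex_iff geometrically_convex_iff
    using infinitesimally_imp_locally_convex locally_imp_infinitesimally_convex
    by (intro conjI infinitesimally_iff_geometrically_convex) (auto simp: mult_pos_neg)
qed

end
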